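(* Let $q,r\ge2$ be integers and let $(S_n)$ be an increasing family of tetrahedra in $\mathrm{DL}(q,r)$, $S_n$ having height $n$, whose union is $\mathrm{DL}(q,r)$. Let $\tilde\mu_n$ and $\tilde\mu_{|n}$ be the cumulative spectral measures associated, respectively, with simple random walk on $S_n$ and with the truncation to $S_n$ of the simple random walk operator on $\mathrm{DL}(q,r)$. If $r=q$, then both sequences $\tilde\mu_n$ and $\tilde\mu_{|n}$ converge weakly to the Plancherel measure of $\mathrm{DL}(q,q)$. If $r\ne q$, then $\tilde\mu_{|n}$ does not converge weakly to the Plancherel measure of $\mathrm{DL}(q,r)$.
   Context: Trees. For an integer $p\ge2$, $\mathbb T_p$ is the homogeneous tree of degree $p+1$ with a chosen root $o$ and a chosen reference end $\omega$ (an end is an equivalence class of geodesic rays, two rays being equivalent if their supports have finite symmetric difference). For a vertex $x$, $\overline{x\,\omega}$ is the unique geodesic ray from $x$ representing $\omega$; for vertices $v,z$ the confluent $b=v\curlywedge z$ is defined by $\overline{v\,\omega}\cap\overline{z\,\omega}=\overline{b\,\omega}$. Write $z\preccurlyeq v$ if $z\curlywedge v=z$. The Busemann function is $\mathfrak h(x)=d(x,x\curlywedge o)-d(o,x\curlywedge o)$. Diestel-Leader graph. Let $\mathbb T_q$, $\mathbb T_r$ have roots $o_1,o_2$ and reference ends $\omega_1,\omega_2$. $\mathrm{DL}(q,r)$ has vertex set $\{x_1x_2\in\mathbb T_q\times\mathbb T_r:\mathfrak h(x_1)+\mathfrak h(x_2)=0\}$, with $x_1x_2\sim y_1y_2$ iff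 $x_1\sim y_1$ and $x_2\sim y_2$. It is $(q+r)$-regular and vertex-transitive; $o=o_1o_2$. For $a_1\in\mathbb T_q$, $a_2\in\mathbb T_r$ with $-\mathfrak h(a_2)=\mathfrak h(a_1)+n$, $n\ge0$, the tetrahedron $S(a_1,a_2)$ of height $n$ is the induced subgraph $\{x_1x_2\in\mathrm{DL}(q,r):a_1\preccurlyeq x_1,\ a_2\preccurlyeq x_2\}$. Measures. Simple random walk (SRW) on a graph has transition probabilities $p(x,y)=1/\deg(x)$ for $y\sim x$, $0$ otherwise. $P$ is the SRW operator on $\mathrm{DL}(q,r)$, self-adjoint on $\ell^2$, with resolution of the identity $E$; the Plancherel measure is $\mu_{o,o}(d\lambda)=\langle\delta_o,E(d\lambda)\delta_o\rangle$. $P_n$ is the SRW operator of the finite graph $S_n$ ($n\ge1$), using degrees in $S_n$; $P_{|n}=(p(x,y))_{x,y\in S_n}$ is the truncation of $P$. Then $\tilde\mu_n=\frac1{|S_n|}\sum_{\lambda\in\mathrm{spec}(P_n)}\mathrm{mult}(\lambda)\delta_\lambda$ and $\tilde\mu_{|n}=\frac1{|S_n|}\sum_{\lambda\in\mathrm{spec}(P_{|n})}\mathrm{mult}(\lambda)\delta_\lambda$, with $\mathrm{mult}(\lambda)$ the multiplicity of the eigenvalue $\lambda$. *)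

theory Defs
  imports "HOL-Probability.Probability" "HOL-Library.Function_Algebras"
begin

section \<open>Homogeneous trees with a root and a reference end\<close>

text \<open>The vertices of a tree are all the elements of its vertex type.\<close>

definition graph_dist :: "('a \<Rightarrow> 'a \<Rightarrow> bool) \<Rightarrow> 'a \<Rightarrow> 'a \<Rightarrow> nat" where
  "graph_dist A x y = (LEAST n. (A ^^ n) x y)"

definition is_tree :: "('a \<Rightarrow> 'a \<Rightarrow> bool) \<Rightarrow> bool" where
  "is_tree A \<longleftrightarrow> irreflp A \<and> symp A \<and> (\<forall>x y. A\<^sup>*\<^sup>* x y) \<and>
     \<not> (\<exists>xs. 3 \<le> length xs \<and> distinct xs \<and> successively A xs \<and> A (last xs) (hd xs))"

definition geodesic_ray :: "('a \<Rightarrow> 'a \<Rightarrow> bool) \<Rightarrow> (nat \<Rightarrow> 'a) \<Rightarrow> bool" where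
  "geodesic_ray A f \<longleftrightarrow> (\<forall>m n. m \<le> n \<longrightarrow> graph_dist A (f m) (f n) = n - m)"

definition ray_equiv :: "('a \<Rightarrow> 'a \<Rightarrow> bool) \<Rightarrow> ((nat \<Rightarrow> 'a) \<times> (nat \<Rightarrow> 'a)) set" where
  "ray_equiv A = {(f, g). geodesic_ray A f \<and> geodesic_ray A g \<and>
     finite ((range f - range g) \<union> (range g - range f))}"

definition tree_ends :: "('a \<Rightarrow> 'a \<Rightarrow> bool) \<Rightarrow> (nat \<Rightarrow> 'a) set set" where
  "tree_ends A = {f. geodesic_ray A f} // ray_equiv A"

record 'a end_tree =
  tadj :: "'a \<Rightarrow> 'a \<Rightarrow> bool"
  troot :: 'a
  tend :: "(nat \<Rightarrow> 'a) set"

definition homogeneous_end_tree :: "nat \<Rightarrow> 'a end_tree \<Rightarrow> bool" where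
  "homogeneous_end_tree p T \<longleftrightarrow> is_tree (tadj T) \<and>
     (\<forall>x. finite {y. tadj T x y} \<and> card {y. tadj T x y} = p + 1) \<and> tend T \<in> tree_ends (tadj T)"

definition ray_from :: "'a end_tree \<Rightarrow> 'a \<Rightarrow> (nat \<Rightarrow> 'a)" where
  "ray_from T x = (THE f. f \<in> tend T \<and> f 0 = x)"

definition confluent :: "'a end_tree \<Rightarrow> 'a \<Rightarrow> 'a \<Rightarrow> 'a" where
  "confluent T v z =
     (THE b. range (ray_from T v) \<inter> range (ray_from T z) = range (ray_from T b))"

definition tree_le :: "'a end_tree \<Rightarrow> 'a \<Rightarrow> 'a \<Rightarrow> bool" where
  "tree_le T z v \<longleftrightarrow> confluent T z v = z"

definition busemann :: "'a end_tree \<Rightarrow> 'a \<Rightarrow> int" where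
  "busemann T x =
     int (graph_dist (tadj T) x (confluent T x (troot T)))
     - int (graph_dist (tadj T) (troot T) (confluent T x (troot T)))"

section \<open>Diestel--Leader graphs and tetrahedra\<close>

definition DL :: "'a end_tree \<Rightarrow> 'b end_tree \<Rightarrow> ('a \<times> 'b) set" where
  "DL T1 T2 = {(x1, x2). busemann T1 x1 + busemann T2 x2 = 0}"

text \<open>Adjacency is only ever used between elements of the vertex set \<open>DL T1 T2\<close>
  or of subsets of it, so induced subgraphs share the relation.\<close>

definition DL_adj :: "'a end_tree \<Rightarrow> 'b end_tree \<Rightarrow> 'a \<times> 'b \<Rightarrow> 'a \<times> 'b \<Rightarrow> bool" where
  "DL_adj T1 T2 x y \<longleftrightarrow> tadj T1 (fst x) (fst y) \<and> tadj T2 (snd x) (snd y)"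

definition tetrahedron :: "'a end_tree \<Rightarrow> 'b end_tree \<Rightarrow> 'a \<Rightarrow> 'b \<Rightarrow> ('a \<times> 'b) set" where
  "tetrahedron T1 T2 a1 a2 = {(x1, x2) \<in> DL T1 T2. tree_le T1 a1 x1 \<and> tree_le T2 a2 x2}"

definition is_tetrahedron ::
    "'a end_tree \<Rightarrow> 'b end_tree \<Rightarrow> nat \<Rightarrow> ('a \<times> 'b) set \<Rightarrow> bool" where
  "is_tetrahedron T1 T2 n S \<longleftrightarrow>
     (\<exists>a1 a2. - busemann T2 a2 = busemann T1 a1 + int n \<and> S = tetrahedron T1 T2 a1 a2)"

section \<open>Random walk operators\<close>

text \<open>Simple random walk on the graph induced on the vertex set \<open>V\<close>; degrees are taken in \<open>V\<close>.\<close>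

definition srw :: "'v set \<Rightarrow> ('v \<Rightarrow> 'v \<Rightarrow> bool) \<Rightarrow> 'v \<Rightarrow> 'v \<Rightarrow> real" where
  "srw V A x y =
     (if x \<in> V \<and> y \<in> V \<and> A x y then 1 / real (card {z \<in> V. A x z}) else 0)"

text \<open>Functions on \<open>V\<close> are represented by functions vanishing outside \<open>V\<close>. The operator below
  only uses the entries of \<open>M\<close> in \<open>V \<times> V\<close>: for \<open>S\<close> a subset of the index set of \<open>M\<close>,
  \<open>mat_op S M\<close> is the truncation of \<open>M\<close> to \<open>S\<close>.\<close>

definition mat_op :: "'v set \<Rightarrow> ('v \<Rightarrow> 'v \<Rightarrow> real) \<Rightarrow> ('v \<Rightarrow> complex) \<Rightarrow> ('v \<Rightarrow> complex)" where
  "mat_op V M f = (\<lambda>x. if x \<in> V then \<Sum>\<^sub>\<infinity>y\<in>V. complex_of_real (M x y) * f y else 0)"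

section \<open>Spectral measures of finite matrices\<close>

definition eigenspace :: "'v set \<Rightarrow> ('v \<Rightarrow> 'v \<Rightarrow> real) \<Rightarrow> real \<Rightarrow> ('v \<Rightarrow> complex) set" where
  "eigenspace V M l = {f. (\<forall>x. x \<notin> V \<longrightarrow> f x = 0) \<and>
     mat_op V M f = (\<lambda>x. complex_of_real l * f x)}"

text \<open>Only real eigenvalues are recorded. Simple random walk on a finite graph is reversible, and the
  truncated operator on \<open>DL T1 T2\<close> is symmetric; so all their eigenvalues are real, and algebraic
  and geometric multiplicities agree.\<close>

definition spec :: "'v set \<Rightarrow> ('v \<Rightarrow> 'v \<Rightarrow> real) \<Rightarrow> real set" where
  "spec V M = {l. \<exists>f \<in> eigenspace V M l. f \<noteq> (\<lambda>_. 0)}"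

definition mult :: "'v set \<Rightarrow> ('v \<Rightarrow> 'v \<Rightarrow> real) \<Rightarrow> real \<Rightarrow> nat" where
  "mult V M l =
     vector_space.dim (\<lambda>(c::complex) (f::'v \<Rightarrow> complex) x. c * f x) (eigenspace V M l)"

definition cumulative_spectral_measure ::
    "'v set \<Rightarrow> ('v \<Rightarrow> 'v \<Rightarrow> real) \<Rightarrow> real measure" where
  "cumulative_spectral_measure V M = measure_of UNIV (sets borel)
     (\<lambda>B. ennreal (1 / real (card V) * (\<Sum>l\<in>spec V M. real (mult V M l) * indicator B l)))"

section \<open>Resolutions of the identity and the Plancherel measure\<close>

definition ell2 :: "'v set \<Rightarrow> ('v \<Rightarrow> complex) set" where
  "ell2 V = {f. (\<forall>x. x \<notin> V \<longrightarrow> f x = 0) \<and> (\<lambda>x. (cmod (f x))\<^sup>2) summable_on V}"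

definition l2_inner :: "'v set \<Rightarrow> ('v \<Rightarrow> complex) \<Rightarrow> ('v \<Rightarrow> complex) \<Rightarrow> complex" where
  "l2_inner V f g = (\<Sum>\<^sub>\<infinity>x\<in>V. cnj (f x) * g x)"

definition l2_projection :: "'v set \<Rightarrow> (('v \<Rightarrow> complex) \<Rightarrow> ('v \<Rightarrow> complex)) \<Rightarrow> bool" where
  "l2_projection V Q \<longleftrightarrow>
     (\<forall>f\<in>ell2 V. Q f \<in> ell2 V \<and> Q (Q f) = Q f) \<and>
     (\<forall>f\<in>ell2 V. \<forall>g\<in>ell2 V. \<forall>c d. Q (\<lambda>x. c * f x + d * g x) = (\<lambda>x. c * Q f x + d * Q g x)) \<and>
     (\<forall>f\<in>ell2 V. \<forall>g\<in>ell2 V. l2_inner V (Q f) g = l2_inner V f (Q g))"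

definition projection_valued_measure ::
    "'v set \<Rightarrow> (real set \<Rightarrow> ('v \<Rightarrow> complex) \<Rightarrow> ('v \<Rightarrow> complex)) \<Rightarrow> bool" where
  "projection_valued_measure V E \<longleftrightarrow>
     (\<forall>B\<in>sets borel. l2_projection V (E B)) \<and>
     (\<forall>f\<in>ell2 V. E UNIV f = f) \<and>
     (\<forall>A\<in>sets borel. \<forall>B\<in>sets borel. \<forall>f\<in>ell2 V. E (A \<inter> B) f = E A (E B f)) \<and>
     (\<forall>B :: nat \<Rightarrow> real set. range B \<subseteq> sets borel \<longrightarrow> disjoint_family B \<longrightarrow>
        (\<forall>f\<in>ell2 V. \<forall>g\<in>ell2 V.
           (\<lambda>n. l2_inner V f (E (B n) g)) sums l2_inner V f (E (\<Union>n. B n) g)))"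

text \<open>The finite Borel measure \<open>\<langle>f, E(d\<lambda>) f\<rangle>\<close>; its values are real and nonnegative because
  every \<open>E B\<close> is an orthogonal projection.\<close>

definition diagonal_measure ::
    "'v set \<Rightarrow> (real set \<Rightarrow> ('v \<Rightarrow> complex) \<Rightarrow> ('v \<Rightarrow> complex)) \<Rightarrow> ('v \<Rightarrow> complex) \<Rightarrow> real measure" where
  "diagonal_measure V E f =
     measure_of UNIV (sets borel) (\<lambda>B. ennreal (Re (l2_inner V f (E B f))))"

text \<open>\<open>E\<close> is the resolution of the identity of the bounded self-adjoint operator \<open>Q\<close>, that is,
  \<open>Q = \<integral> \<lambda> E(d\<lambda>)\<close> in the weak sense. By polarization it is enough to require this for the
  quadratic forms. Compact support makes all the integrals exist.\<close>

definition resolution_of_identity ::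
    "'v set \<Rightarrow> (('v \<Rightarrow> complex) \<Rightarrow> ('v \<Rightarrow> complex)) \<Rightarrow>
     (real set \<Rightarrow> ('v \<Rightarrow> complex) \<Rightarrow> ('v \<Rightarrow> complex)) \<Rightarrow> bool" where
  "resolution_of_identity V Q E \<longleftrightarrow>
     projection_valued_measure V E \<and>
     (\<exists>c. \<forall>f\<in>ell2 V. E {-c..c} f = f) \<and>
     (\<forall>f\<in>ell2 V. l2_inner V f (Q f) = complex_of_real (\<integral>l. l \<partial>(diagonal_measure V E f)))"

definition plancherel_measure ::
    "'v set \<Rightarrow> 'v \<Rightarrow> (real set \<Rightarrow> ('v \<Rightarrow> complex) \<Rightarrow> ('v \<Rightarrow> complex)) \<Rightarrow> real measure" where
  "plancherel_measure V v E = diagonal_measure V E (\<lambda>x. if x = v then 1 else 0)"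

end

theory Submission
  imports Defs "HOL-Computational_Algebra.Fundamental_Theorem_Algebra" "HOL-Real_Asymp.Real_Asymp"
begin

text \<open>All the measures in question are probability measures carried by one bounded interval, and on such an
interval weak convergence is the same as convergence of every moment. Moments are weighted counts of
closed walks. The \<open>k\<close>-th moment of a cumulative spectral measure is the normalised trace
\<open>(1 / |S|) \<Sum>x\<in>S. A\<^sup>k(x,x)\<close> of the operator \<open>A\<close> on the tetrahedron \<open>S\<close>, because \<open>A\<close> has
a basis of eigenvectors. The \<open>k\<close>-th moment of the Plancherel measure is the probability
\<open>P\<^sup>k(o,o)\<close> that the walk on the whole graph is back at \<open>o\<close> after \<open>k\<close> steps. So everything comes down
to comparing the entries \<open>A\<^sup>k(x,x)\<close> with \<open>P\<^sup>k(o,o)\<close>.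

A tetrahedron of height \<open>n\<close> is layered into levels \<open>0, \<dots>, n\<close>, and level \<open>j\<close> has \<open>q\<^sup>j r\<^sup>n\<^sup>-\<^sup>j\<close> vertices.
A vertex strictly between level \<open>0\<close> and level \<open>n\<close> has all its \<open>q + r\<close> neighbours in the tetrahedron,
so there the walk on \<open>S\<close> and the truncated operator both act like \<open>P\<close>. Hence a vertex at least \<open>k\<close> levels
away from both extreme levels has \<open>A\<^sup>k(x,x) = P\<^sup>k(x,x)\<close>, and this number does not depend on \<open>x\<close>
(\<open>return_homogeneous\<close>).

For \<open>q = r\<close> all levels have the same size, so the vertices that are not of this kind make up a proportion of
at most \<open>2 k / (n + 1)\<close>; each of them changes the trace by at most \<open>2\<close>. The moments therefore
converge to those of the Plancherel measure (\<open>trace_estimate\<close>).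

For \<open>q \<noteq> r\<close> the level sizes grow geometrically towards one end, and an extreme level keeps a
fixed proportion of all vertices. Each vertex of that level misses all its neighbours on one side. Counting
edges shows that the second moment of the truncation is at most \<open>(q + r - |q - r|) / (q + r)\<^sup>2\<close>
for every \<open>n\<close>, while that of the Plancherel measure is \<open>1 / (q + r)\<close> (\<open>second_moment_gap\<close>).\<close>

section \<open>The parent map of a tree with a reference end\<close>

text \<open>If two simple paths with the same endpoints differ, then, from the point where they first separate to
the first return of one of them to the other, they enclose a cycle.\<close>

lemma simple_path_unique:
  assumes A: "is_tree A"
  shows "distinct xs \<Longrightarrow> distinct ys \<Longrightarrow> successively A xs \<Longrightarrow> successively A ys \<Longrightarrow> xs \<noteq> [] \<Longrightarrow> ys \<noteq> []
    \<Longrightarrow> hd xs = hd ys \<Longrightarrow> last xs = last ys \<Longrightarrow> xs = ys"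
proof (induction xs arbitrary: ys)
  case (Cons x xs')
  from A have sym: "symp A" and nocyc: "\<And>xs. 3 \<le> length xs \<Longrightarrow> distinct xs \<Longrightarrow> successively A xs \<Longrightarrow> \<not> A (last xs) (hd xs)"
    by (auto simp: is_tree_def)
  obtain ys' where ys: "ys = x # ys'"
    using Cons.prems by (cases ys) auto
  show ?case
  proof (cases "xs' = [] \<or> ys' = []")
    case True
    then show ?thesis using Cons.prems ys by (auto split: if_splits)
  next
    case False
    then have ne: "xs' \<noteq> []" "ys' \<noteq> []" by auto
    have lasts: "last xs' = last ys'" using Cons.prems ne ys by simp
    have adj: "A x (hd xs')" "A x (hd ys')" "successively A xs'" "successively A ys'"
      using Cons.prems ne ys by (auto simp: successively_Cons)
    show ?thesis
    proof (cases "hd xs' = hd ys'")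
      case True
      then show ?thesis using Cons.IH[of ys'] Cons.prems ne ys lasts adj by auto
    next
      case False
      have "\<exists>z\<in>set xs'. z \<in> set ys'" using lasts ne by (metis last_in_set)
      from split_list_first_prop[OF this] obtain us z ws
        where xs': "xs' = us @ z # ws" "z \<in> set ys'" "\<forall>u\<in>set us. u \<notin> set ys'"
        by blast
      obtain vs ts where ys': "ys' = vs @ z # ts" using xs'(2) by (meson split_list)
      \<comment> \<open>\<open>z\<close> is the first vertex of \<open>xs'\<close> on \<open>ys'\<close>: out along \<open>xs'\<close> to \<open>z\<close>, back along \<open>ys'\<close>\<close>
      let ?c = "x # us @ z # rev vs"
      have "us \<noteq> [] \<or> vs \<noteq> []" using False xs' ys' by auto
      then have len: "3 \<le> length ?c" by (cases us; cases vs) auto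
      have dist: "distinct ?c" using Cons.prems(1,2) xs' ys ys' by auto
      have "successively A (rev (vs @ [z]))"
      proof -
        have "successively A (vs @ [z])" using adj(4) ys' by (auto simp: successively_append_iff)
        moreover have "(\<lambda>x y. A y x) = A" using sym by (auto simp: fun_eq_iff dest: sympD)
        ultimately show ?thesis unfolding successively_rev by metis
      qed
      moreover have "successively A (us @ [z])" using adj(3) xs' by (auto simp: successively_append_iff)
      ultimately have "successively A (us @ z # rev vs)"
        by (auto simp: successively_append_iff successively_Cons)
      moreover have "A x (hd (us @ z # rev vs))" using adj(1) xs' by (cases us) auto
      ultimately have succ: "successively A ?c" by (simp add: successively_Cons)
      have "A (last ?c) (hd ?c)"
        using adj(2) ys' sympD[OF sym] by (cases vs) auto
      with nocyc[OF len dist succ] show ?thesis by blast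
    qed
  qed
qed simp

text \<open>A walk of minimal length between two vertices is a simple path, since a repeated vertex would give a shortcut;
and there is only one simple path.\<close>

lemma graph_dist_simple_path:
  assumes A: "is_tree A" and f: "inj_on f {..n}" "\<And>i. i < n \<Longrightarrow> A (f i) (f (Suc i))"
  shows "graph_dist A (f 0) (f n) = n"
proof -
  define N where "N = graph_dist A (f 0) (f n)"
  have "(A ^^ n) (f 0) (f n)" using f(2) relpowp_fun_conv by metis
  then have N: "(A ^^ N) (f 0) (f n)" and le: "\<And>m. (A ^^ m) (f 0) (f n) \<Longrightarrow> N \<le> m"
    unfolding N_def graph_dist_def by (auto intro: LeastI Least_le)
  obtain g where g: "g 0 = f 0" "g N = f n" "\<And>i. i < N \<Longrightarrow> A (g i) (g (Suc i))"
    using N relpowp_fun_conv by metis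
  have inj: "i < j \<Longrightarrow> j \<le> N \<Longrightarrow> g i \<noteq> g j" for i j
  proof
    assume ij: "i < j" "j \<le> N" "g i = g j"
    have "(A ^^ i) (g 0) (g i)" using g(3) ij unfolding relpowp_fun_conv by (intro exI[of _ g]) auto
    moreover have "(A ^^ (N - j)) (g j) (g N)" using g(3) ij
      unfolding relpowp_fun_conv by (intro exI[of _ "\<lambda>k. g (j + k)"]) auto
    ultimately have "(A ^^ (i + (N - j))) (f 0) (f n)"
      using ij g by (metis relcomppI relpowp_add)
    from le[OF this] ij show False by auto
  qed
  have "map f [0..<Suc n] = map g [0..<Suc N]"
  proof (rule simple_path_unique[OF A])
    show "distinct (map f [0..<Suc n])" using f(1)
      by (simp add: distinct_map atLeast0LessThan lessThan_Suc_atMost del: upt_Suc)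
    have "inj_on g {..N}" by (metis (no_types, lifting) atMost_iff inj inj_onI linorder_neqE_nat)
    then show "distinct (map g [0..<Suc N])"
      by (simp add: distinct_map atLeast0LessThan lessThan_Suc_atMost del: upt_Suc)
    show "successively A (map f [0..<Suc n])" "successively A (map g [0..<Suc N])"
      using f(2) g(3) by (auto simp: successively_conv_nth simp del: upt_Suc)
    show "hd (map f [0..<Suc n]) = hd (map g [0..<Suc N])"
      using g by (simp add: hd_map del: upt_Suc)
    show "last (map f [0..<Suc n]) = last (map g [0..<Suc N])" using g by (simp add: last_map)
  qed auto
  then have "Suc n = Suc N" by (metis diff_zero length_map length_upt)
  then show ?thesis by (simp add: N_def)
qed

text \<open>Simple paths in a tree realise distances, so being geodesic amounts to being a walk without repetitions.\<close>

lemma geodesic_ray_iff: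
  assumes A: "is_tree A"
  shows "geodesic_ray A f \<longleftrightarrow> inj f \<and> (\<forall>i. A (f i) (f (Suc i)))"
proof
  assume g: "geodesic_ray A f"
  have reach: "\<exists>n. (A ^^ n) x y" for x y
    using A by (auto simp: is_tree_def rtranclp_imp_relpowp)
  have D: "(A ^^ graph_dist A x y) x y" for x y
    unfolding graph_dist_def using reach[of x y] by (auto intro: LeastI)
  have "graph_dist A x x = 0" for x
    unfolding graph_dist_def by (rule Least_eq_0) auto
  then have "m < n \<Longrightarrow> f m \<noteq> f n" for m n
    using g unfolding geodesic_ray_def by (metis diff_is_0_eq less_imp_le not_le)
  then have "inj f" by (metis injI linorder_neqE_nat)
  moreover have "A (f i) (f (Suc i))" for i
  proof -
    have "graph_dist A (f i) (f (Suc i)) = 1" using g by (auto simp: geodesic_ray_def)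
    with D[of "f i" "f (Suc i)"] have "(A ^^ 1) (f i) (f (Suc i))" by simp
    then show ?thesis unfolding relpowp_1 .
  qed
  ultimately show "inj f \<and> (\<forall>i. A (f i) (f (Suc i)))" by auto
next
  assume f: "inj f \<and> (\<forall>i. A (f i) (f (Suc i)))"
  show "geodesic_ray A f" unfolding geodesic_ray_def
  proof (intro allI impI)
    fix m n :: nat assume "m \<le> n"
    moreover have "inj_on (\<lambda>i. f (m + i)) {..n - m}"
      using f by (intro inj_onI) (metis add_left_cancel injD)
    then have "graph_dist A (f (m + 0)) (f (m + (n - m))) = n - m"
      using f by (intro graph_dist_simple_path[OF A, of "\<lambda>i. f (m + i)"]) auto
    ultimately show "graph_dist A (f m) (f n) = n - m" by simp
  qed
qed

text \<open>From here on the tree with its end is described by the map that moves every vertex one step towards the end.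
All notions of the model -- adjacency, the order \<open>\<preceq>\<close>, the Busemann function -- are expressed in
terms of it below.\<close>

definition parent :: "'a end_tree \<Rightarrow> 'a \<Rightarrow> 'a" where
  "parent T x = ray_from T x 1"

context
  fixes T :: "'a end_tree" and p :: nat
  assumes T: "homogeneous_end_tree p T"
begin

lemma tadj_is_tree: "is_tree (tadj T)"
  using T by (auto simp: homogeneous_end_tree_def)

lemma tadj_sym: "tadj T x y \<Longrightarrow> tadj T y x"
  using tadj_is_tree by (auto simp: is_tree_def sympD)

lemma tend_obtain:
  obtains \<rho> where "tend T = {g. (\<rho>, g) \<in> ray_equiv (tadj T)}" "geodesic_ray (tadj T) \<rho>"
  using T by (auto simp: homogeneous_end_tree_def tree_ends_def elim!: quotientE)

lemma tend_ray:
  assumes "f \<in> tend T" shows "inj f" "tadj T (f i) (f (Suc i))"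
  using tend_obtain assms geodesic_ray_iff[OF tadj_is_tree]
  by (auto simp: ray_equiv_def)

lemma tend_change_finitely_many:
  assumes f: "f \<in> tend T" and g: "inj g" "\<And>i. tadj T (g i) (g (Suc i))"
   "finite ((range f - range g) \<union> (range g - range f))"
 shows "g \<in> tend T"
proof -
  obtain \<rho> where r: "tend T = {g. (\<rho>, g) \<in> ray_equiv (tadj T)}" "geodesic_ray (tadj T) \<rho>"
    using tend_obtain by metis
  have "geodesic_ray (tadj T) g" using g geodesic_ray_iff[OF tadj_is_tree] by auto
  moreover have "finite ((range \<rho> - range f) \<union> (range f - range \<rho>))"
    using r f by (auto simp: ray_equiv_def)
  from finite_UnI[OF this g(3)] have "finite ((range \<rho> - range g) \<union> (range g - range \<rho>))"
    by (rule rev_finite_subset) auto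
  ultimately show ?thesis using r by (auto simp: ray_equiv_def)
qed

lemma tend_infinite_inter:
  assumes f: "f \<in> tend T" and g: "g \<in> tend T"
  shows "infinite (range f \<inter> range g)"
proof
  assume fin: "finite (range f \<inter> range g)"
  obtain \<rho> where r: "tend T = {g. (\<rho>, g) \<in> ray_equiv (tadj T)}" "geodesic_ray (tadj T) \<rho>"
    using tend_obtain by metis
  have "finite (range \<rho> - range f)" "finite (range \<rho> - range g)"
    using r f g by (auto simp: ray_equiv_def)
  then have "finite ((range \<rho> - range f) \<union> (range \<rho> - range g) \<union> (range f \<inter> range g))"
    using fin by simp
  then have "finite (range \<rho>)" by (rule rev_finite_subset) auto
  moreover have "inj \<rho>" using r geodesic_ray_iff[OF tadj_is_tree] by auto
  ultimately show False by (metis finite_imageD infinite_UNIV_nat)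
qed

text \<open>Equivalent rays share infinitely many vertices, so beyond any index \<open>n\<close> there is a common
vertex. Up to that vertex both are simple paths with the same endpoints.\<close>

lemma tend_unique:
  assumes f: "f \<in> tend T" and g: "g \<in> tend T" and 0: "f 0 = g 0"
  shows "f = g"
proof
  fix n
  note fr = tend_ray[OF f] and gr = tend_ray[OF g]
  have "finite (f ` {..n})" by simp
  then have "\<not> range f \<inter> range g \<subseteq> f ` {..n}"
    using tend_infinite_inter[OF f g] by (meson rev_finite_subset)
  then obtain i j where ij: "f i = g j" "i > n" by (auto simp: not_le) (metis atMost_iff image_eqI not_le)
  have "map f [0..<Suc i] = map g [0..<Suc j]"
  proof (rule simple_path_unique[OF tadj_is_tree])
    show "distinct (map f [0..<Suc i])" "distinct (map g [0..<Suc j])"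
      using fr(1) gr(1) inj_on_subset by (auto simp: distinct_map simp del: upt_Suc)
    show "successively (tadj T) (map f [0..<Suc i])" "successively (tadj T) (map g [0..<Suc j])"
      using fr(2) gr(2) by (auto simp: successively_conv_nth simp del: upt_Suc)
    show "hd (map f [0..<Suc i]) = hd (map g [0..<Suc j])"
      using 0 by (simp add: hd_map del: upt_Suc)
    show "last (map f [0..<Suc i]) = last (map g [0..<Suc j])" using ij by (simp add: last_map)
  qed auto
  then have len: "Suc i = Suc j" and eq: "\<forall>k<Suc i. map f [0..<Suc i] ! k = map g [0..<Suc j] ! k"
    by (metis diff_zero length_map length_upt, metis)
  then have "map f [0..<Suc i] ! n = map g [0..<Suc j] ! n" using ij by auto
  then show "f n = g n" using len ij by (simp del: upt_Suc)
qed

text \<open>The extended ray stays simple: a vertex of the ray \<open>f\<close> that is adjacent to \<open>f 0\<close> has distance 1 from it,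
so it can only be \<open>f 1\<close>.\<close>

lemma tend_extend:
  assumes f: "f \<in> tend T" and a: "tadj T (f 0) y" and ne: "y \<noteq> f 1"
  shows "case_nat y f \<in> tend T"
proof (rule tend_change_finitely_many[OF f])
  have "y \<noteq> f k" for k
  proof
    assume k: "y = f k"
    have "graph_dist (tadj T) (f 0) (f k) = k"
      by (rule graph_dist_simple_path[OF tadj_is_tree]) (use tend_ray[OF f] in \<open>auto simp: inj_on_def inj_def\<close>)
    moreover have "graph_dist (tadj T) (f 0) (f k) \<le> 1"
      unfolding graph_dist_def using a k by (intro Least_le) auto
    moreover have "y \<noteq> f 0" using a tadj_is_tree by (auto simp: is_tree_def irreflp_def)
    ultimately have "k = 1" using k by (cases "k = 0") auto
    with k ne show False by simp
  qed
  then show "inj (case_nat y f)" using tend_ray(1)[OF f]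
    by (auto simp: inj_def split: nat.splits; metis)
  show "tadj T (case_nat y f i) (case_nat y f (Suc i))" for i
    using tend_ray(2)[OF f] tadj_sym[OF a] by (cases i) auto
  have "range (case_nat y f) = insert y (range f)"
  proof -
    have "case_nat y f n \<in> insert y (range f)" for n by (cases n) auto
    moreover have "y = case_nat y f 0" "f n = case_nat y f (Suc n)" for n by auto
    ultimately show ?thesis by (metis (no_types, lifting) insert_subset rangeI image_subsetI subset_antisym)
  qed
  then show "finite ((range f - range (case_nat y f)) \<union> (range (case_nat y f) - range f))"
    by (auto intro: finite_subset[of _ "{y}"])
qed

lemma tend_tail:
  assumes f: "f \<in> tend T" shows "(\<lambda>i. f (Suc i)) \<in> tend T"
proof (rule tend_change_finitely_many[OF f])
  show "inj (\<lambda>i. f (Suc i))" using tend_ray(1)[OF f] by (auto simp: inj_def)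
  show "tadj T (f (Suc i)) (f (Suc (Suc i)))" for i using tend_ray(2)[OF f] .
  have "range f = insert (f 0) (range (\<lambda>i. f (Suc i)))"
  proof -
    have "f n \<in> insert (f 0) (range (\<lambda>i. f (Suc i)))" for n by (cases n) auto
    then show ?thesis by auto
  qed
  then show "finite ((range f - range (\<lambda>i. f (Suc i))) \<union> (range (\<lambda>i. f (Suc i)) - range f))"
    by (auto intro: finite_subset[of _ "{f 0}"])
qed

lemma tend_step:
  assumes f: "f \<in> tend T" and a: "tadj T (f 0) y"
  shows "\<exists>g\<in>tend T. g 0 = y"
proof (cases "y = f 1")
  case True
  then show ?thesis using tend_tail[OF f] by (intro bexI[of _ "\<lambda>i. f (Suc i)"]) auto
next
  case False
  then show ?thesis using tend_extend[OF assms] by (intro bexI[of _ "case_nat y f"]) auto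
qed

text \<open>Rays of the end are transported along a path to \<open>x\<close>, one edge at a time: either the next vertex lies on the ray
and the first vertex is dropped, or the next vertex is put in front.\<close>

lemma tend_ex: "\<exists>f\<in>tend T. f 0 = x"
proof -
  obtain \<rho> where r: "tend T = {g. (\<rho>, g) \<in> ray_equiv (tadj T)}" "geodesic_ray (tadj T) \<rho>"
    using tend_obtain by metis
  then have "\<rho> \<in> tend T" by (auto simp: ray_equiv_def)
  then have base: "\<exists>f\<in>tend T. f 0 = \<rho> 0" by auto
  have "(tadj T)\<^sup>*\<^sup>* (\<rho> 0) x" using tadj_is_tree by (auto simp: is_tree_def)
  then show ?thesis
  proof (induction rule: rtranclp_induct)
    case (step y z)
    then obtain f where "f \<in> tend T" "f 0 = y" by auto
    with step tend_step show ?case by metis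
  qed (rule base)
qed

lemma ray_from: "ray_from T x \<in> tend T" "ray_from T x 0 = x"
proof -
  have "\<exists>!f. f \<in> tend T \<and> f 0 = x" using tend_ex[of x] tend_unique by fastforce
  from theI'[OF this] show "ray_from T x \<in> tend T" "ray_from T x 0 = x"
    by (auto simp: ray_from_def)
qed

lemma ray_from_eqI: "f \<in> tend T \<Longrightarrow> f 0 = x \<Longrightarrow> ray_from T x = f"
  using tend_unique ray_from by metis

text \<open>The tail of the ray from \<open>x\<close> is the ray from the parent of \<open>x\<close>.\<close>

lemma ray_from_eq: "ray_from T x n = (parent T ^^ n) x"
proof (induction n arbitrary: x)
  case (Suc n)
  have "ray_from T (parent T x) = (\<lambda>i. ray_from T x (Suc i))"
    by (rule ray_from_eqI) (auto simp: tend_tail ray_from parent_def)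
  then have "ray_from T x (Suc n) = ray_from T (parent T x) n" by simp
  then show ?case using Suc by (simp add: funpow_swap1)
qed (simp add: ray_from)

lemma inj_ancestor: "(parent T ^^ i) x = (parent T ^^ j) x \<longleftrightarrow> i = j"
  using tend_ray(1)[OF ray_from(1)] ray_from_eq by (metis injD)

text \<open>If \<open>y\<close> is adjacent to \<open>x\<close> without being its parent, then the ray from \<open>y\<close> starts by stepping
to \<open>x\<close>.\<close>

lemma tadj_iff: "tadj T x y \<longleftrightarrow> parent T x = y \<or> parent T y = x"
proof
  assume a: "tadj T x y"
  show "parent T x = y \<or> parent T y = x"
  proof (cases "y = parent T x")
    case False
    then have "case_nat y (ray_from T x) \<in> tend T"
      using a by (intro tend_extend) (auto simp: ray_from parent_def)
    from ray_from_eqI[OF this, of y] have "ray_from T y = case_nat y (ray_from T x)" by simp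
    then show ?thesis by (simp add: parent_def ray_from)
  qed auto
next
  have "tadj T x (parent T x)" for x
    using tend_ray(2)[OF ray_from(1), of x 0] by (simp add: ray_from parent_def)
  then show "parent T x = y \<or> parent T y = x \<Longrightarrow> tadj T x y" using tadj_sym by metis
qed

lemma common_ancestor: "\<exists>i j. (parent T ^^ i) x = (parent T ^^ j) y"
proof -
  have "range (ray_from T x) \<inter> range (ray_from T y) \<noteq> {}"
    using tend_infinite_inter[OF ray_from(1) ray_from(1)] by (metis finite.emptyI)
  then obtain z where "z \<in> range (ray_from T x)" "z \<in> range (ray_from T y)" by auto
  then show ?thesis by (auto simp: ray_from_eq)
qed

lemma range_ray_from: "range (ray_from T x) = {y. \<exists>i. y = (parent T ^^ i) x}"
  by (auto simp: ray_from_eq)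

lemma range_ray_from_inj: "range (ray_from T b) = range (ray_from T b') \<longleftrightarrow> b = b'"
proof
  assume eq: "range (ray_from T b) = range (ray_from T b')"
  have "b \<in> range (ray_from T b)" "b' \<in> range (ray_from T b')"
    using ray_from(2) by (metis rangeI)+
  then have "b \<in> range (ray_from T b')" "b' \<in> range (ray_from T b)" using eq by simp_all
  then obtain i j where ij: "b = (parent T ^^ i) b'" "b' = (parent T ^^ j) b"
    unfolding range_ray_from by blast
  then have "(parent T ^^ (j + i)) b' = (parent T ^^ 0) b'" by (simp add: funpow_add)
  then have "j = 0" by (metis add_is_0 inj_ancestor)
  with ij show "b = b'" by simp
qed auto

lemma confluent_eqI:
  "range (ray_from T v) \<inter> range (ray_from T z) = range (ray_from T b) \<Longrightarrow> confluent T v z = b"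
  unfolding confluent_def using range_ray_from_inj by (intro the_equality) auto

text \<open>The confluent is the first ancestor of \<open>v\<close> that is also an ancestor of \<open>z\<close>; such ancestors exist
because the two rays are equivalent.\<close>

lemma confluent_obtain:
  obtains i j where "confluent T v z = (parent T ^^ i) v" "confluent T v z = (parent T ^^ j) z"
    "range (ray_from T v) \<inter> range (ray_from T z) = range (ray_from T (confluent T v z))"
proof -
  define i where "i = (LEAST i. \<exists>j. (parent T ^^ i) v = (parent T ^^ j) z)"
  obtain j where j: "(parent T ^^ i) v = (parent T ^^ j) z"
    using common_ancestor LeastI_ex[of "\<lambda>i. \<exists>j. (parent T ^^ i) v = (parent T ^^ j) z"]
    unfolding i_def by metis
  have le: "i \<le> k" if "(parent T ^^ k) v = (parent T ^^ l) z" for k l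
    unfolding i_def using that by (intro Least_le) auto
  define b where "b = (parent T ^^ i) v"
  have "range (ray_from T v) \<inter> range (ray_from T z) = range (ray_from T b)"
  proof (intro set_eqI iffI)
    fix w assume "w \<in> range (ray_from T v) \<inter> range (ray_from T z)"
    then obtain k l where kl: "w = (parent T ^^ k) v" "w = (parent T ^^ l) z"
      unfolding range_ray_from by blast
    with le have "i \<le> k" by metis
    then have "w = (parent T ^^ (k - i)) b"
      using kl unfolding b_def by (metis add.commute comp_apply funpow_add le_add_diff_inverse)
    then show "w \<in> range (ray_from T b)" unfolding range_ray_from by auto
  next
    fix w assume "w \<in> range (ray_from T b)"
    then obtain k where k: "w = (parent T ^^ k) b" unfolding range_ray_from by auto
    then have "w = (parent T ^^ (k + i)) v" "w = (parent T ^^ (k + j)) z"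
      using j by (simp_all add: b_def funpow_add)
    then show "w \<in> range (ray_from T v) \<inter> range (ray_from T z)"
      unfolding range_ray_from by blast
  qed
  with confluent_eqI[OF this] j that show ?thesis by (metis b_def)
qed

lemma tree_le_iff: "tree_le T z v \<longleftrightarrow> (\<exists>i. z = (parent T ^^ i) v)"
proof
  assume "tree_le T z v"
  then show "\<exists>i. z = (parent T ^^ i) v"
    unfolding tree_le_def using confluent_obtain by metis
next
  assume "\<exists>i. z = (parent T ^^ i) v"
  then obtain i where i: "z = (parent T ^^ i) v" by auto
  have "range (ray_from T z) \<subseteq> range (ray_from T v)"
  proof
    fix w assume "w \<in> range (ray_from T z)"
    then obtain k where "w = (parent T ^^ k) z" unfolding range_ray_from by auto
    then have "w = (parent T ^^ (k + i)) v" using i by (simp add: funpow_add)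
    then show "w \<in> range (ray_from T v)" unfolding range_ray_from by auto
  qed
  then show "tree_le T z v" unfolding tree_le_def by (intro confluent_eqI) auto
qed

lemma graph_dist_ancestor: "graph_dist (tadj T) x ((parent T ^^ i) x) = i"
  using graph_dist_simple_path[OF tadj_is_tree, of "\<lambda>i. (parent T ^^ i) x" i] inj_ancestor
  by (auto simp: inj_on_def tadj_iff)

text \<open>Any common ancestor of \<open>x\<close> and the root may replace the confluent: both distances increase by
the same amount.\<close>

lemma busemann_eqI:
  assumes ij: "(parent T ^^ i) x = (parent T ^^ j) (troot T)"
  shows "busemann T x = int i - int j"
proof -
  let ?o = "troot T" let ?b = "confluent T x ?o"
  obtain k l where kl: "?b = (parent T ^^ k) x" "?b = (parent T ^^ l) ?o"
    "range (ray_from T x) \<inter> range (ray_from T ?o) = range (ray_from T ?b)"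
    using confluent_obtain by metis
  have "(parent T ^^ i) x \<in> range (ray_from T x)" unfolding range_ray_from by blast
  moreover have "(parent T ^^ i) x \<in> range (ray_from T ?o)" unfolding range_ray_from ij by blast
  ultimately have "(parent T ^^ i) x \<in> range (ray_from T ?b)" using kl(3) by blast
  then obtain m where m: "(parent T ^^ i) x = (parent T ^^ m) ?b" unfolding range_ray_from by auto
  then have "i = m + k" "j = m + l"
    using kl ij inj_ancestor by (metis comp_apply funpow_add)+
  moreover have "busemann T x = int k - int l"
    unfolding busemann_def using graph_dist_ancestor kl by metis
  ultimately show ?thesis by simp
qed

lemma busemann_parent: "busemann T (parent T x) = busemann T x - 1"
proof -
  obtain i j where ij: "(parent T ^^ i) x = (parent T ^^ j) (troot T)" using common_ancestor by metis
  then have "(parent T ^^ i) (parent T x) = (parent T ^^ (Suc j)) (troot T)"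
    by (metis funpow_swap1 funpow.simps(2) o_apply)
  from busemann_eqI[OF this] busemann_eqI[OF ij] show ?thesis by simp
qed

lemma busemann_root: "busemann T (troot T) = 0"
  using busemann_eqI[of 0 _ 0] by simp

lemma card_children: "finite {y. parent T y = x} \<and> card {y. parent T y = x} = p"
proof -
  have fin: "finite {y. tadj T x y}" "card {y. tadj T x y} = p + 1"
    using T by (auto simp: homogeneous_end_tree_def)
  have "{y. tadj T x y} = insert (parent T x) {y. parent T y = x}"
    using tadj_iff by auto
  moreover have "parent T (parent T x) \<noteq> x" using inj_ancestor[of 2 x 0] by (simp add: numeral_2_eq_2)
  ultimately show ?thesis using fin by auto
qed

end

section \<open>Spectral theory of symmetrizable matrices\<close>

abbreviation kron :: "'v \<Rightarrow> 'v \<Rightarrow> complex" where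
  "kron v \<equiv> (\<lambda>x. if x = v then 1 else 0)"

text \<open>Functions on \<open>V\<close> are functions on the whole type that vanish outside \<open>V\<close>; for finite \<open>V\<close> they form a
space of dimension \<open>card V\<close>.\<close>

definition supported :: "'v set \<Rightarrow> ('v \<Rightarrow> complex) set" where
  "supported V = {f. \<forall>x. x \<notin> V \<longrightarrow> f x = 0}"

interpretation fun_vs: vector_space "\<lambda>(c::complex) (f::'v \<Rightarrow> complex) x. c * f x"
  by unfold_locales (auto simp: fun_eq_iff algebra_simps)

lemma sum_fun_apply: "(\<Sum>i\<in>I. f i) x = (\<Sum>i\<in>I. f i x)" for f :: "'i \<Rightarrow> 'v \<Rightarrow> complex"
  by (induction I rule: infinite_finite_induct) auto

lemma mat_op_finite:
  "finite V \<Longrightarrow> mat_op V M f x = (if x \<in> V then \<Sum>y\<in>V. complex_of_real (M x y) * f y else 0)"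
  by (simp add: mat_op_def)

lemma mat_op_supported: "mat_op V M f \<in> supported V"
  by (simp add: mat_op_def supported_def)

text \<open>The condition on \<open>d\<close> is reversibility: it makes \<open>M\<close> self-adjoint for the inner product \<open>ip\<close> weighted by
\<open>d\<close>. Simple random walk is of this kind with the degrees as weights, the truncated operator with
constant weights.\<close>

locale symmetrizable_matrix =
  fixes V :: "'v set" and M :: "'v \<Rightarrow> 'v \<Rightarrow> real" and d :: "'v \<Rightarrow> real"
  assumes fin: "finite V"
    and pos: "x \<in> V \<Longrightarrow> d x > 0"
    and sym: "x \<in> V \<Longrightarrow> y \<in> V \<Longrightarrow> d x * M x y = d y * M y x"
begin

abbreviation "op \<equiv> mat_op V M"

definition ip :: "('v \<Rightarrow> complex) \<Rightarrow> ('v \<Rightarrow> complex) \<Rightarrow> complex" where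
  "ip f g = (\<Sum>x\<in>V. d x * cnj (f x) * g x)"

lemma op_lin: "op (\<lambda>x. a * f x + b * g x) = (\<lambda>x. a * op f x + b * op g x)"
  by (auto simp: mat_op_finite[OF fin] fun_eq_iff sum_distrib_left sum.distrib algebra_simps)

lemma op_sum: "op (\<lambda>x. \<Sum>i\<in>I. c i * f i x) = (\<lambda>x. \<Sum>i\<in>I. c i * op (f i) x)"
proof -
  have "(\<Sum>y\<in>V. complex_of_real (M x y) * (\<Sum>i\<in>I. c i * f i y))
      = (\<Sum>i\<in>I. c i * (\<Sum>y\<in>V. complex_of_real (M x y) * f i y))" for x
    by (simp add: sum_distrib_left algebra_simps) (rule sum.swap)
  then show ?thesis by (auto simp: mat_op_finite[OF fin] fun_eq_iff)
qed

lemma ip_op: "ip f (op g) = ip (op f) g"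
proof -
  have "ip f (op g) = (\<Sum>x\<in>V. \<Sum>y\<in>V. complex_of_real (d x * M x y) * (cnj (f x) * g y))"
    by (simp add: ip_def mat_op_finite[OF fin] sum_distrib_left algebra_simps)
  also have "\<dots> = (\<Sum>x\<in>V. \<Sum>y\<in>V. complex_of_real (d y * M y x) * (cnj (f x) * g y))"
    using sym by (intro sum.cong refl) auto
  also have "\<dots> = (\<Sum>y\<in>V. \<Sum>x\<in>V. complex_of_real (d y * M y x) * (cnj (f x) * g y))"
    by (rule sum.swap)
  also have "\<dots> = ip (op f) g"
    by (simp add: ip_def mat_op_finite[OF fin] sum_distrib_left sum_distrib_right algebra_simps)
  finally show ?thesis .
qed

lemma ip_cnj: "cnj (ip f g) = ip g f"
  by (simp add: ip_def algebra_simps)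

lemma ip_scale: "ip f (\<lambda>x. c * g x) = c * ip f g" "ip (\<lambda>x. c * f x) g = cnj c * ip f g"
  by (simp_all add: ip_def sum_distrib_left algebra_simps)

lemma ip_sum: "ip f (\<lambda>x. \<Sum>i\<in>I. c i * g i x) = (\<Sum>i\<in>I. c i * ip f (g i))"
  unfolding ip_def sum_distrib_left by (subst sum.swap) (simp add: algebra_simps)

lemma ip_diff: "ip f (\<lambda>x. g x - h x) = ip f g - ip f h"
  by (simp add: ip_def sum_subtractf algebra_simps)

lemma ip_self: "ip f f = complex_of_real (\<Sum>x\<in>V. d x * (cmod (f x))\<^sup>2)"
  unfolding ip_def of_real_sum
  by (intro sum.cong refl) (simp add: complex_norm_square[symmetric] mult.assoc mult.commute[of "cnj _"])

lemma ip_pos: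
  assumes "f \<in> supported V" "f \<noteq> (\<lambda>_. 0)"
  shows "Re (ip f f) > 0"
proof -
  obtain x where x: "x \<in> V" "f x \<noteq> 0" using assms by (auto simp: supported_def fun_eq_iff)
  have "(\<Sum>x\<in>V. d x * (cmod (f x))\<^sup>2) > 0"
    using x pos by (intro sum_pos2[OF fin]) (auto simp: less_imp_le)
  then show ?thesis by (simp add: ip_self)
qed

definition poly_op :: "complex poly \<Rightarrow> ('v \<Rightarrow> complex) \<Rightarrow> 'v \<Rightarrow> complex" where
  "poly_op p f = (\<lambda>x. \<Sum>i\<le>degree p. coeff p i * (op ^^ i) f x)"

lemma poly_op_bound: "degree p \<le> n \<Longrightarrow> poly_op p f = (\<lambda>x. \<Sum>i\<le>n. coeff p i * (op ^^ i) f x)"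
  unfolding poly_op_def fun_eq_iff
  by (intro allI sum.mono_neutral_left) (auto simp: coeff_eq_0)

text \<open>Polynomials in the operator are used to find an eigenvector: a root of a polynomial that annihilates a vector
splits off a linear factor.\<close>

lemma poly_op_mult_linear:
  "poly_op ([:-c, 1:] * p) f = (\<lambda>x. op (poly_op p f) x - c * poly_op p f x)"
proof -
  define n where "n = degree p"
  have deg: "degree ([:-c, 1:] * p) \<le> Suc n"
    unfolding n_def by (rule order_trans[OF degree_mult_le]) auto
  have cf: "coeff ([:-c, 1:] * p) i = (case i of 0 \<Rightarrow> 0 | Suc j \<Rightarrow> coeff p j) - c * coeff p i" for i
    by (simp add: coeff_pCons split: nat.splits)
  have "poly_op ([:-c, 1:] * p) f x = op (poly_op p f) x - c * poly_op p f x" for x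
  proof -
    have "poly_op ([:-c, 1:] * p) f x =
       (\<Sum>i\<le>Suc n. (case i of 0 \<Rightarrow> 0 | Suc j \<Rightarrow> coeff p j) * (op ^^ i) f x)
        - c * (\<Sum>i\<le>Suc n. coeff p i * (op ^^ i) f x)"
      unfolding poly_op_bound[OF deg] cf by (simp only: left_diff_distrib sum_subtractf sum_distrib_left mult.assoc)
    also have "(\<Sum>i\<le>Suc n. coeff p i * (op ^^ i) f x) = poly_op p f x"
      using poly_op_bound[of p "Suc n"] n_def by simp
    also have "(\<Sum>i\<le>Suc n. (case i of 0 \<Rightarrow> 0 | Suc j \<Rightarrow> coeff p j) * (op ^^ i) f x)
        = (\<Sum>i\<le>n. coeff p i * op ((op ^^ i) f) x)"
      by (subst sum.atMost_Suc_shift) simp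
    also have "\<dots> = op (poly_op p f) x"
      unfolding poly_op_def op_sum n_def ..
    finally show ?thesis .
  qed
  then show ?thesis by auto
qed

lemma supported_subset_span: "supported V \<subseteq> fun_vs.span (kron ` V)"
proof
  fix f assume f: "f \<in> supported V"
  have "f = (\<Sum>v\<in>V. (\<lambda>x. f v * kron v x))"
  proof
    fix x
    have "(\<Sum>v\<in>V. f v * kron v x) = f x"
      using f fin by (auto simp: supported_def if_distrib cong: if_cong)
    then show "f x = (\<Sum>v\<in>V. (\<lambda>x. f v * kron v x)) x" by (simp only: sum_fun_apply)
  qed
  also have "\<dots> \<in> fun_vs.span (kron ` V)"
    by (intro fun_vs.span_sum fun_vs.span_scale fun_vs.span_base) auto
  finally show "f \<in> fun_vs.span (kron ` V)" .
qed

text \<open>The vectors \<open>f, A f, A\<^sup>2 f, \<dots>\<close> lie in a finite-dimensional space, so some nontrivial combination of them vanishes.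
A repetition in the sequence is treated apart, because linear dependence is a property of sets of
vectors.\<close>

lemma annihilating_poly:
  assumes f: "f \<in> supported V"
  shows "\<exists>p. p \<noteq> 0 \<and> poly_op p f = (\<lambda>_. 0)"
proof (cases "inj_on (\<lambda>i. (op ^^ i) f) {..card V}")
  case True
  let ?g = "\<lambda>i. (op ^^ i) f"
  let ?B = "?g ` {..card V}"
  have "?g i \<in> supported V" for i using f by (cases i) (auto simp: mat_op_supported)
  then have "?B \<subseteq> fun_vs.span (kron ` V)" using supported_subset_span by auto
  moreover have "card ?B > card (kron ` V)"
    using True fin card_image_le[of V kron] by (simp add: card_image)
  ultimately have "fun_vs.dependent ?B"
    using fun_vs.independent_span_bound[of "kron ` V" ?B] fin by fastforce
  then obtain u where u: "\<exists>v\<in>?B. u v \<noteq> 0" "(\<Sum>v\<in>?B. (\<lambda>x. u v * v x)) = 0"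
    using fun_vs.dependent_finite[of ?B] by auto
  define p where "p = (\<Sum>i\<le>card V. monom (u (?g i)) i)"
  have cp: "coeff p i = (if i \<le> card V then u (?g i) else 0)" for i
    by (simp add: p_def coeff_sum)
  have p: "p \<noteq> 0"
  proof
    assume p0: "p = 0"
    obtain i where i: "i \<le> card V" "u (?g i) \<noteq> 0" using u(1) by auto
    with cp[of i] p0 show False by simp
  qed
  have "degree p \<le> card V" by (rule degree_le) (simp add: cp)
  then have "poly_op p f = (\<lambda>x. \<Sum>i\<le>card V. u (?g i) * ?g i x)"
    by (simp add: poly_op_bound cp)
  also have "\<dots> = (\<lambda>x. (\<Sum>v\<in>?B. (\<lambda>x. u v * v x)) x)"
    using True by (simp add: sum_fun_apply sum.reindex)
  finally have "poly_op p f = (\<lambda>_. 0)" using u(2) by (simp add: fun_eq_iff)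
  with p show ?thesis by blast
next
  case False
  then obtain i j where ij: "i < j" "(op ^^ i) f = (op ^^ j) f"
    unfolding inj_on_def by (metis linorder_neqE_nat)
  define p :: "complex poly" where "p = monom 1 j - monom 1 i"
  have "coeff p j = 1" using ij by (simp add: p_def)
  then have p: "p \<noteq> 0" by auto
  have "degree p \<le> j" using ij by (intro degree_le) (auto simp: p_def)
  then have "poly_op p f = (\<lambda>x. \<Sum>k\<le>j. coeff p k * (op ^^ k) f x)" by (simp add: poly_op_bound)
  also have "\<dots> = (\<lambda>_. 0)"
  proof
    fix x
    have "(\<Sum>k\<le>j. coeff p k * (op ^^ k) f x)
      = (\<Sum>k\<le>j. (if k = j then (op ^^ k) f x else 0) - (if k = i then (op ^^ k) f x else 0))"
      using ij by (intro sum.cong) (auto simp: p_def)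
    also have "\<dots> = 0" using ij by (simp add: sum_subtractf)
    finally show "(\<Sum>k\<le>j. coeff p k * (op ^^ k) f x) = 0" .
  qed
  finally show ?thesis using p by blast
qed

lemma eigenvalue_real:
  assumes "g \<in> supported V" "g \<noteq> (\<lambda>_. 0)" "op g = (\<lambda>x. c * g x)"
  shows "c = complex_of_real (Re c)"
proof -
  have "c * ip g g = cnj c * ip g g"
    using ip_op[of g g] by (simp add: assms(3) ip_scale)
  moreover have "ip g g \<noteq> 0" using ip_pos[OF assms(1,2)] by auto
  ultimately have "c = cnj c" by simp
  then show ?thesis by (metis complex_cnj_cancel_iff Reals_cnj_iff complex_is_Real_iff of_real_Re)
qed

text \<open>Take the linear factors off an annihilating polynomial of \<open>f\<close>, one after the other. The last nonzero
vector that arises before everything is annihilated is an eigenvector, and its eigenvalue is real by self-adjointness.\<close>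

lemma eigenvector_in_invariant_subspace:
  assumes U: "U \<subseteq> supported V" "\<And>f. f \<in> U \<Longrightarrow> op f \<in> U"
      "\<And>f g a b. f \<in> U \<Longrightarrow> g \<in> U \<Longrightarrow> (\<lambda>x. a * f x + b * g x) \<in> U"
    and f: "f \<in> U" "f \<noteq> (\<lambda>_. 0)"
  shows "\<exists>g\<in>U. g \<noteq> (\<lambda>_. 0) \<and> (\<exists>l::real. op g = (\<lambda>x. l * g x))"
proof -
  have ex: "p \<noteq> 0 \<Longrightarrow> f \<in> U \<Longrightarrow> f \<noteq> (\<lambda>_. 0) \<Longrightarrow> poly_op p f = (\<lambda>_. 0) \<Longrightarrow>
     \<exists>g\<in>U. g \<noteq> (\<lambda>_. 0) \<and> (\<exists>c. op g = (\<lambda>x. c * g x))" for p f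
  proof (induction "degree p" arbitrary: p)
    case 0
    then obtain a where "p = [:a:]" "a \<noteq> 0" by (metis degree_0_id of_nat_0 pCons_0_0 degree_eq_zeroE)
    then have "poly_op p f = (\<lambda>x. a * f x)" by (simp add: poly_op_def)
    with 0 \<open>a \<noteq> 0\<close> show ?case by (auto simp: fun_eq_iff)
  next
    case (Suc n)
    have "\<not> constant (poly p)" using Suc.hyps(2) by (simp add: constant_degree)
    then obtain c where "poly p c = 0" using fundamental_theorem_of_algebra by blast
    then obtain s where s: "p = [:-c, 1:] * s" by (auto simp: poly_eq_0_iff_dvd dvd_def)
    have s0: "s \<noteq> 0" using s Suc.prems by auto
    have degs: "n = degree s" using Suc.hyps(2) s0 unfolding s by (subst (asm) degree_mult_eq) auto
    show ?case
    proof (cases "poly_op s f = (\<lambda>_. 0)")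
      case True
      then show ?thesis using Suc.hyps(1)[OF degs s0] Suc.prems by auto
    next
      case False
      have it: "(op ^^ i) f \<in> U" for i using U(2) Suc.prems(2) by (induction i) auto
      have zero: "(\<lambda>x. 0) \<in> U" using U(3)[of f f 0 0] Suc.prems(2) by simp
      have "(\<lambda>x. \<Sum>i\<in>I. coeff s i * (op ^^ i) f x) \<in> U" if "finite I" for I
        using that
      proof (induction I)
        case (insert i I)
        then show ?case using U(3)[OF it[of i] insert.IH, of "coeff s i" 1] by simp
      qed (simp add: zero)
      then have "poly_op s f \<in> U" unfolding poly_op_def by simp
      moreover have "op (poly_op s f) = (\<lambda>x. c * poly_op s f x)"
        using Suc.prems(4) unfolding s poly_op_mult_linear by (simp add: fun_eq_iff)
      ultimately show ?thesis using False by blast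
    qed
  qed
  obtain p where "p \<noteq> 0" "poly_op p f = (\<lambda>_. 0)" using annihilating_poly f U by blast
  from ex[OF this(1) f this(2)] obtain g c where g: "g \<in> U" "g \<noteq> (\<lambda>_. 0)" "op g = (\<lambda>x. c * g x)"
    by blast
  with eigenvalue_real[of g c] U(1) have "op g = (\<lambda>x. complex_of_real (Re c) * g x)" by auto
  with g show ?thesis by blast
qed

definition orthonormal_eigenvectors :: "('v \<Rightarrow> complex) set \<Rightarrow> (('v \<Rightarrow> complex) \<Rightarrow> real) \<Rightarrow> bool" where
  "orthonormal_eigenvectors B lam \<longleftrightarrow> finite B \<and> B \<subseteq> supported V \<and>
     (\<forall>b\<in>B. op b = (\<lambda>x. lam b * b x)) \<and> (\<forall>b\<in>B. \<forall>c\<in>B. ip b c = (if b = c then 1 else 0))"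

text \<open>Bessel's inequality for the unit mass at \<open>x\<close> bounds the contribution of \<open>x\<close> to
\<open>\<Sum>b\<in>B. ip b b\<close> by 1; summing over \<open>x\<close> gives the claim.\<close>

lemma orthonormal_card:
  assumes B: "orthonormal_eigenvectors B lam"
  shows "card B \<le> card V"
proof -
  note B = B[unfolded orthonormal_eigenvectors_def]
  have bessel: "(\<Sum>b\<in>B. d x * (cmod (b x))\<^sup>2) \<le> 1" if x: "x \<in> V" for x
  proof -
    define s where "s = (\<Sum>b\<in>B. d x * (cmod (b x))\<^sup>2)"
    \<comment> \<open>the part of the unit mass at \<open>x\<close> that is orthogonal to \<open>B\<close>\<close>
    define h where "h = (\<lambda>y. kron x y - (\<Sum>b\<in>B. (d x * cnj (b x)) * b y))"
    have ipk: "ip g (kron x) = d x * cnj (g x)" for g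
      using x fin by (simp add: ip_def if_distrib cong: if_cong)
    have ipb: "ip b h = 0" if "b \<in> B" for b
    proof -
      have "ip b (\<lambda>y. \<Sum>c\<in>B. (d x * cnj (c x)) * c y) = (\<Sum>c\<in>B. (d x * cnj (c x)) * ip b c)"
        by (rule ip_sum)
      also have "\<dots> = (\<Sum>c\<in>B. if c = b then d x * cnj (c x) else 0)"
        using B that by (intro sum.cong) auto
      also have "\<dots> = d x * cnj (b x)" using B that by simp
      finally show ?thesis unfolding h_def ip_diff ipk by simp
    qed
    have "ip h h = ip h (kron x) - (\<Sum>b\<in>B. (d x * cnj (b x)) * ip h b)"
      using ip_diff[of h "kron x" "\<lambda>y. \<Sum>b\<in>B. (d x * cnj (b x)) * b y"]
        ip_sum[of h "\<lambda>b. d x * cnj (b x)" "\<lambda>b. b" B] unfolding h_def by simp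
    also have "(\<Sum>b\<in>B. (d x * cnj (b x)) * ip h b) = 0"
      using ipb ip_cnj by (intro sum.neutral) (metis complex_cnj_zero mult_zero_right)
    also have "ip h (kron x) = d x * (1 - s)"
      unfolding ipk h_def s_def
      by (simp add: sum_distrib_left complex_norm_square mult_ac del: of_real_power)
    finally have "Re (ip h h) = d x * (1 - s)" by simp
    moreover have "Re (ip h h) \<ge> 0" unfolding ip_self using pos by (auto intro!: sum_nonneg simp: less_imp_le)
    ultimately show ?thesis using pos[OF x] unfolding s_def by (auto simp: zero_le_mult_iff)
  qed
  have "real (card B) = (\<Sum>b\<in>B. Re (ip b b))" using B by simp
  also have "\<dots> = (\<Sum>x\<in>V. \<Sum>b\<in>B. d x * (cmod (b x))\<^sup>2)"
    unfolding ip_self by simp (rule sum.swap)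
  also have "\<dots> \<le> (\<Sum>x\<in>V. 1)" using bessel by (intro sum_mono) auto
  finally show ?thesis by simp
qed

text \<open>A largest orthonormal family of eigenvectors is complete: its orthogonal complement is invariant, so if it
were nonzero it would contain a further eigenvector.\<close>

lemma eigenbasis:
  obtains B lam where "orthonormal_eigenvectors B lam"
    "\<And>f. f \<in> supported V \<Longrightarrow> f = (\<lambda>x. \<Sum>b\<in>B. ip b f * b x)"
proof -
  define K where "K = {k. \<exists>B lam. orthonormal_eigenvectors B lam \<and> card B = k}"
  have "K \<subseteq> {..card V}" using orthonormal_card by (auto simp: K_def)
  then have finK: "finite K" by (rule finite_subset) simp
  have "orthonormal_eigenvectors {} (\<lambda>_. 0)" by (simp add: orthonormal_eigenvectors_def)
  then have "K \<noteq> {}" by (auto simp: K_def)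
  then have "Max K \<in> K" using finK by simp
  then obtain B lam where B: "orthonormal_eigenvectors B lam" "card B = Max K" by (auto simp: K_def)
  note B' = B(1)[unfolded orthonormal_eigenvectors_def]
  define U where "U = {f \<in> supported V. \<forall>b\<in>B. ip b f = 0}"
  have U0: "U \<subseteq> {\<lambda>_. 0}"
  proof (rule ccontr)
    assume "\<not> U \<subseteq> {\<lambda>_. 0}"
    then obtain f where f: "f \<in> U" "f \<noteq> (\<lambda>_. 0)" by auto
    have "\<exists>g\<in>U. g \<noteq> (\<lambda>_. 0) \<and> (\<exists>l::real. op g = (\<lambda>x. l * g x))"
    proof (rule eigenvector_in_invariant_subspace[OF _ _ _ f])
      show "U \<subseteq> supported V" by (auto simp: U_def)
      show "op g \<in> U" if "g \<in> U" for g
        using that B' unfolding U_def by (auto simp: mat_op_supported ip_op ip_scale)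
      show "(\<lambda>x. a * g x + b * h x) \<in> U" if "g \<in> U" "h \<in> U" for g h a b
      proof -
        have "ip c (\<lambda>x. a * g x + b * h x) = a * ip c g + b * ip c h" for c
          by (simp add: ip_def sum_distrib_left sum.distrib algebra_simps)
        then show ?thesis using that by (auto simp: U_def supported_def)
      qed
    qed
    then obtain g l where g: "g \<in> U" "g \<noteq> (\<lambda>_. 0)" "op g = (\<lambda>x. complex_of_real l * g x)" by blast
    define s where "s = Re (ip g g)"
    have s: "s > 0" using ip_pos[of g] g by (auto simp: U_def s_def)
    have gs: "ip g g = complex_of_real s" by (simp add: s_def ip_self)
    define e where "e = (\<lambda>x. complex_of_real (1 / sqrt s) * g x)"
    have ee: "ip e e = 1"
      using s unfolding e_def ip_scale gs by (simp add: field_simps flip: of_real_mult)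
    have be: "ip b e = 0" "ip e b = 0" if "b \<in> B" for b
    proof -
      have "ip b g = 0" using that g(1) by (simp add: U_def)
      then show "ip b e = 0" unfolding e_def ip_scale by simp
      then show "ip e b = 0" using ip_cnj[of b e] by simp
    qed
    have eB: "e \<notin> B" using be ee by fastforce
    have "op e = (\<lambda>x. l * e x)"
      unfolding e_def using op_lin[of "complex_of_real (1 / sqrt s)" g 0 g] by (simp add: g(3) algebra_simps)
    moreover have "e \<in> supported V" using g(1) by (auto simp: e_def U_def supported_def)
    ultimately have "orthonormal_eigenvectors (insert e B) (lam(e := l))"
      using B' eB ee be unfolding orthonormal_eigenvectors_def by auto
    then have "Suc (card B) \<in> K" using eB B' unfolding K_def by (metis (mono_tags, lifting) card_insert_disjoint mem_Collect_eq)
    then have "Suc (card B) \<le> Max K" using finK by simp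
    with B(2) show False by simp
  qed
  show ?thesis
  proof (rule that[OF B(1)])
    fix f assume f: "f \<in> supported V"
    let ?h = "\<lambda>x. f x - (\<Sum>b\<in>B. ip b f * b x)"
    have "ip c ?h = 0" if "c \<in> B" for c
    proof -
      have "(\<Sum>b\<in>B. ip b f * ip c b) = (\<Sum>b\<in>B. if b = c then ip b f else 0)"
        using B' that by (intro sum.cong) auto
      also have "\<dots> = ip c f" using B' that by simp
      finally show ?thesis by (simp add: ip_diff ip_sum)
    qed
    moreover have "?h \<in> supported V"
      using f B' by (auto simp: supported_def subset_iff intro!: sum.neutral)
    ultimately have "?h \<in> U" by (simp add: U_def)
    then have "?h = (\<lambda>_. 0)" using U0 by auto
    then show "f = (\<lambda>x. \<Sum>b\<in>B. ip b f * b x)" by (simp add: fun_eq_iff)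
  qed
qed

text \<open>Eigenvectors for different eigenvalues are orthogonal, so the expansion of an eigenvector for \<open>l\<close> involves only
basis vectors with eigenvalue \<open>l\<close>.\<close>

lemma eigenspace_eq_span:
  assumes B: "orthonormal_eigenvectors B lam"
    and exp: "\<And>f. f \<in> supported V \<Longrightarrow> f = (\<lambda>x. \<Sum>b\<in>B. ip b f * b x)"
  shows "eigenspace V M l = fun_vs.span {b \<in> B. lam b = l}"
proof (intro set_eqI iffI)
  note B' = B[unfolded orthonormal_eigenvectors_def]
  fix f assume "f \<in> eigenspace V M l"
  then have f: "f \<in> supported V" "op f = (\<lambda>x. l * f x)" by (auto simp: eigenspace_def supported_def)
  have 0: "ip b f = 0" if "b \<in> B" "lam b \<noteq> l" for b
  proof -
    have "lam b * ip b f = l * ip b f"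
      using ip_op[of b f] B' that by (simp add: f(2) ip_scale)
    with that show ?thesis by simp
  qed
  have "f = (\<lambda>x. \<Sum>b\<in>{b \<in> B. lam b = l}. ip b f * b x)"
  proof
    fix x
    have "f x = (\<Sum>b\<in>B. ip b f * b x)" using exp[OF f(1)] by metis
    also have "\<dots> = (\<Sum>b\<in>{b \<in> B. lam b = l}. ip b f * b x)"
      using B' 0 by (intro sum.mono_neutral_right) auto
    finally show "f x = (\<Sum>b\<in>{b \<in> B. lam b = l}. ip b f * b x)" .
  qed
  also have "\<dots> = (\<Sum>b\<in>{b \<in> B. lam b = l}. (\<lambda>x. ip b f * b x))"
    by (simp add: fun_eq_iff sum_fun_apply)
  also have "\<dots> \<in> fun_vs.span {b \<in> B. lam b = l}"
    by (intro fun_vs.span_sum fun_vs.span_scale fun_vs.span_base)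
  finally show "f \<in> fun_vs.span {b \<in> B. lam b = l}" .
next
  note B' = B[unfolded orthonormal_eigenvectors_def]
  fix f assume "f \<in> fun_vs.span {b \<in> B. lam b = l}"
  moreover have "fun_vs.subspace (eigenspace V M l)"
    unfolding fun_vs.subspace_def
  proof (intro conjI ballI allI)
    show "0 \<in> eigenspace V M l"
      using op_lin[of 0 "\<lambda>_. 0" 0 "\<lambda>_. 0"] by (simp add: eigenspace_def zero_fun_def)
    fix f g c assume f: "f \<in> eigenspace V M l" and g: "g \<in> eigenspace V M l"
    show "f + g \<in> eigenspace V M l"
      using f g op_lin[of 1 f 1 g] by (simp add: eigenspace_def plus_fun_def algebra_simps)
    show "(\<lambda>x. c * f x) \<in> eigenspace V M l"
    proof -
      have "op (\<lambda>x. c * f x) = (\<lambda>x. c * op f x)" using op_lin[of c f 0 f] by simp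
      also have "op f = (\<lambda>x. l * f x)" using f by (simp add: eigenspace_def)
      finally show ?thesis using f by (simp add: eigenspace_def mult.left_commute)
    qed
  qed
  moreover have "{b \<in> B. lam b = l} \<subseteq> eigenspace V M l"
    using B' by (auto simp: eigenspace_def supported_def)
  ultimately show "f \<in> eigenspace V M l"
    using fun_vs.span_minimal by blast
qed

lemma orthonormal_independent:
  assumes B: "orthonormal_eigenvectors B lam"
  shows "fun_vs.independent B"
proof
  note B' = B[unfolded orthonormal_eigenvectors_def]
  assume "fun_vs.dependent B"
  then obtain u v where u: "v \<in> B" "u v \<noteq> 0" "(\<Sum>b\<in>B. (\<lambda>x. u b * b x)) = 0"
    using fun_vs.dependent_finite[of B] B' by auto
  have "(\<lambda>x. \<Sum>b\<in>B. u b * b x) = (\<lambda>_. 0)"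
    using u(3) by (auto simp: fun_eq_iff sum_fun_apply dest: fun_cong)
  then have "ip v (\<lambda>x. \<Sum>b\<in>B. u b * b x) = 0" by (simp add: ip_def)
  moreover have "ip v (\<lambda>x. \<Sum>b\<in>B. u b * b x) = (\<Sum>b\<in>B. if b = v then u b else 0)"
    unfolding ip_sum using B' u(1) by (intro sum.cong) auto
  ultimately show False using u B' by simp
qed

text \<open>Expand each unit mass in the eigenbasis and sum first over the vertices: what remains for \<open>b\<close> is
its eigenvalue to the power \<open>k\<close> times \<open>ip b b = 1\<close>.\<close>

lemma trace_eq_sum_eigenvalues:
  assumes B: "orthonormal_eigenvectors B lam"
    and exp: "\<And>f. f \<in> supported V \<Longrightarrow> f = (\<lambda>x. \<Sum>b\<in>B. ip b f * b x)"
  shows "(\<Sum>x\<in>V. (op ^^ k) (kron x) x) = (\<Sum>b\<in>B. complex_of_real (lam b ^ k))"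
proof -
  note B' = B[unfolded orthonormal_eigenvectors_def]
  have pw: "(op ^^ k) f = (\<lambda>x. \<Sum>b\<in>B. (ip b f * lam b ^ k) * b x)" if f: "f \<in> supported V" for f
  proof (induction k)
    case 0 then show ?case using exp[OF f] by simp
  next
    case (Suc k)
    have "(op ^^ Suc k) f = op (\<lambda>x. \<Sum>b\<in>B. (ip b f * lam b ^ k) * b x)" using Suc by simp
    also have "\<dots> = (\<lambda>x. \<Sum>b\<in>B. (ip b f * lam b ^ k) * op b x)" by (rule op_sum)
    also have "\<dots> = (\<lambda>x. \<Sum>b\<in>B. (ip b f * lam b ^ Suc k) * b x)"
      using B' by (intro ext sum.cong) auto
    finally show ?case .
  qed
  have "(op ^^ k) (kron x) x = (\<Sum>b\<in>B. complex_of_real (lam b ^ k) * (d x * cnj (b x) * b x))" if x: "x \<in> V" for x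
  proof -
    have "ip g (kron x) = d x * cnj (g x)" for g
      using x fin by (simp add: ip_def if_distrib cong: if_cong)
    moreover have "kron x \<in> supported V" using x by (auto simp: supported_def)
    ultimately show ?thesis by (simp add: pw algebra_simps)
  qed
  then have "(\<Sum>x\<in>V. (op ^^ k) (kron x) x)
     = (\<Sum>b\<in>B. \<Sum>x\<in>V. complex_of_real (lam b ^ k) * (d x * cnj (b x) * b x))"
    by simp (rule sum.swap)
  also have "\<dots> = (\<Sum>b\<in>B. complex_of_real (lam b ^ k) * ip b b)"
    by (simp add: ip_def sum_distrib_left)
  finally show ?thesis using B' by simp
qed

text \<open>The sum over the spectrum weighted with multiplicities is a sum over an eigenbasis. In this form the measure is
the distribution of the eigenvalue of a uniformly chosen basis vector, and integrals against it are
averages.\<close>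

theorem cumulative_spectral_measure_eigenbasis:
  obtains B :: "('v \<Rightarrow> complex) set" and lam where
    "finite B" "card B = card V"
    "cumulative_spectral_measure V M = distr (uniform_count_measure B) borel lam"
    "\<And>b. b \<in> B \<Longrightarrow> b \<noteq> (\<lambda>_. 0) \<and> b \<in> supported V \<and> op b = (\<lambda>x. complex_of_real (lam b) * b x)"
    "\<And>k. (\<Sum>x\<in>V. (op ^^ k) (kron x) x) = (\<Sum>b\<in>B. complex_of_real (lam b ^ k))"
proof -
  obtain B lam where B: "orthonormal_eigenvectors B lam"
    and exp: "\<And>f. f \<in> supported V \<Longrightarrow> f = (\<lambda>x. \<Sum>b\<in>B. ip b f * b x)"
    using eigenbasis by blast
  note B' = B[unfolded orthonormal_eigenvectors_def]
  have tr: "\<And>k. (\<Sum>x\<in>V. (op ^^ k) (kron x) x) = (\<Sum>b\<in>B. complex_of_real (lam b ^ k))"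
    by (rule trace_eq_sum_eigenvalues[OF B exp])
  have "of_nat (card B) = (of_nat (card V) :: complex)" using tr[of 0] by simp
  then have card: "card B = card V" using of_nat_eq_iff by blast
  have ne: "b \<noteq> (\<lambda>_. 0)" if "b \<in> B" for b
  proof
    assume "b = (\<lambda>_. 0)" then have "ip b b = 0" by (simp add: ip_def)
    with B' that show False by simp
  qed
  have es: "eigenspace V M l = fun_vs.span {b \<in> B. lam b = l}" for l
    by (rule eigenspace_eq_span[OF B exp])
  have mult: "mult V M l = card {b \<in> B. lam b = l}" for l
  proof -
    have "fun_vs.independent {b \<in> B. lam b = l}"
      using orthonormal_independent[OF B] by (rule fun_vs.independent_mono) auto
    from fun_vs.dim_span_eq_card_independent[OF this] show ?thesis unfolding mult_def es .
  qed
  have spec: "spec V M = lam ` B"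
  proof (intro set_eqI iffI)
    fix l assume "l \<in> spec V M"
    then obtain f where f: "f \<in> eigenspace V M l" "f \<noteq> (\<lambda>_. 0)" by (auto simp: spec_def)
    have "{b \<in> B. lam b = l} \<noteq> {}"
    proof
      assume e: "{b \<in> B. lam b = l} = {}"
      with f show False unfolding es e by (auto simp: zero_fun_def)
    qed
    then show "l \<in> lam ` B" by auto
  next
    fix l assume "l \<in> lam ` B"
    then obtain b where "b \<in> B" "l = lam b" by auto
    with ne B' show "l \<in> spec V M" unfolding spec_def eigenspace_def supported_def by blast
  qed
  have eq: "(\<Sum>l\<in>spec V M. real (mult V M l) * indicator A l) = real (card {b \<in> B. lam b \<in> A})" for A
  proof -
    have "(\<Sum>l\<in>spec V M. real (mult V M l) * indicator A l)
        = (\<Sum>l\<in>lam ` B. \<Sum>b\<in>{b \<in> B. lam b = l}. indicator A (lam b))"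
      unfolding spec mult by (intro sum.cong) auto
    also have "\<dots> = (\<Sum>b\<in>B. indicator A (lam b))"
      using B' by (subst sum.image_gen[of B _ lam]) auto
    also have "\<dots> = real (card {b \<in> B. lam b \<in> A})"
      using B' by (simp add: indicator_def sum.If_cases Int_def)
    finally show ?thesis .
  qed
  have "cumulative_spectral_measure V M = distr (uniform_count_measure B) borel lam"
    unfolding cumulative_spectral_measure_def distr_def eq
  proof -
    have "ennreal (1 / real (card V) * real (card {b \<in> B. lam b \<in> A}))
       = emeasure (uniform_count_measure B) (lam -` A \<inter> space (uniform_count_measure B))" for A
    proof -
      have "lam -` A \<inter> space (uniform_count_measure B) = {b \<in> B. lam b \<in> A}"
        by (auto simp: space_uniform_count_measure)
      then show ?thesis using B' card by (simp add: emeasure_uniform_count_measure)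
    qed
    then show "measure_of UNIV (sets borel) (\<lambda>A. ennreal (1 / real (card V) * real (card {b \<in> B. lam b \<in> A})))
      = measure_of (space borel) (sets borel) (\<lambda>A. emeasure (uniform_count_measure B) (lam -` A \<inter> space (uniform_count_measure B)))"
      by simp
  qed
  with that[of B lam] card ne tr B' show ?thesis by auto
qed

end

section \<open>Weak convergence and moments on a bounded interval\<close>

lemma integrable_bounded_support:
  fixes g :: "real \<Rightarrow> real"
  assumes M: "finite_measure M" "sets M = sets borel" "AE x in M. x \<in> {-C..C}" and g: "continuous_on UNIV g"
  shows "integrable M g"
proof -
  interpret finite_measure M by fact
  have "bounded (g ` {-C..C})"
    by (intro compact_imp_bounded compact_continuous_image continuous_on_subset[OF g]) auto
  then obtain K where K: "\<And>x. x \<in> {-C..C} \<Longrightarrow> norm (g x) \<le> K" unfolding bounded_iff by blast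
  have "g \<in> borel_measurable M" using borel_measurable_continuous_onI[OF g] M(2)
    by (simp add: measurable_def sets_eq_imp_space_eq[OF M(2)])
  moreover have "AE x in M. norm (g x) \<le> K" using M(3) K by auto
  ultimately show ?thesis by (intro integrable_const_bound) auto
qed

lemma integral_approx_bounded_support:
  fixes g h :: "real \<Rightarrow> real"
  assumes M: "real_distribution M" "AE x in M. x \<in> {-C..C}"
    and g: "continuous_on UNIV g" and h: "continuous_on UNIV h"
    and le: "\<And>x. x \<in> {-C..C} \<Longrightarrow> \<bar>g x - h x\<bar> \<le> e"
  shows "\<bar>integral\<^sup>L M g - integral\<^sup>L M h\<bar> \<le> e"
proof -
  interpret real_distribution M by fact
  have i: "integrable M g" "integrable M h"
    using g h by (auto intro!: integrable_bounded_support[OF _ _ M(2)] finite_measure_axioms)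
  have "\<bar>integral\<^sup>L M g - integral\<^sup>L M h\<bar> = \<bar>\<integral>x. g x - h x \<partial>M\<bar>" using i by simp
  also have "\<dots> \<le> (\<integral>x. \<bar>g x - h x\<bar> \<partial>M)" by (rule integral_abs_bound)
  also have "\<dots> \<le> (\<integral>x. e \<partial>M)"
    using i M(2) le by (intro integral_mono_AE) auto
  also have "\<dots> = e" using prob_space by simp
  finally show ?thesis .
qed

text \<open>By Weierstrass, a continuous function is uniformly close to a polynomial on the interval that carries all the measures, and the
integral of a polynomial is a finite combination of moments.\<close>

theorem method_of_moments_bounded_support:
  fixes \<nu> :: "nat \<Rightarrow> real measure" and \<mu> :: "real measure"
  assumes \<nu>: "\<And>n. real_distribution (\<nu> n)" "\<And>n. AE x in \<nu> n. x \<in> {-C..C}"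
    and \<mu>: "real_distribution \<mu>" "AE x in \<mu>. x \<in> {-C..C}"
    and moments: "\<And>k. (\<lambda>n. \<integral>x. x ^ k \<partial>\<nu> n) \<longlonglongrightarrow> (\<integral>x. x ^ k \<partial>\<mu>)"
  shows "weak_conv_m \<nu> \<mu>"
proof (rule integral_bdd_continuous_conv_imp_weak_conv[OF \<nu>(1) \<mu>(1)])
  fix f :: "real \<Rightarrow> real" assume "\<And>x. isCont f x"
  then have f: "continuous_on UNIV f" by (simp add: continuous_at_imp_continuous_on)
  have fm: "finite_measure (\<nu> n)" "finite_measure \<mu>" "sets (\<nu> n) = sets borel" "sets \<mu> = sets borel" for n
    using \<nu>(1)[of n] \<mu>(1) by (auto simp: real_distribution_def prob_space_def real_distribution_axioms_def)
  show "(\<lambda>n. integral\<^sup>L (\<nu> n) f) \<longlonglongrightarrow> integral\<^sup>L \<mu> f"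
  proof (rule LIMSEQ_I)
    fix e :: real assume "e > 0"
    then have e: "e / 4 > 0" by simp
    obtain p where p: "real_polynomial_function p" "\<And>x. x \<in> {-C..C} \<Longrightarrow> \<bar>f x - p x\<bar> < e / 4"
      using Stone_Weierstrass_real_polynomial_function[OF _ continuous_on_subset[OF f subset_UNIV] e, of "{-C..C}"]
      by auto
    obtain a N where pa: "p = (\<lambda>x. \<Sum>i\<le>N. a i * x ^ i)" using p(1) real_polynomial_function_iff_sum by metis
    have pc: "continuous_on UNIV p" unfolding pa by (intro continuous_intros)
    have powc: "continuous_on UNIV (\<lambda>x::real. x ^ i)" for i by (intro continuous_intros)
    have ip: "integral\<^sup>L M p = (\<Sum>i\<le>N. a i * (\<integral>x. x ^ i \<partial>M))"
      if "finite_measure M" "sets M = sets borel" "AE x in M. x \<in> {-C..C}" for M :: "real measure"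
      unfolding pa using integrable_bounded_support[OF that powc]
      by (subst Bochner_Integration.integral_sum) auto
    have "(\<lambda>n. integral\<^sup>L (\<nu> n) p) \<longlonglongrightarrow> integral\<^sup>L \<mu> p"
      unfolding ip[OF fm(1) fm(3) \<nu>(2)] ip[OF fm(2) fm(4) \<mu>(2)] by (intro tendsto_intros moments)
    from LIMSEQ_D[OF this, of "e / 4"] e obtain n0
      where n0: "\<And>n. n \<ge> n0 \<Longrightarrow> \<bar>integral\<^sup>L (\<nu> n) p - integral\<^sup>L \<mu> p\<bar> < e / 4" by auto
    have "\<bar>integral\<^sup>L (\<nu> n) f - integral\<^sup>L \<mu> f\<bar> < e" if "n \<ge> n0" for n
    proof -
      have "\<bar>integral\<^sup>L (\<nu> n) f - integral\<^sup>L (\<nu> n) p\<bar> \<le> e / 4"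
        by (rule integral_approx_bounded_support[OF \<nu> f pc]) (use p(2) less_imp_le in blast)
      moreover have "\<bar>integral\<^sup>L \<mu> f - integral\<^sup>L \<mu> p\<bar> \<le> e / 4"
        by (rule integral_approx_bounded_support[OF \<mu> f pc]) (use p(2) less_imp_le in blast)
      ultimately show ?thesis using n0[OF that] e by linarith
    qed
    then show "\<exists>no. \<forall>n\<ge>no. norm (integral\<^sup>L (\<nu> n) f - integral\<^sup>L \<mu> f) < e" by auto
  qed
qed

text \<open>Powers are unbounded on the line, but they may be truncated outside the interval that carries the measures
without changing any integral.\<close>

theorem weak_conv_moments_bounded_support:
  fixes \<nu> :: "nat \<Rightarrow> real measure" and \<mu> :: "real measure"
  assumes \<nu>: "\<And>n. real_distribution (\<nu> n)" "\<And>n. AE x in \<nu> n. x \<in> {-C..C}"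
    and \<mu>: "real_distribution \<mu>" "AE x in \<mu>. x \<in> {-C..C}"
    and weak: "weak_conv_m \<nu> \<mu>"
  shows "(\<lambda>n. \<integral>x. x ^ k \<partial>\<nu> n) \<longlonglongrightarrow> (\<integral>x. x ^ k \<partial>\<mu>)"
proof -
  let ?g = "\<lambda>x::real. (max (-C) (min C x)) ^ k"
  have c: "continuous_on UNIV ?g" by (intro continuous_intros)
  have b: "norm (?g x) \<le> \<bar>C\<bar> ^ k" for x
    unfolding norm_power by (intro power_mono) auto
  have "(\<lambda>n. integral\<^sup>L (\<nu> n) ?g) \<longlonglongrightarrow> integral\<^sup>L \<mu> ?g"
    by (rule weak_conv_imp_integral_bdd_continuous_conv[OF \<nu>(1) \<mu>(1) weak _ b])
      (use c continuous_on_eq_continuous_at in blast)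
  moreover have "integral\<^sup>L M ?g = (\<integral>x. x ^ k \<partial>M)"
    if "real_distribution M" "AE x in M. x \<in> {-C..C}" for M
  proof -
    interpret real_distribution M by fact
    show ?thesis using that(2) by (intro integral_cong_AE) auto
  qed
  ultimately show ?thesis using \<nu> \<mu> by simp
qed

section \<open>Moments of spectral measures on l2\<close>

lemma ell2_finite_support:
  assumes "f \<in> supported V" "finite {x. f x \<noteq> 0}"
  shows "f \<in> ell2 V"
proof -
  have "(\<lambda>x. (cmod (f x))\<^sup>2) summable_on V \<longleftrightarrow> (\<lambda>x. (cmod (f x))\<^sup>2) summable_on {x. f x \<noteq> 0}"
    using assms(1) by (intro summable_on_cong_neutral) (auto simp: supported_def)
  with assms show ?thesis by (simp add: ell2_def supported_def)
qed

lemma ell2_mult_summable: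
  assumes "f \<in> ell2 V" "g \<in> ell2 V"
  shows "(\<lambda>x. cnj (f x) * g x) summable_on V"
proof -
  have "(\<lambda>x. (cmod (f x))\<^sup>2 + (cmod (g x))\<^sup>2) summable_on V"
    using assms by (auto simp: ell2_def intro: summable_on_add)
  then have "(\<lambda>x. norm ((cmod (f x))\<^sup>2 + (cmod (g x))\<^sup>2)) summable_on V" by simp
  then have "(\<lambda>x. norm (cnj (f x) * g x)) summable_on V"
  proof (rule Infinite_Sum.abs_summable_on_comparison_test)
    fix x
    have "cmod (f x) * cmod (g x) \<le> (cmod (f x))\<^sup>2 + (cmod (g x))\<^sup>2"
      using sum_squares_bound[of "cmod (f x)" "cmod (g x)"]
        mult_nonneg_nonneg[OF norm_ge_zero[of "f x"] norm_ge_zero[of "g x"]] by linarith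
    then show "norm (cnj (f x) * g x) \<le> norm ((cmod (f x))\<^sup>2 + (cmod (g x))\<^sup>2)"
      by (simp add: norm_mult)
  qed
  then show ?thesis by (rule abs_summable_summable)
qed

lemma ell2_add:
  assumes "f \<in> ell2 V" "g \<in> ell2 V"
  shows "(\<lambda>x. f x + g x) \<in> ell2 V"
proof -
  have "(\<lambda>x. 2 * ((cmod (f x))\<^sup>2 + (cmod (g x))\<^sup>2)) summable_on V"
    using assms by (intro summable_on_cmult_right summable_on_add) (auto simp: ell2_def)
  then have "(\<lambda>x. norm (2 * ((cmod (f x))\<^sup>2 + (cmod (g x))\<^sup>2))) summable_on V" by simp
  then have "(\<lambda>x. norm ((cmod (f x + g x))\<^sup>2)) summable_on V"
  proof (rule Infinite_Sum.abs_summable_on_comparison_test)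
    fix x
    have "(cmod (f x + g x))\<^sup>2 \<le> (cmod (f x) + cmod (g x))\<^sup>2"
      by (intro power_mono norm_triangle_ineq) auto
    also have "\<dots> \<le> 2 * ((cmod (f x))\<^sup>2 + (cmod (g x))\<^sup>2)"
      using sum_squares_bound[of "cmod (f x)" "cmod (g x)"] by (simp add: power2_sum)
    finally show "norm ((cmod (f x + g x))\<^sup>2) \<le> norm (2 * ((cmod (f x))\<^sup>2 + (cmod (g x))\<^sup>2))" by simp
  qed
  then show ?thesis using assms by (auto simp: ell2_def)
qed

lemma ell2_scale:
  assumes "f \<in> ell2 V" shows "(\<lambda>x. c * f x) \<in> ell2 V"
  using assms by (auto simp: ell2_def norm_mult power_mult_distrib intro: summable_on_cmult_right)

lemma ell2_comb: "f \<in> ell2 V \<Longrightarrow> g \<in> ell2 V \<Longrightarrow> (\<lambda>x. c * f x + d * g x) \<in> ell2 V"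
  by (intro ell2_add ell2_scale)

lemma l2_inner_comb:
  assumes "f \<in> ell2 V" "g \<in> ell2 V" "h \<in> ell2 V"
  shows "l2_inner V h (\<lambda>x. c * f x + d * g x) = c * l2_inner V h f + d * l2_inner V h g"
proof -
  have "l2_inner V h (\<lambda>x. c * f x + d * g x)
      = (\<Sum>\<^sub>\<infinity>x\<in>V. c * (cnj (h x) * f x) + d * (cnj (h x) * g x))"
    by (simp add: l2_inner_def algebra_simps)
  also have "\<dots> = c * l2_inner V h f + d * l2_inner V h g"
    unfolding l2_inner_def using ell2_mult_summable[OF assms(3,1)] ell2_mult_summable[OF assms(3,2)]
    by (subst infsum_add) (auto simp: infsum_cmult_right' intro!: summable_on_cmult_right)
  finally show ?thesis .
qed

lemma l2_inner_cnj: "cnj (l2_inner V f g) = l2_inner V g f"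
  unfolding l2_inner_def infsum_cnj[symmetric] by (simp add: mult.commute)

lemma l2_inner_finite_support:
  assumes "f \<in> supported V" "finite A" "\<And>x. x \<notin> A \<Longrightarrow> f x = 0"
  shows "l2_inner V f g = (\<Sum>x\<in>A. cnj (f x) * g x)"
proof -
  have "l2_inner V f g = (\<Sum>\<^sub>\<infinity>x\<in>A. cnj (f x) * g x)"
    unfolding l2_inner_def by (rule infsum_cong_neutral) (use assms in \<open>auto simp: supported_def\<close>)
  with assms show ?thesis by simp
qed

lemma l2_inner_self_nonneg: "Re (l2_inner V f f) \<ge> 0"
proof (cases "(\<lambda>x. cnj (f x) * f x) summable_on V")
  case True
  then have "Re (l2_inner V f f) = (\<Sum>\<^sub>\<infinity>x\<in>V. Re (cnj (f x) * f x))"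
    unfolding l2_inner_def by (rule infsum_Re[symmetric])
  then show ?thesis by (simp add: infsum_nonneg)
qed (simp add: l2_inner_def infsum_not_exists)

text \<open>A resolution of the identity is tied to its operator through quadratic forms. For a symmetric operator two
values of the quadratic form recover the real part of a mixed term.\<close>

lemma l2_polarization:
  assumes u: "u \<in> ell2 V" and v: "v \<in> ell2 V" and Fu: "F u \<in> ell2 V" and Fv: "F v \<in> ell2 V"
    and lin: "\<And>c d. F (\<lambda>x. c * u x + d * v x) = (\<lambda>x. c * F u x + d * F v x)"
    and sym: "l2_inner V u (F v) = l2_inner V (F u) v"
  shows "4 * Re (l2_inner V u (F v)) =
      Re (l2_inner V (\<lambda>x. 1 * u x + 1 * v x) (F (\<lambda>x. 1 * u x + 1 * v x)))
    - Re (l2_inner V (\<lambda>x. 1 * u x + (-1) * v x) (F (\<lambda>x. 1 * u x + (-1) * v x)))"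
proof -
  have comb1: "l2_inner V (\<lambda>x. c * u x + d * v x) h = cnj c * l2_inner V u h + cnj d * l2_inner V v h"
    if "h \<in> ell2 V" for c d h
    using l2_inner_comb[OF u v that, of c d] by (metis complex_cnj_add complex_cnj_mult l2_inner_cnj)
  have "Re (l2_inner V (\<lambda>x. 1 * u x + d * v x) (F (\<lambda>x. 1 * u x + d * v x))) =
     Re (l2_inner V u (F u)) + Re d * (2 * Re (l2_inner V u (F v))) + Re (cnj d * d * l2_inner V v (F v))"
    if d: "d \<in> \<real>" for d
  proof -
    have "l2_inner V (\<lambda>x. 1 * u x + d * v x) (F (\<lambda>x. 1 * u x + d * v x)) =
       l2_inner V u (F u) + d * l2_inner V u (F v) + cnj d * l2_inner V v (F u) + cnj d * d * l2_inner V v (F v)"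
      unfolding lin comb1[OF ell2_comb[OF Fu Fv]]
        l2_inner_comb[OF Fu Fv u] l2_inner_comb[OF Fu Fv v] by (simp add: algebra_simps)
    moreover have "l2_inner V v (F u) = cnj (l2_inner V u (F v))"
      using sym l2_inner_cnj by metis
    ultimately show ?thesis using d by (auto simp: Reals_def)
  qed
  from this[of 1] this[of "-1"] show ?thesis by simp
qed

text \<open>Polarization produces differences of measures. Moving the negative terms to the other side turns them
into equalities between sums of two positive measures, which pass from sets to integrals.\<close>

lemma nn_integral_add_measure_eq:
  assumes s: "sets M1 = sets borel" "sets M2 = sets borel" "sets M3 = sets borel" "sets M4 = sets borel"
    and em: "\<And>B. B \<in> sets borel \<Longrightarrow> emeasure M1 B + emeasure M2 B = emeasure M3 B + emeasure M4 B"
    and g: "g \<in> borel_measurable borel"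
  shows "(\<integral>\<^sup>+x. g x \<partial>M1) + (\<integral>\<^sup>+x. g x \<partial>M2) = (\<integral>\<^sup>+x. g x \<partial>M3) + (\<integral>\<^sup>+x. g x \<partial>M4)"
  using g
proof (induction rule: borel_measurable_induct)
  case (cong f g)
  then have "f = g" by auto
  with cong show ?case by simp
next
  case (set A)
  then show ?case using em s by simp
next
  case (mult u c)
  note [measurable_cong] = s
  have [measurable]: "u \<in> borel_measurable borel" by fact
  show ?case using mult by (simp add: nn_integral_cmult distrib_left[symmetric])
next
  case (add u v)
  note [measurable_cong] = s
  have [measurable]: "u \<in> borel_measurable borel" "v \<in> borel_measurable borel" by fact+
  have "(\<integral>\<^sup>+x. (v x + u x) \<partial>M) = (\<integral>\<^sup>+x. v x \<partial>M) + (\<integral>\<^sup>+x. u x \<partial>M)" if "sets M = sets borel" for M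
  proof -
    note [measurable_cong] = that
    show ?thesis by (rule nn_integral_add) measurable
  qed
  note L = this
  have swap: "(a + b) + (c + d) = (a + c) + (b + d)" for a b c d :: ennreal
    by (simp add: ac_simps)
  show ?case unfolding L[OF s(1)] L[OF s(2)] L[OF s(3)] L[OF s(4)]
    by (subst (1 2) swap) (simp only: add.IH)
next
  case (seq U)
  have [measurable]: "U i \<in> borel_measurable borel" for i by fact
  have lim: "(\<lambda>i. \<integral>\<^sup>+x. U i x \<partial>M) \<longlonglongrightarrow> (\<integral>\<^sup>+x. (SUP i. U i) x \<partial>M)" if "sets M = sets borel" for M
  proof -
    note [measurable_cong] = that
    have "(\<integral>\<^sup>+x. (SUP i. U i) x \<partial>M) = (SUP i. \<integral>\<^sup>+x. U i x \<partial>M)"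
      unfolding SUP_apply by (rule nn_integral_monotone_convergence_SUP) (use seq in auto)
    moreover have "incseq (\<lambda>i. \<integral>\<^sup>+x. U i x \<partial>M)"
      using seq by (auto simp: incseq_def le_fun_def intro!: nn_integral_mono)
    ultimately show ?thesis using LIMSEQ_SUP by metis
  qed
  have "(\<lambda>i. (\<integral>\<^sup>+x. U i x \<partial>M1) + (\<integral>\<^sup>+x. U i x \<partial>M2)) \<longlonglongrightarrow> (\<integral>\<^sup>+x. (SUP i. U i) x \<partial>M1) + (\<integral>\<^sup>+x. (SUP i. U i) x \<partial>M2)"
    using s by (intro tendsto_add lim) auto
  moreover have "(\<lambda>i. (\<integral>\<^sup>+x. U i x \<partial>M1) + (\<integral>\<^sup>+x. U i x \<partial>M2)) \<longlonglongrightarrow> (\<integral>\<^sup>+x. (SUP i. U i) x \<partial>M3) + (\<integral>\<^sup>+x. (SUP i. U i) x \<partial>M4)"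
    unfolding seq.IH using s by (intro tendsto_add lim) auto
  ultimately show ?case using LIMSEQ_unique by blast
qed

lemma integral_add_measure_eq:
  fixes g :: "real \<Rightarrow> real"
  assumes s: "sets M1 = sets borel" "sets M2 = sets borel" "sets M3 = sets borel" "sets M4 = sets borel"
    and em: "\<And>B. B \<in> sets borel \<Longrightarrow> emeasure M1 B + emeasure M2 B = emeasure M3 B + emeasure M4 B"
    and g: "g \<in> borel_measurable borel"
    and i: "integrable M1 g" "integrable M2 g" "integrable M3 g" "integrable M4 g"
  shows "integral\<^sup>L M1 g + integral\<^sup>L M2 g = integral\<^sup>L M3 g + integral\<^sup>L M4 g"
proof -
  have fin: "(\<integral>\<^sup>+x. ennreal (g x) \<partial>M) < \<top>" "(\<integral>\<^sup>+x. ennreal (- g x) \<partial>M) < \<top>" if "integrable M g" for M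
    using that by (auto simp: real_integrable_def less_top)
  have "(\<integral>\<^sup>+x. ennreal (g x) \<partial>M1) + (\<integral>\<^sup>+x. ennreal (g x) \<partial>M2) = (\<integral>\<^sup>+x. ennreal (g x) \<partial>M3) + (\<integral>\<^sup>+x. ennreal (g x) \<partial>M4)"
    by (rule nn_integral_add_measure_eq[OF s em]) (use g in auto)
  then have p: "enn2real (\<integral>\<^sup>+x. ennreal (g x) \<partial>M1) + enn2real (\<integral>\<^sup>+x. ennreal (g x) \<partial>M2) = enn2real (\<integral>\<^sup>+x. ennreal (g x) \<partial>M3) + enn2real (\<integral>\<^sup>+x. ennreal (g x) \<partial>M4)"
    using fin i by (metis enn2real_plus)
  have "(\<integral>\<^sup>+x. ennreal (- g x) \<partial>M1) + (\<integral>\<^sup>+x. ennreal (- g x) \<partial>M2) = (\<integral>\<^sup>+x. ennreal (- g x) \<partial>M3) + (\<integral>\<^sup>+x. ennreal (- g x) \<partial>M4)"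
    by (rule nn_integral_add_measure_eq[OF s em]) (use g in auto)
  then have "enn2real (\<integral>\<^sup>+x. ennreal (- g x) \<partial>M1) + enn2real (\<integral>\<^sup>+x. ennreal (- g x) \<partial>M2) = enn2real (\<integral>\<^sup>+x. ennreal (- g x) \<partial>M3) + enn2real (\<integral>\<^sup>+x. ennreal (- g x) \<partial>M4)"
    using fin i by (metis enn2real_plus)
  with p show ?thesis using i by (simp add: real_lebesgue_integral_def)
qed

text \<open>Symmetry and the bound on the row sums make \<open>M\<close> a contraction of \<open>ell2 V\<close>; finiteness of the rows turns the operator into
finite sums and keeps finite supports finite.\<close>

locale resolved_operator =
  fixes V :: "'v set" and M :: "'v \<Rightarrow> 'v \<Rightarrow> real" and E :: "real set \<Rightarrow> ('v \<Rightarrow> complex) \<Rightarrow> ('v \<Rightarrow> complex)"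
  assumes M_sym: "x \<in> V \<Longrightarrow> y \<in> V \<Longrightarrow> M x y = M y x"
    and M_nonneg: "M x y \<ge> 0"
    and M_finite: "x \<in> V \<Longrightarrow> finite {y \<in> V. M x y \<noteq> 0}"
    and M_row: "x \<in> V \<Longrightarrow> (\<Sum>y\<in>{y \<in> V. M x y \<noteq> 0}. M x y) \<le> 1"
    and E: "resolution_of_identity V (mat_op V M) E"
begin

abbreviation "Q \<equiv> mat_op V M"
abbreviation "nb x \<equiv> {y \<in> V. M x y \<noteq> 0}"

lemma Q_eq:
  fixes f :: "'v \<Rightarrow> complex"
  assumes "x \<in> V" "finite A" "nb x \<subseteq> A" "A \<subseteq> V" shows "Q f x = (\<Sum>y\<in>A. M x y * f y)"
proof -
  have "Q f x = (\<Sum>\<^sub>\<infinity>y\<in>A. complex_of_real (M x y) * f y)"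
  proof -
    have "(\<Sum>\<^sub>\<infinity>y\<in>V. complex_of_real (M x y) * f y) = (\<Sum>\<^sub>\<infinity>y\<in>A. complex_of_real (M x y) * f y)"
      using assms by (intro infsum_cong_neutral) auto
    with assms show ?thesis by (simp add: mat_op_def)
  qed
  with assms show ?thesis by simp
qed

lemma Q_lin: "Q (\<lambda>x. c * f x + d * g x) = (\<lambda>x. c * Q f x + d * Q g x)"
proof
  fix x
  show "Q (\<lambda>x. c * f x + d * g x) x = c * Q f x + d * Q g x"
  proof (cases "x \<in> V")
    case True
    show ?thesis unfolding Q_eq[OF True M_finite[OF True] subset_refl Collect_restrict]
      by (simp add: sum_distrib_left sum.distrib algebra_simps)
  qed (simp add: mat_op_def)
qed

text \<open>Jensen's inequality for the substochastic row of \<open>x\<close>.\<close>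

lemma cauchy_schwarz_row:
  assumes x: "x \<in> V" shows "(cmod (Q f x))\<^sup>2 \<le> (\<Sum>y\<in>nb x. M x y * (cmod (f y))\<^sup>2)"
proof -
  have "cmod (Q f x) \<le> (\<Sum>y\<in>nb x. M x y * cmod (f y))"
    unfolding Q_eq[OF x M_finite[OF x] subset_refl Collect_restrict]
    by (rule order_trans[OF norm_sum]) (simp add: norm_mult M_nonneg)
  then have "(cmod (Q f x))\<^sup>2 \<le> (\<Sum>y\<in>nb x. sqrt (M x y) * (sqrt (M x y) * cmod (f y)))\<^sup>2"
    by (simp add: M_nonneg mult.assoc[symmetric] power_mono)
  also have "\<dots> \<le> (\<Sum>y\<in>nb x. (sqrt (M x y))\<^sup>2) * (\<Sum>y\<in>nb x. (sqrt (M x y) * cmod (f y))\<^sup>2)"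
    by (rule Cauchy_Schwarz_ineq_sum)
  also have "\<dots> = (\<Sum>y\<in>nb x. M x y) * (\<Sum>y\<in>nb x. M x y * (cmod (f y))\<^sup>2)"
    by (simp add: M_nonneg power_mult_distrib)
  also have "\<dots> \<le> 1 * (\<Sum>y\<in>nb x. M x y * (cmod (f y))\<^sup>2)"
    using M_row[OF x] by (intro mult_right_mono sum_nonneg) (auto simp: M_nonneg)
  finally show ?thesis by simp
qed

text \<open>Sum the inequality of the preceding lemma over \<open>x\<close>: by symmetry the column sums of \<open>M\<close> are also at most 1.\<close>

lemma Q_ell2: assumes f: "f \<in> ell2 V" shows "Q f \<in> ell2 V"
proof -
  let ?n = "\<lambda>x. (cmod (f x))\<^sup>2"
  have sm: "?n summable_on V" using f by (simp add: ell2_def)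
  have "sum (\<lambda>x. (cmod (Q f x))\<^sup>2) F \<le> infsum ?n V" if F: "F \<subseteq> V" "finite F" for F
  proof -
    define G where "G = (\<Union>x\<in>F. nb x)"
    have G: "finite G" "G \<subseteq> V" using F M_finite by (auto simp: G_def)
    have "sum (\<lambda>x. (cmod (Q f x))\<^sup>2) F \<le> (\<Sum>x\<in>F. \<Sum>y\<in>G. M x y * ?n y)"
    proof (rule sum_mono)
      fix x assume x: "x \<in> F"
      have "(cmod (Q f x))\<^sup>2 \<le> (\<Sum>y\<in>nb x. M x y * ?n y)" using x F by (intro cauchy_schwarz_row) auto
      also have "\<dots> \<le> (\<Sum>y\<in>G. M x y * ?n y)"
        using x G by (intro sum_mono2) (auto simp: G_def M_nonneg)
      finally show "(cmod (Q f x))\<^sup>2 \<le> (\<Sum>y\<in>G. M x y * ?n y)" .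
    qed
    also have "\<dots> = (\<Sum>y\<in>G. (\<Sum>x\<in>F. M x y) * ?n y)"
      by (subst sum.swap) (simp add: sum_distrib_right)
    also have "\<dots> \<le> (\<Sum>y\<in>G. 1 * ?n y)"
    proof (intro sum_mono mult_right_mono)
      fix y assume y: "y \<in> G"
      then have yV: "y \<in> V" using G by auto
      have "(\<Sum>x\<in>F. M x y) = (\<Sum>x\<in>F. M y x)" using yV F M_sym by (intro sum.cong) auto
      also have "\<dots> = (\<Sum>x\<in>F \<inter> nb y. M y x)" using F by (intro sum.mono_neutral_right) auto
      also have "\<dots> \<le> (\<Sum>x\<in>nb y. M y x)"
        using M_finite[OF yV] by (intro sum_mono2) (auto simp: M_nonneg)
      finally show "(\<Sum>x\<in>F. M x y) \<le> 1" using M_row[OF yV] by simp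
    qed auto
    also have "\<dots> \<le> infsum ?n V" using finite_sum_le_infsum[OF sm G] by simp
    finally show ?thesis .
  qed
  then have "(\<lambda>x. (cmod (Q f x))\<^sup>2) summable_on V"
    by (intro nonneg_bdd_above_summable_on) (auto simp: bdd_above_def)
  then show ?thesis by (simp add: ell2_def mat_op_def)
qed

lemma Q_finite_support:
  assumes f: "f \<in> supported V" "finite {x. f x \<noteq> 0}"
  shows "finite {x. Q f x \<noteq> 0}"
proof (rule finite_subset)
  show "finite (\<Union>y\<in>{x. f x \<noteq> 0}. nb y)"
    using f M_finite by (auto simp: supported_def)
  show "{x. Q f x \<noteq> 0} \<subseteq> (\<Union>y\<in>{x. f x \<noteq> 0}. nb y)"
  proof
    fix x assume "x \<in> {x. Q f x \<noteq> 0}"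
    then have x: "x \<in> V" "Q f x \<noteq> 0" by (auto simp: mat_op_def split: if_splits)
    then have "\<exists>y\<in>nb x. M x y * f y \<noteq> 0"
      unfolding Q_eq[OF x(1) M_finite[OF x(1)] subset_refl Collect_restrict] by (meson sum.not_neutral_contains_not_neutral)
    then show "x \<in> (\<Union>y\<in>{x. f x \<noteq> 0}. nb y)" using x M_sym by auto
  qed
qed

lemma Q_symmetric:
  assumes u: "u \<in> supported V" "finite {x. u x \<noteq> 0}"
  shows "l2_inner V u (Q v) = l2_inner V (Q u) v"
proof -
  define A where "A = {x. u x \<noteq> 0}"
  define B where "B = A \<union> (\<Union>x\<in>A. nb x)"
  have A: "finite A" "A \<subseteq> V" "\<And>x. x \<notin> A \<Longrightarrow> u x = 0" using u by (auto simp: A_def supported_def)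
  have B: "finite B" "B \<subseteq> V" using A M_finite by (auto simp: B_def)
  have QuB: "x \<in> V \<Longrightarrow> Q u x = (\<Sum>y\<in>A. M x y * u y)" for x
  proof -
    assume x: "x \<in> V"
    have "Q u x = (\<Sum>y\<in>nb x. M x y * u y)" by (rule Q_eq[OF x M_finite[OF x] subset_refl Collect_restrict])
    also have "\<dots> = (\<Sum>y\<in>nb x \<union> A. M x y * u y)"
      using M_finite[OF x] A by (intro sum.mono_neutral_left) auto
    also have "\<dots> = (\<Sum>y\<in>A. M x y * u y)"
      using M_finite[OF x] A by (intro sum.mono_neutral_right) auto
    finally show ?thesis .
  qed
  have Qu0: "Q u x = 0" if "x \<notin> B" for x
  proof (cases "x \<in> V")
    case True
    have "M x y = 0" if "y \<in> A" for y
      using that \<open>x \<notin> B\<close> A True M_sym[of x y] by (auto simp: B_def)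
    then show ?thesis unfolding QuB[OF True] by simp
  qed (simp add: mat_op_def)
  have "l2_inner V u (Q v) = (\<Sum>x\<in>A. cnj (u x) * Q v x)"
    by (rule l2_inner_finite_support[OF u(1) A(1,3)])
  also have "\<dots> = (\<Sum>x\<in>A. \<Sum>y\<in>B. cnj (u x) * M x y * v y)"
  proof (rule sum.cong)
    fix x assume x: "x \<in> A"
    then have "Q v x = (\<Sum>y\<in>B. M x y * v y)" using A B by (intro Q_eq) (auto simp: B_def)
    then show "cnj (u x) * Q v x = (\<Sum>y\<in>B. cnj (u x) * M x y * v y)"
      by (simp add: sum_distrib_left algebra_simps)
  qed simp
  also have "\<dots> = (\<Sum>y\<in>B. \<Sum>x\<in>A. cnj (u x) * M x y * v y)" by (rule sum.swap)
  also have "\<dots> = (\<Sum>y\<in>B. cnj (Q u y) * v y)"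
  proof (rule sum.cong)
    fix y assume y: "y \<in> B"
    then have "y \<in> V" using B by auto
    then have "cnj (Q u y) = (\<Sum>x\<in>A. cnj (u x) * M x y)"
      using QuB[of y] A(2) M_sym[of y] by (simp add: subset_iff mult.commute cong: sum.cong)
    then show "(\<Sum>x\<in>A. cnj (u x) * M x y * v y) = cnj (Q u y) * v y"
      by (simp add: sum_distrib_right)
  qed simp
  also have "\<dots> = l2_inner V (Q u) v"
    by (rule l2_inner_finite_support[symmetric, OF mat_op_supported B(1) Qu0])
  finally show ?thesis .
qed

lemma pvm: "projection_valued_measure V E"
  using E by (simp add: resolution_of_identity_def)

lemma E_ell2: "B \<in> sets borel \<Longrightarrow> f \<in> ell2 V \<Longrightarrow> E B f \<in> ell2 V"
  and E_lin: "B \<in> sets borel \<Longrightarrow> f \<in> ell2 V \<Longrightarrow> g \<in> ell2 V \<Longrightarrow> E B (\<lambda>x. c * f x + d * g x) = (\<lambda>x. c * E B f x + d * E B g x)"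
  and E_sym: "B \<in> sets borel \<Longrightarrow> f \<in> ell2 V \<Longrightarrow> g \<in> ell2 V \<Longrightarrow> l2_inner V (E B f) g = l2_inner V f (E B g)"
  and E_idem: "B \<in> sets borel \<Longrightarrow> f \<in> ell2 V \<Longrightarrow> E B (E B f) = E B f"
  and E_UNIV: "f \<in> ell2 V \<Longrightarrow> E UNIV f = f"
  and E_inter: "A \<in> sets borel \<Longrightarrow> B \<in> sets borel \<Longrightarrow> f \<in> ell2 V \<Longrightarrow> E A (E B f) = E (A \<inter> B) f"
  using pvm by (auto simp: projection_valued_measure_def l2_projection_def)

lemma E_sums: "range B \<subseteq> sets borel \<Longrightarrow> disjoint_family B \<Longrightarrow> f \<in> ell2 V \<Longrightarrow> g \<in> ell2 V \<Longrightarrow>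
   (\<lambda>n. l2_inner V f (E (B n) g)) sums l2_inner V f (E (\<Union>n::nat. B n) g)"
  using pvm by (auto simp: projection_valued_measure_def)

text \<open>For a projection, \<open>\<langle>f, E B f\<rangle> = \<langle>E B f, E B f\<rangle>\<close>.\<close>

lemma E_nonneg:
  assumes "B \<in> sets borel" "f \<in> ell2 V" shows "Re (l2_inner V f (E B f)) \<ge> 0"
proof -
  have "l2_inner V f (E B f) = l2_inner V (E B f) (E B f)"
    using assms E_sym E_idem E_ell2 by metis
  then show ?thesis using l2_inner_self_nonneg by metis
qed

text \<open>The empty set is the disjoint union of infinitely many copies of itself, so the constant series with
this term converges.\<close>

lemma E_empty:
  assumes f: "f \<in> ell2 V" "g \<in> ell2 V" shows "l2_inner V f (E {} g) = 0"
proof -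
  have "(\<lambda>n::nat. l2_inner V f (E {} g)) sums l2_inner V f (E {} g)"
    using E_sums[of "\<lambda>_. {}" f g] f by (simp add: disjoint_family_on_def)
  then have "(\<lambda>n::nat. l2_inner V f (E {} g)) \<longlonglongrightarrow> 0" using sums_summable summable_LIMSEQ_zero by blast
  then show ?thesis by (simp add: LIMSEQ_const_iff)
qed

abbreviation "\<mu> \<equiv> diagonal_measure V E"

lemma sets_diagonal: "sets (\<mu> f) = sets borel" and space_diagonal: "space (\<mu> f) = UNIV"
  unfolding diagonal_measure_def by (simp_all add: sets_measure_of_conv space_measure_of_conv)
     (metis sets.sigma_sets_eq space_borel)

lemma emeasure_diagonal:
  assumes f: "f \<in> ell2 V" and B: "B \<in> sets borel"
  shows "emeasure (\<mu> f) B = ennreal (Re (l2_inner V f (E B f)))"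
  unfolding diagonal_measure_def
proof (rule emeasure_measure_of_sigma[OF _ _ _ B])
  show "sigma_algebra UNIV (sets borel :: real set set)"
    using sets.sigma_algebra_axioms[of "borel :: real measure"] by simp
  show "positive (sets borel) (\<lambda>B. ennreal (Re (l2_inner V f (E B f))))"
    by (simp add: positive_def E_empty[OF f f])
  show "countably_additive (sets borel) (\<lambda>B. ennreal (Re (l2_inner V f (E B f))))"
    unfolding countably_additive_def
  proof (intro allI impI)
    fix A :: "nat \<Rightarrow> real set" assume A: "range A \<subseteq> sets borel" "disjoint_family A"
    have "(\<lambda>n. Re (l2_inner V f (E (A n) f))) sums Re (l2_inner V f (E (\<Union>n. A n) f))"
      using sums_Re[OF E_sums[OF A f f]] .
    then show "(\<Sum>n. ennreal (Re (l2_inner V f (E (A n) f)))) = ennreal (Re (l2_inner V f (E (\<Union>n. A n) f)))"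
      using A E_nonneg[OF _ f] by (intro suminf_ennreal_eq) (auto simp: subset_iff)
  qed
qed

lemma measure_diagonal:
  assumes f: "f \<in> ell2 V" and B: "B \<in> sets borel"
  shows "measure (\<mu> f) B = Re (l2_inner V f (E B f))"
  using emeasure_diagonal[OF assms] E_nonneg[OF B f] by (simp add: measure_def)

lemma finite_diagonal: "f \<in> ell2 V \<Longrightarrow> finite_measure (\<mu> f)"
  by (intro finite_measureI) (simp add: space_diagonal emeasure_diagonal)

text \<open>One interval serves for all vectors, namely the one that carries the resolution of the identity.\<close>

lemma support_diagonal:
  obtains C where "\<And>f. f \<in> ell2 V \<Longrightarrow> AE x in \<mu> f. x \<in> {-C..C}"
proof -
  obtain C where C: "\<And>f. f \<in> ell2 V \<Longrightarrow> E {-C..C} f = f"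
    using E by (auto simp: resolution_of_identity_def)
  have "AE x in \<mu> f. x \<in> {-C..C}" if f: "f \<in> ell2 V" for f
  proof -
    have "E (- {-C..C}) f = E {} f"
      using E_inter[of "- {-C..C}" "{-C..C}" f] C[OF f] f by simp
    then have "emeasure (\<mu> f) (- {-C..C}) = 0"
      by (simp add: emeasure_diagonal f E_empty)
    then have "- {-C..C} \<in> null_sets (\<mu> f)" by (auto simp: null_sets_def sets_diagonal)
    then show ?thesis by (rule AE_I') auto
  qed
  then show ?thesis using that by blast
qed

lemma Q_form: "f \<in> ell2 V \<Longrightarrow> Re (l2_inner V f (Q f)) = (\<integral>l. l \<partial>\<mu> f)"
  using E by (simp add: resolution_of_identity_def)

lemma integrable_diagonal:
  assumes f: "f \<in> ell2 V" and g: "continuous_on UNIV g" and B: "B \<in> sets borel"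
  shows "integrable (\<mu> f) (\<lambda>l. indicator B l * (g l :: real))"
proof -
  obtain C where C: "AE x in \<mu> f. x \<in> {-C..C}" using support_diagonal f by metis
  have "integrable (\<mu> f) g"
    by (rule integrable_bounded_support[OF finite_diagonal[OF f] sets_diagonal C g])
  from integrable_mult_indicator[OF _ this, of B] B show ?thesis by (simp add: sets_diagonal)
qed

text \<open>This extends the relation \<open>\<langle>f, Q f\<rangle> = \<integral> l d\<langle>f, E f\<rangle>\<close> to mixed terms, in real parts throughout: if the signed measure \<open>\<langle>u, E v\<rangle>\<close> has density \<open>w\<close>
with respect to the spectral measure of \<open>f\<close>, then \<open>\<langle>u, Q v\<rangle>\<close> is the integral of \<open>l\<close>
against that signed measure. With \<open>a = u + v\<close> and \<open>b = u - v\<close>, polarization gives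
\<open>\<mu> a - \<mu> b = 4 w \<mu> f\<close>; splitting \<open>w\<close> into its positive and negative parts makes this an equality of sums of positive
measures.\<close>

lemma Q_form_density:
  assumes u: "u \<in> supported V" "finite {x. u x \<noteq> 0}" and v: "v \<in> ell2 V" and f: "f \<in> ell2 V"
    and w: "w \<in> borel_measurable borel" "integrable (\<mu> f) w" "integrable (\<mu> f) (\<lambda>l. w l * l)"
    and eq: "\<And>B. B \<in> sets borel \<Longrightarrow> Re (l2_inner V u (E B v)) = (\<integral>l. indicator B l * w l \<partial>\<mu> f)"
  shows "Re (l2_inner V u (Q v)) = (\<integral>l. w l * l \<partial>\<mu> f)"
proof -
  have u2: "u \<in> ell2 V" using ell2_finite_support u by blast
  define a where "a = (\<lambda>x. 1 * u x + 1 * v x)"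
  define b where "b = (\<lambda>x. 1 * u x + (-1) * v x)"
  have ab: "a \<in> ell2 V" "b \<in> ell2 V" unfolding a_def b_def by (intro ell2_comb u2 v)+
  \<comment> \<open>the factor 4 is the one of the polarization identity\<close>
  define N where "N = (\<lambda>g. density (\<mu> f) (\<lambda>l. ennreal (4 * g l)))"
  let ?wp = "\<lambda>l. max (w l) 0" and ?wm = "\<lambda>l. max (- w l) 0"
  have wpm: "w l = ?wp l - ?wm l" for l by auto
  have wmeas[measurable]: "w \<in> borel_measurable (\<mu> f)" using w(2) by auto
  note [measurable_cong] = sets_diagonal
  have iwp: "integrable (\<mu> f) ?wp" and iwm: "integrable (\<mu> f) ?wm" using w(2) by auto
  have N_em: "emeasure (N g) B = ennreal (4 * (\<integral>l. indicator B l * g l \<partial>\<mu> f))"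
    if g: "integrable (\<mu> f) g" "\<And>l. g l \<ge> 0" and B: "B \<in> sets borel" for g B
  proof -
    have "emeasure (N g) B = (\<integral>\<^sup>+l. ennreal (4 * g l) * indicator B l \<partial>\<mu> f)"
      unfolding N_def using g B by (intro emeasure_density) (auto simp: sets_diagonal)
    also have "\<dots> = (\<integral>\<^sup>+l. ennreal (4 * (indicator B l * g l)) \<partial>\<mu> f)"
      by (intro nn_integral_cong) (auto split: split_indicator)
    also have "\<dots> = ennreal (\<integral>l. 4 * (indicator B l * g l) \<partial>\<mu> f)"
      using g B integrable_mult_indicator[of B "\<mu> f" g]
      by (intro nn_integral_eq_integral) (auto simp: sets_diagonal)
    finally show ?thesis by simp
  qed
  have em: "emeasure (\<mu> a) B + emeasure (N ?wm) B = emeasure (\<mu> b) B + emeasure (N ?wp) B"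
    if B: "B \<in> sets borel" for B
  proof -
    have ib: "integrable (\<mu> f) (\<lambda>l. indicator B l * g l)" if "integrable (\<mu> f) g" for g :: "real \<Rightarrow> real"
      using integrable_mult_indicator[of B "\<mu> f" g] B that by (simp add: sets_diagonal)
    have "4 * Re (l2_inner V u (E B v)) = Re (l2_inner V a (E B a)) - Re (l2_inner V b (E B b))"
      unfolding a_def b_def
      by (rule l2_polarization) (use u2 v B E_ell2 E_lin E_sym in auto)
    moreover have "Re (l2_inner V u (E B v)) = (\<integral>l. indicator B l * ?wp l \<partial>\<mu> f) - (\<integral>l. indicator B l * ?wm l \<partial>\<mu> f)"
      unfolding eq[OF B] using ib[OF iwp] ib[OF iwm]
      by (subst Bochner_Integration.integral_diff[symmetric]) (auto simp: right_diff_distrib[symmetric] wpm[symmetric])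
    ultimately have "Re (l2_inner V a (E B a)) + 4 * (\<integral>l. indicator B l * ?wm l \<partial>\<mu> f)
       = Re (l2_inner V b (E B b)) + 4 * (\<integral>l. indicator B l * ?wp l \<partial>\<mu> f)" by linarith
    then show ?thesis
      unfolding emeasure_diagonal[OF ab(1) B] emeasure_diagonal[OF ab(2) B]
      using N_em[OF iwm _ B] N_em[OF iwp _ B] E_nonneg[OF B ab(1)] E_nonneg[OF B ab(2)]
      by (simp flip: ennreal_plus)
  qed
  have id: "integrable (\<mu> g) (\<lambda>l. l)" if "g \<in> ell2 V" for g
    using integrable_diagonal[OF that, of "\<lambda>l. l" UNIV] by (simp add: continuous_on_id)
  have prod: "integrable (\<mu> f) (\<lambda>l. g l * l)" if "\<And>l. \<bar>g l\<bar> \<le> \<bar>w l\<bar>" "g \<in> borel_measurable (\<mu> f)" for g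
    by (rule Bochner_Integration.integrable_bound[OF w(3)]) (use that in \<open>auto simp: abs_mult intro!: mult_right_mono\<close>)
  have iN: "integrable (N g) (\<lambda>l. l)" "(\<integral>l. l \<partial>N g) = 4 * (\<integral>l. g l * l \<partial>\<mu> f)"
    if g: "\<And>l. \<bar>g l\<bar> \<le> \<bar>w l\<bar>" "g \<in> borel_measurable (\<mu> f)" "\<And>l. g l \<ge> 0" for g
  proof -
    have [measurable]: "g \<in> borel_measurable (\<mu> f)" by fact
    have id_meas: "(\<lambda>l. l) \<in> borel_measurable (\<mu> f)" by simp
    have p: "integrable (\<mu> f) (\<lambda>l. 4 * (g l * l))" using prod[OF g(1,2)] by simp
    have 4: "(\<lambda>l. 4 * g l) \<in> borel_measurable (\<mu> f)" "AE l in \<mu> f. 0 \<le> 4 * g l" using g(3) by auto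
    show "integrable (N g) (\<lambda>l. l)"
      unfolding N_def integrable_density[OF id_meas 4] using p by (simp add: mult.assoc)
    show "(\<integral>l. l \<partial>N g) = 4 * (\<integral>l. g l * l \<partial>\<mu> f)"
      unfolding N_def integral_density[OF id_meas 4] by (simp add: mult.assoc)
  qed
  have "(\<integral>l. l \<partial>\<mu> a) + (\<integral>l. l \<partial>N ?wm) = (\<integral>l. l \<partial>\<mu> b) + (\<integral>l. l \<partial>N ?wp)"
  proof (rule integral_add_measure_eq[OF _ _ _ _ em])
    show "sets (N ?wm) = sets borel" "sets (N ?wp) = sets borel" by (simp_all add: N_def sets_diagonal)
    show "integrable (N ?wm) (\<lambda>l. l)" "integrable (N ?wp) (\<lambda>l. l)" by (rule iN; auto)+
    show "integrable (\<mu> a) (\<lambda>l. l)" "integrable (\<mu> b) (\<lambda>l. l)" by (rule id; rule ab)+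
  qed (simp_all add: sets_diagonal)
  moreover have "(\<integral>l. l \<partial>N ?wm) = 4 * (\<integral>l. ?wm l * l \<partial>\<mu> f)" by (rule iN) auto
  moreover have "(\<integral>l. l \<partial>N ?wp) = 4 * (\<integral>l. ?wp l * l \<partial>\<mu> f)" by (rule iN) auto
  moreover have "(\<integral>l. w l * l \<partial>\<mu> f) = (\<integral>l. ?wp l * l \<partial>\<mu> f) - (\<integral>l. ?wm l * l \<partial>\<mu> f)"
    using prod[of ?wp] prod[of ?wm]
    by (subst Bochner_Integration.integral_diff[symmetric]) (auto simp: left_diff_distrib[symmetric] wpm[symmetric])
  moreover have "4 * Re (l2_inner V u (Q v)) = Re (l2_inner V a (Q a)) - Re (l2_inner V b (Q b))"
    unfolding a_def b_def
    by (rule l2_polarization) (use u2 v Q_ell2 Q_lin Q_symmetric[OF u] in auto)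
  ultimately show ?thesis using Q_form[OF ab(1)] Q_form[OF ab(2)] by simp
qed

text \<open>The real part of \<open>\<langle>Q\<^sup>k f, E f\<rangle>\<close> is a signed measure with density \<open>l\<^sup>k\<close> with respect to \<open>\<langle>f, E f\<rangle>\<close>. In the induction step, symmetry of \<open>Q\<close> moves
one factor to the other side, \<open>\<langle>Q\<^sup>k\<^sup>+\<^sup>1 f, E B f\<rangle> = \<langle>Q\<^sup>k f, Q (E B f)\<rangle>\<close>, and the preceding lemma applies with density
\<open>l\<^sup>k\<close> restricted to \<open>B\<close>.\<close>

lemma Q_power_density:
  assumes f: "f \<in> supported V" "finite {x. f x \<noteq> 0}"
  shows "(Q ^^ k) f \<in> supported V \<and> finite {x. (Q ^^ k) f x \<noteq> 0} \<and>
    (\<forall>B\<in>sets borel. Re (l2_inner V ((Q ^^ k) f) (E B f)) = (\<integral>l. indicator B l * l ^ k \<partial>\<mu> f))"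
proof (induction k)
  have f2: "f \<in> ell2 V" using ell2_finite_support f by blast
  case 0
  interpret finite_measure "\<mu> f" using f2 by (rule finite_diagonal)
  show ?case using f f2 by (simp add: measure_diagonal sets_diagonal space_diagonal)
next
  have f2: "f \<in> ell2 V" using ell2_finite_support f by blast
  case (Suc k)
  let ?u = "(Q ^^ k) f"
  from Suc have u: "?u \<in> supported V" "finite {x. ?u x \<noteq> 0}" by auto
  have "Re (l2_inner V (Q ?u) (E B f)) = (\<integral>l. indicator B l * l ^ Suc k \<partial>\<mu> f)" if B: "B \<in> sets borel" for B
  proof -
    have c: "continuous_on UNIV (\<lambda>l::real. l ^ j)" for j by (intro continuous_intros)
    have "Re (l2_inner V (Q ?u) (E B f)) = Re (l2_inner V ?u (Q (E B f)))" using Q_symmetric[OF u] by simp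
    also have "\<dots> = (\<integral>l. (indicator B l * l ^ k) * l \<partial>\<mu> f)"
    proof (rule Q_form_density[OF u E_ell2[OF B f2] f2])
      show "(\<lambda>l. indicator B l * l ^ k :: real) \<in> borel_measurable borel" using B by measurable
      show "integrable (\<mu> f) (\<lambda>l. indicator B l * l ^ k)" by (rule integrable_diagonal[OF f2 c B])
      show "integrable (\<mu> f) (\<lambda>l. (indicator B l * l ^ k) * l)"
        using integrable_diagonal[OF f2 c[of "Suc k"] B] by (simp add: mult_ac)
      fix A :: "real set" assume A: "A \<in> sets borel"
      have "Re (l2_inner V ?u (E A (E B f))) = Re (l2_inner V ?u (E (A \<inter> B) f))"
        using E_inter[OF A B f2] by simp
      also have "\<dots> = (\<integral>l. indicator (A \<inter> B) l * l ^ k \<partial>\<mu> f)" using Suc A B by simp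
      finally show "Re (l2_inner V ?u (E A (E B f))) = (\<integral>l. indicator A l * (indicator B l * l ^ k) \<partial>\<mu> f)"
        by (simp add: indicator_inter_arith mult.assoc)
    qed
    finally show ?thesis by (simp add: mult_ac)
  qed
  with u show ?case using Q_finite_support[OF u] by (simp add: mat_op_supported)
qed

theorem moment_diagonal:
  assumes "v \<in> V"
  shows "(\<integral>l. l ^ k \<partial>\<mu> (kron v)) = Re ((Q ^^ k) (kron v) v)"
proof -
  have f: "kron v \<in> supported V" "finite {x. kron v x \<noteq> 0}" using assms by (auto simp: supported_def)
  have "(\<integral>l. l ^ k \<partial>\<mu> (kron v)) = Re (l2_inner V ((Q ^^ k) (kron v)) (kron v))"
  proof -
    have "Re (l2_inner V ((Q ^^ k) (kron v)) (E UNIV (kron v))) = (\<integral>l. indicator UNIV l * l ^ k \<partial>\<mu> (kron v))"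
      by (rule bspec[OF conjunct2[OF conjunct2[OF Q_power_density[OF f, of k]]], of UNIV]) simp
    then show ?thesis using E_UNIV[OF ell2_finite_support[OF f]] by simp
  qed
  also have "l2_inner V ((Q ^^ k) (kron v)) (kron v) = cnj (l2_inner V (kron v) ((Q ^^ k) (kron v)))"
    by (simp add: l2_inner_cnj)
  also have "l2_inner V (kron v) ((Q ^^ k) (kron v)) = (Q ^^ k) (kron v) v"
    by (subst l2_inner_finite_support[of _ _ "{v}"]) (use f in auto)
  finally show ?thesis by simp
qed

lemma diagonal_real_distribution:
  assumes "v \<in> V" shows "real_distribution (\<mu> (kron v))"
proof -
  have f: "kron v \<in> ell2 V" using assms by (intro ell2_finite_support) (auto simp: supported_def)
  have "l2_inner V (kron v) (kron v) = 1"
    by (subst l2_inner_finite_support[of _ _ "{v}"]) (use assms in \<open>auto simp: supported_def\<close>)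
  then have "emeasure (\<mu> (kron v)) (space (\<mu> (kron v))) = 1"
    using f by (simp add: space_diagonal emeasure_diagonal E_UNIV)
  then have "prob_space (\<mu> (kron v))" by (rule prob_spaceI)
  then show ?thesis
    by (simp add: real_distribution_def real_distribution_axioms_def sets_diagonal space_diagonal)
qed

end

section \<open>Substochastic symmetrizable matrices\<close>

locale substochastic_matrix = symmetrizable_matrix V M d
  for V :: "'v set" and M :: "'v \<Rightarrow> 'v \<Rightarrow> real" and d :: "'v \<Rightarrow> real" +
  assumes ne: "V \<noteq> {}"
    and nn: "\<And>x y. x \<in> V \<Longrightarrow> y \<in> V \<Longrightarrow> 0 \<le> M x y"
    and row: "\<And>x. x \<in> V \<Longrightarrow> (\<Sum>y\<in>V. M x y) \<le> 1"
begin

text \<open>The contraction property is the maximum principle: each value of \<open>op f\<close> is a subconvex combination of values of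
\<open>f\<close>.\<close>

lemma op_contraction:
  assumes f: "\<And>y. y \<in> V \<Longrightarrow> cmod (f y) \<le> K" and K: "0 \<le> K"
  shows "cmod (op f x) \<le> K"
proof (cases "x \<in> V")
  case True
  have "cmod (op f x) \<le> (\<Sum>y\<in>V. M x y * cmod (f y))"
    unfolding mat_op_finite[OF fin] using True nn
    by (simp, intro order_trans[OF norm_sum] sum_mono) (simp add: norm_mult)
  also have "\<dots> \<le> (\<Sum>y\<in>V. M x y * K)" using True nn f by (intro sum_mono mult_left_mono) auto
  also have "\<dots> = (\<Sum>y\<in>V. M x y) * K" by (simp add: sum_distrib_right)
  also have "\<dots> \<le> 1 * K" using row[OF True] K by (rule mult_right_mono)
  finally show ?thesis by simp
qed (simp add: mat_op_def K)

lemma op_power_contraction: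
  assumes f: "\<And>y. cmod (f y) \<le> K" and K: "0 \<le> K"
  shows "cmod ((op ^^ k) f x) \<le> K"
  by (induction k arbitrary: x) (use f op_contraction[OF _ K] in auto)

text \<open>An eigenvector takes its maximal modulus \<open>K\<close> at some vertex, and there the contraction property
reads \<open>\<bar>l\<bar> K \<le> K\<close>.\<close>

theorem cumulative_spectral_measure_substochastic:
  shows "real_distribution (cumulative_spectral_measure V M)"
    and "AE l in cumulative_spectral_measure V M. l \<in> {-1..1}"
    and "(\<integral>l. l ^ k \<partial>cumulative_spectral_measure V M) = Re (\<Sum>x\<in>V. (op ^^ k) (kron x) x) / card V"
proof -
  obtain B :: "('v \<Rightarrow> complex) set" and lam where B: "finite B" "card B = card V"
    and eq: "cumulative_spectral_measure V M = distr (uniform_count_measure B) borel lam"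
    and ev: "\<And>b. b \<in> B \<Longrightarrow> b \<noteq> (\<lambda>_. 0) \<and> b \<in> supported V \<and> op b = (\<lambda>x. complex_of_real (lam b) * b x)"
    and tr: "\<And>k. (\<Sum>x\<in>V. (op ^^ k) (kron x) x) = (\<Sum>b\<in>B. complex_of_real (lam b ^ k))"
    by (rule cumulative_spectral_measure_eigenbasis) (rule that; assumption)
  have "card V \<noteq> 0" using ne fin by simp
  with B have "B \<noteq> {}" by auto
  interpret U: prob_space "uniform_count_measure B"
    using B \<open>B \<noteq> {}\<close> by (intro prob_space_uniform_count_measure)
  have lam[measurable]: "lam \<in> borel_measurable (uniform_count_measure B)"
    by (simp add: measurable_def sets_uniform_count_measure space_uniform_count_measure)
  show "real_distribution (cumulative_spectral_measure V M)"
    unfolding eq using U.prob_space_distr[OF lam]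
    by (simp add: real_distribution_def real_distribution_axioms_def)
  have le: "\<bar>lam b\<bar> \<le> 1" if b: "b \<in> B" for b
  proof -
    define K where "K = Max ((\<lambda>x. cmod (b x)) ` V)"
    have K: "\<And>x. x \<in> V \<Longrightarrow> cmod (b x) \<le> K" unfolding K_def using fin by auto
    have "K \<in> (\<lambda>x. cmod (b x)) ` V" unfolding K_def using fin ne by (intro Max_in) auto
    then obtain x where x: "x \<in> V" "cmod (b x) = K" by auto
    obtain y where "y \<in> V" "b y \<noteq> 0" using ev[OF b] by (auto simp: supported_def fun_eq_iff)
    then have K0: "K > 0" using K[of y] by (meson less_le_trans zero_less_norm_iff)
    have "cmod (op b x) \<le> K" by (rule op_contraction[OF K]) (use K0 in auto)
    then have "\<bar>lam b\<bar> * K \<le> 1 * K" using ev[OF b] x by (simp add: norm_mult)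
    with K0 show ?thesis by simp
  qed
  have "AE b in uniform_count_measure B. lam b \<in> {-1..1}"
    by (rule AE_I2) (use le in \<open>auto simp: space_uniform_count_measure abs_le_iff minus_le_iff\<close>)
  then show "AE l in cumulative_spectral_measure V M. l \<in> {-1..1}"
    unfolding eq by (subst AE_distr_iff[OF lam]) auto
  have "(\<integral>l. l ^ k \<partial>cumulative_spectral_measure V M) = (\<integral>b. lam b ^ k \<partial>uniform_count_measure B)"
    unfolding eq by (subst integral_distr[OF lam]) auto
  also have "\<dots> = (\<Sum>b\<in>B. lam b ^ k) / card B" using B by (simp add: integral_uniform_count_measure)
  also have "(\<Sum>b\<in>B. lam b ^ k) = Re (\<Sum>x\<in>V. (op ^^ k) (kron x) x)" by (simp add: tr)
  finally show "(\<integral>l. l ^ k \<partial>cumulative_spectral_measure V M) = Re (\<Sum>x\<in>V. (op ^^ k) (kron x) x) / card V"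
    using B by simp
qed

end

section \<open>Homogeneity of the Diestel--Leader graph\<close>

text \<open>The position of \<open>x\<close> relative to \<open>y\<close> in one tree: their confluent lies \<open>i\<close> steps above \<open>x\<close> and \<open>j\<close> steps above
\<open>y\<close>. The second conjunct expresses minimality, namely that one step below the \<open>i\<close>-th ancestor of \<open>x\<close> the
two lines of ancestors are still apart.\<close>

definition meet :: "('a \<Rightarrow> 'a) \<Rightarrow> nat \<Rightarrow> nat \<Rightarrow> 'a \<Rightarrow> 'a \<Rightarrow> bool" where
  "meet \<pi> i j x y \<longleftrightarrow> (\<pi> ^^ i) x = (\<pi> ^^ j) y \<and> (i = 0 \<or> j = 0 \<or> (\<pi> ^^ (i - 1)) x \<noteq> (\<pi> ^^ (j - 1)) y)"

definition meet_parent :: "nat \<Rightarrow> nat \<Rightarrow> nat \<times> nat" where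
  "meet_parent i j = (if i > 0 then (i - 1, j) else (0, Suc j))"

lemma meet_parent:
  assumes "meet \<pi> i j x y" shows "meet \<pi> (fst (meet_parent i j)) (snd (meet_parent i j)) (\<pi> x) y"
proof (cases i)
  case 0
  with assms show ?thesis by (auto simp: meet_def meet_parent_def)
next
  case (Suc i')
  with assms show ?thesis
    by (cases i') (auto simp: meet_def meet_parent_def funpow_swap1)
qed

text \<open>Moving down increases the distance to the confluent, except when \<open>x\<close> is a proper ancestor of \<open>y\<close> and the
child is the one that leads to \<open>y\<close>.\<close>

lemma meet_child:
  assumes "meet \<pi> i j x y" "\<pi> c = x"
  shows "if i = 0 \<and> j > 0 \<and> c = (\<pi> ^^ (j - 1)) y then meet \<pi> 0 (j - 1) c y else meet \<pi> (Suc i) j c y"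
proof (cases i)
  case 0
  then show ?thesis using assms by (cases j) (auto simp: meet_def)
next
  case (Suc i')
  then show ?thesis using assms by (auto simp: meet_def funpow_swap1)
qed

text \<open>The sum over the \<open>p\<close> children of \<open>x\<close> of a function of their position relative to \<open>y\<close>, where \<open>x\<close> itself has
position \<open>(i, j)\<close>.\<close>

definition child_sum :: "nat \<Rightarrow> (nat \<Rightarrow> nat \<Rightarrow> complex) \<Rightarrow> nat \<Rightarrow> nat \<Rightarrow> complex" where
  "child_sum p g i j = (if i = 0 \<and> j > 0 then g 0 (j - 1) + of_nat (p - 1) * g 1 j else of_nat p * g (Suc i) j)"

lemma sum_children:
  assumes m: "meet \<pi> i j x y" and card: "finite {c. \<pi> c = x}" "card {c. \<pi> c = x} = p"
    and F: "\<And>c i j. \<pi> c = x \<Longrightarrow> meet \<pi> i j c y \<Longrightarrow> F c = g i j"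
  shows "(\<Sum>c\<in>{c. \<pi> c = x}. F c) = child_sum p g i j"
proof (cases "i = 0 \<and> j > 0")
  case True
  define c0 where "c0 = (\<pi> ^^ (j - 1)) y"
  have "\<pi> c0 = (\<pi> ^^ Suc (j - 1)) y" by (simp add: c0_def)
  then have c0: "\<pi> c0 = x" using True m by (simp add: meet_def)
  have "F c0 = g 0 (j - 1)" using meet_child[OF m c0] True c0 F by (simp add: c0_def)
  moreover have "F c = g 1 j" if "c \<in> {c. \<pi> c = x} - {c0}" for c
    using meet_child[OF m, of c] True that F by (simp add: c0_def)
  moreover have "(\<Sum>c\<in>{c. \<pi> c = x}. F c) = F c0 + (\<Sum>c\<in>{c. \<pi> c = x} - {c0}. F c)"
    using card c0 by (intro sum.remove) auto
  ultimately show ?thesis using True card c0 by (simp add: child_sum_def)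
next
  case False
  have "F c = g (Suc i) j" if "c \<in> {c. \<pi> c = x}" for c
  proof -
    from meet_child[OF m, of c] False that have "meet \<pi> (Suc i) j c y" by auto
    with that F show ?thesis by auto
  qed
  with False card show ?thesis by (auto simp: child_sum_def)
qed

locale diestel_leader =
  fixes q r :: nat and T1 :: "'a end_tree" and T2 :: "'b end_tree"
  assumes q: "q \<ge> 2" and r: "r \<ge> 2"
    and T1: "homogeneous_end_tree q T1" and T2: "homogeneous_end_tree r T2"
begin

abbreviation "\<pi>1 \<equiv> parent T1"
abbreviation "\<pi>2 \<equiv> parent T2"
abbreviation "adj \<equiv> DL_adj T1 T2"
abbreviation "DLV \<equiv> DL T1 T2"
abbreviation "P \<equiv> srw DLV adj"

text \<open>A step in the Diestel--Leader graph descends in one tree and climbs in the other, because the two Busemann functions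
have to cancel. The names refer to the Busemann function of the first tree.\<close>

definition up :: "'a \<times> 'b \<Rightarrow> ('a \<times> 'b) set" where
  "up x = {(c, \<pi>2 (snd x)) |c. \<pi>1 c = fst x}"
definition down :: "'a \<times> 'b \<Rightarrow> ('a \<times> 'b) set" where
  "down x = {(\<pi>1 (fst x), c) |c. \<pi>2 c = snd x}"

lemma DL_iff: "x \<in> DLV \<longleftrightarrow> busemann T1 (fst x) + busemann T2 (snd x) = 0"
  by (auto simp: DL_def)

lemma root_in_DL: "(troot T1, troot T2) \<in> DLV"
  by (simp add: DL_iff busemann_root[OF T1] busemann_root[OF T2])

lemma busemann_child1: "\<pi>1 c = x \<Longrightarrow> busemann T1 c = busemann T1 x + 1"
  and busemann_child2: "\<pi>2 d = y \<Longrightarrow> busemann T2 d = busemann T2 y + 1"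
  using busemann_parent[OF T1, of c] busemann_parent[OF T2, of d] by auto

lemma DL_neighbours:
  assumes x: "x \<in> DLV" shows "{y \<in> DLV. adj x y} = up x \<union> down x"
proof (intro set_eqI iffI)
  fix y assume y: "y \<in> {y \<in> DLV. adj x y}"
  then have h: "busemann T1 (fst y) - busemann T1 (fst x) = - (busemann T2 (snd y) - busemann T2 (snd x))"
    using x by (auto simp: DL_iff)
  have "\<pi>1 (fst x) = fst y \<or> \<pi>1 (fst y) = fst x" "\<pi>2 (snd x) = snd y \<or> \<pi>2 (snd y) = snd x"
    using y tadj_iff[OF T1] tadj_iff[OF T2] by (auto simp: DL_adj_def)
  then show "y \<in> up x \<union> down x"
  proof (elim disjE)
    assume "\<pi>1 (fst x) = fst y" "\<pi>2 (snd x) = snd y"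
    then show ?thesis using h busemann_parent[OF T1, of "fst x"] busemann_parent[OF T2, of "snd x"] by simp
  next
    assume "\<pi>1 (fst x) = fst y" "\<pi>2 (snd y) = snd x"
    then show ?thesis by (cases y) (auto simp: down_def)
  next
    assume "\<pi>1 (fst y) = fst x" "\<pi>2 (snd x) = snd y"
    then show ?thesis by (cases y) (auto simp: up_def)
  next
    assume "\<pi>1 (fst y) = fst x" "\<pi>2 (snd y) = snd x"
    then show ?thesis using h busemann_child1[of "fst y"] busemann_child2[of "snd y"] by simp
  qed
next
  fix y assume "y \<in> up x \<union> down x"
  then show "y \<in> {y \<in> DLV. adj x y}"
  proof
    assume "y \<in> up x"
    then obtain c where c: "y = (c, \<pi>2 (snd x))" "\<pi>1 c = fst x" by (auto simp: up_def)
    then show ?thesis using x busemann_child1[OF c(2)] busemann_parent[OF T2, of "snd x"]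
      by (simp add: DL_iff DL_adj_def tadj_iff[OF T1] tadj_iff[OF T2])
  next
    assume "y \<in> down x"
    then obtain c where c: "y = (\<pi>1 (fst x), c)" "\<pi>2 c = snd x" by (auto simp: down_def)
    then show ?thesis using x busemann_child2[OF c(2)] busemann_parent[OF T1, of "fst x"]
      by (simp add: DL_iff DL_adj_def tadj_iff[OF T1] tadj_iff[OF T2])
  qed
qed

lemma up_image: "up x = (\<lambda>c. (c, \<pi>2 (snd x))) ` {c. \<pi>1 c = fst x}"
  and down_image: "down x = (\<lambda>c. (\<pi>1 (fst x), c)) ` {c. \<pi>2 c = snd x}"
  by (auto simp: up_def down_def)

lemma finite_up: "finite (up x)" and finite_down: "finite (down x)"
  using card_children[OF T1] card_children[OF T2] by (auto simp: up_image down_image)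

lemma sum_up: "sum f (up x) = (\<Sum>c\<in>{c. \<pi>1 c = fst x}. f (c, \<pi>2 (snd x)))"
  unfolding up_image by (subst sum.reindex) (auto simp: inj_on_def)

lemma sum_down: "sum f (down x) = (\<Sum>c\<in>{c. \<pi>2 c = snd x}. f (\<pi>1 (fst x), c))"
  unfolding down_image by (subst sum.reindex) (auto simp: inj_on_def)

lemma card_up: "card (up x) = q"
  using card_children[OF T1, of "fst x"] unfolding up_image by (subst card_image) (auto simp: inj_on_def)

lemma card_down: "card (down x) = r"
  using card_children[OF T2, of "snd x"] unfolding down_image by (subst card_image) (auto simp: inj_on_def)

lemma up_down_disjoint: "up x \<inter> down x = {}"
proof -
  have False if "\<pi>1 (\<pi>1 (fst x)) = fst x"
    using busemann_child1[OF that] busemann_parent[OF T1, of "fst x"] by simp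
  then show ?thesis by (auto simp: up_def down_def)
qed

lemma card_DL_neighbours: "x \<in> DLV \<Longrightarrow> card {y \<in> DLV. adj x y} = q + r"
  by (simp add: DL_neighbours card_Un_disjoint finite_up finite_down up_down_disjoint card_up card_down)

lemma adj_sym: "adj x y \<longleftrightarrow> adj y x"
  unfolding DL_adj_def using tadj_sym[OF T1] tadj_sym[OF T2] by blast

lemma P_eq: "P x y = (if x \<in> DLV \<and> y \<in> DLV \<and> adj x y then 1 / real (q + r) else 0)"
  by (simp add: srw_def card_DL_neighbours)

lemma P_nonzero: "x \<in> DLV \<Longrightarrow> {y \<in> DLV. P x y \<noteq> 0} = up x \<union> down x"
  using q by (subst DL_neighbours[symmetric]) (auto simp: P_eq)

lemma P_resolved:
  assumes "resolution_of_identity DLV (mat_op DLV P) E"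
  shows "resolved_operator DLV P E"
proof
  show "P x y = P y x" if "x \<in> DLV" "y \<in> DLV" for x y by (simp add: P_eq adj_sym[of x y] conj_commute)
  show "P x y \<ge> 0" for x y by (simp add: P_eq)
  show "finite {y \<in> DLV. P x y \<noteq> 0}" if "x \<in> DLV" for x
    using that by (simp add: P_nonzero finite_up finite_down)
  show "(\<Sum>y\<in>{y \<in> DLV. P x y \<noteq> 0}. P x y) \<le> 1" if "x \<in> DLV" for x
  proof -
    have "{y \<in> DLV. P x y \<noteq> 0} = {y \<in> DLV. adj x y}"
      using that P_nonzero DL_neighbours by simp
    then have "(\<Sum>y\<in>{y \<in> DLV. P x y \<noteq> 0}. P x y) = (\<Sum>y\<in>{y \<in> DLV. adj x y}. 1 / real (q + r))"
      using that by (intro sum.cong) (auto simp: P_eq)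
    also have "\<dots> = 1" using q unfolding sum_constant card_DL_neighbours[OF that] by (simp add: add_nonneg_eq_0_iff)
    finally show ?thesis by simp
  qed
qed (fact assms)

abbreviation "Q \<equiv> mat_op DLV P"

lemma Q_eq_sum:
  assumes x: "x \<in> DLV" shows "Q f x = (sum f (up x) + sum f (down x)) / of_nat (q + r)"
proof -
  have "Q f x = (\<Sum>\<^sub>\<infinity>y\<in>DLV. complex_of_real (P x y) * f y)" using x by (simp add: mat_op_def)
  also have "\<dots> = (\<Sum>\<^sub>\<infinity>y\<in>up x \<union> down x. complex_of_real (P x y) * f y)"
    by (rule infsum_cong_neutral) (use P_nonzero[OF x] in auto)
  also have "\<dots> = (\<Sum>y\<in>up x \<union> down x. complex_of_real (P x y) * f y)"
    by (simp add: finite_up finite_down)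
  also have "\<dots> = (\<Sum>y\<in>up x \<union> down x. f y / of_nat (q + r))"
    using DL_neighbours[OF x] x by (intro sum.cong) (auto simp: P_eq)
  also have "\<dots> = (sum f (up x) + sum f (down x)) / of_nat (q + r)"
    by (simp add: sum.union_disjoint finite_up finite_down up_down_disjoint sum_divide_distrib add_divide_distrib)
  finally show ?thesis .
qed

lemma meet_self:
  "meet \<pi>1 i j x x \<Longrightarrow> i = 0 \<and> j = 0"
  "meet \<pi>2 i j z z \<Longrightarrow> i = 0 \<and> j = 0"
  using inj_ancestor[OF T1, of i x j] inj_ancestor[OF T2, of i z j] by (auto simp: meet_def)

text \<open>The transition probabilities depend only on the relative positions in the two trees. One step of
the walk changes the two positions by rules that do not mention the vertices any more, which gives
a recursion for \<open>G\<close>.\<close>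

lemma kernel_depends_on_position:
  "\<exists>G. \<forall>x\<in>DLV. \<forall>y. \<forall>i j k l. meet \<pi>1 i j (fst x) (fst y) \<longrightarrow> meet \<pi>2 k l (snd x) (snd y) \<longrightarrow>
     (Q ^^ n) (kron y) x = G i j k l"
proof (induction n)
  case 0
  show ?case
  proof (intro exI[of _ "\<lambda>i j k l. if i = 0 \<and> j = 0 \<and> k = 0 \<and> l = 0 then 1 else 0"] ballI allI impI)
    fix x y :: "'a \<times> 'b" and i j k l
    assume m: "meet \<pi>1 i j (fst x) (fst y)" "meet \<pi>2 k l (snd x) (snd y)"
    have "x = y \<longleftrightarrow> i = 0 \<and> j = 0 \<and> k = 0 \<and> l = 0"
    proof
      assume "x = y"
      then show "i = 0 \<and> j = 0 \<and> k = 0 \<and> l = 0"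
        using m meet_self(1)[of i j "fst y"] meet_self(2)[of k l "snd y"] by simp
    next
      assume "i = 0 \<and> j = 0 \<and> k = 0 \<and> l = 0"
      then show "x = y" using m by (simp add: meet_def prod_eq_iff)
    qed
    then show "(Q ^^ 0) (kron y) x = (if i = 0 \<and> j = 0 \<and> k = 0 \<and> l = 0 then 1 else 0)" by simp
  qed
next
  case (Suc n)
  then obtain G where G: "\<And>x y i j k l. x \<in> DLV \<Longrightarrow> meet \<pi>1 i j (fst x) (fst y) \<Longrightarrow> meet \<pi>2 k l (snd x) (snd y) \<Longrightarrow>
     (Q ^^ n) (kron y) x = G i j k l" by blast
  let ?G = "\<lambda>i j k l. (child_sum q (\<lambda>i' j'. G i' j' (fst (meet_parent k l)) (snd (meet_parent k l))) i j
      + child_sum r (\<lambda>k' l'. G (fst (meet_parent i j)) (snd (meet_parent i j)) k' l') k l) / of_nat (q + r)"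
  show ?case
  proof (intro exI[of _ ?G] ballI allI impI)
    fix x y :: "'a \<times> 'b" and i j k l
    assume x: "x \<in> DLV" and m: "meet \<pi>1 i j (fst x) (fst y)" "meet \<pi>2 k l (snd x) (snd y)"
    let ?f = "(Q ^^ n) (kron y)"
    have nb: "up x \<union> down x \<subseteq> DLV" using DL_neighbours[OF x] by auto
    have "sum ?f (up x) = child_sum q (\<lambda>i' j'. G i' j' (fst (meet_parent k l)) (snd (meet_parent k l))) i j"
      unfolding sum_up
    proof (rule sum_children[OF m(1)])
      fix c i' j' assume c: "\<pi>1 c = fst x" and mc: "meet \<pi>1 i' j' c (fst y)"
      then have "(c, \<pi>2 (snd x)) \<in> DLV" using nb by (auto simp: up_def)
      from G[OF this, of i' j' y "fst (meet_parent k l)" "snd (meet_parent k l)"] mc meet_parent[OF m(2)]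
      show "?f (c, \<pi>2 (snd x)) = G i' j' (fst (meet_parent k l)) (snd (meet_parent k l))" by simp
    qed (use card_children[OF T1] in auto)
    moreover have "sum ?f (down x) = child_sum r (\<lambda>k' l'. G (fst (meet_parent i j)) (snd (meet_parent i j)) k' l') k l"
      unfolding sum_down
    proof (rule sum_children[OF m(2)])
      fix c k' l' assume c: "\<pi>2 c = snd x" and mc: "meet \<pi>2 k' l' c (snd y)"
      then have "(\<pi>1 (fst x), c) \<in> DLV" using nb by (auto simp: down_def)
      from G[OF this, of "fst (meet_parent i j)" "snd (meet_parent i j)" y k' l'] mc meet_parent[OF m(1)]
      show "?f (\<pi>1 (fst x), c) = G (fst (meet_parent i j)) (snd (meet_parent i j)) k' l'" by simp
    qed (use card_children[OF T2] in auto)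
    ultimately show "(Q ^^ Suc n) (kron y) x = ?G i j k l" by (simp add: Q_eq_sum[OF x])
  qed
qed

lemma return_homogeneous:
  assumes "x \<in> DLV" "y \<in> DLV" shows "(Q ^^ n) (kron x) x = (Q ^^ n) (kron y) y"
proof -
  obtain G where G: "\<forall>x\<in>DLV. \<forall>y. \<forall>i j k l. meet \<pi>1 i j (fst x) (fst y) \<longrightarrow> meet \<pi>2 k l (snd x) (snd y) \<longrightarrow>
     (Q ^^ n) (kron y) x = G i j k l" using kernel_depends_on_position[of n] by (rule exE)
  have "(Q ^^ n) (kron z) z = G 0 0 0 0" if "z \<in> DLV" for z
    using G[rule_format, OF that, of 0 0 z 0 0] by (simp add: meet_def)
  with assms show ?thesis by simp
qed

end

section \<open>Levels of a tetrahedron\<close>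

text \<open>The weights are the degrees. An isolated vertex gets weight 1 instead of 0; its row and its column vanish.\<close>

lemma srw_symmetrizable:
  assumes fin: "finite V" and sym: "\<And>x y. A x y \<longleftrightarrow> A y x"
  shows "symmetrizable_matrix V (srw V A) (\<lambda>x. if {y \<in> V. A x y} = {} then 1 else real (card {y \<in> V. A x y}))"
proof
  show "0 < (if {y \<in> V. A x y} = {} then 1 else real (card {y \<in> V. A x y}))" for x
    using fin by (simp add: card_gt_0_iff)
  fix x y assume xy: "x \<in> V" "y \<in> V"
  have "(if {z \<in> V. A u z} = {} then 1 else real (card {z \<in> V. A u z})) * srw V A u v = (if A u v then 1 else 0)"
    if "u \<in> V" "v \<in> V" for u v
    using that fin by (auto simp: srw_def)
  from this[OF xy] this[OF xy(2,1)] sym[of x y]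
  show "(if {z \<in> V. A x z} = {} then 1 else real (card {z \<in> V. A x z})) * srw V A x y =
        (if {z \<in> V. A y z} = {} then 1 else real (card {z \<in> V. A y z})) * srw V A y x" by simp
qed (fact fin)

lemma srw_nonneg: "0 \<le> srw V A x y"
  by (simp add: srw_def)

lemma srw_row:
  assumes fin: "finite V" shows "(\<Sum>y\<in>V. srw V A x y) \<le> 1"
proof -
  have "(\<Sum>y\<in>V. srw V A x y) \<le> (\<Sum>y\<in>V. if A x y then 1 / real (card {z \<in> V. A x z}) else 0)"
    by (intro sum_mono) (simp add: srw_def)
  also have "\<dots> = (\<Sum>y\<in>{y \<in> V. A x y}. 1 / real (card {z \<in> V. A x z}))"
    by (rule sum.inter_filter[OF fin, symmetric])
  also have "\<dots> \<le> 1" by simp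
  finally show ?thesis .
qed

context
  fixes T :: "'a end_tree" and p :: nat
  assumes T: "homogeneous_end_tree p T"
begin

lemma card_descendants: "finite {x. (parent T ^^ k) x = a} \<and> card {x. (parent T ^^ k) x = a} = p ^ k"
proof (induction k arbitrary: a)
  case 0
  then show ?case by simp
next
  case (Suc k)
  have eq: "{x. (parent T ^^ Suc k) x = a} = (\<Union>c\<in>{c. parent T c = a}. {x. (parent T ^^ k) x = c})" by auto
  have fc: "finite {c. parent T c = a}" "card {c. parent T c = a} = p" using card_children[OF T] by auto
  have "card {x. (parent T ^^ Suc k) x = a} = (\<Sum>c\<in>{c. parent T c = a}. card {x. (parent T ^^ k) x = c})"
    unfolding eq using fc Suc.IH by (intro card_UN_disjoint) auto
  moreover have "finite {x. (parent T ^^ Suc k) x = a}" unfolding eq using fc Suc.IH by auto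
  ultimately show ?case using Suc.IH fc by simp
qed

lemma busemann_ancestor: "busemann T ((parent T ^^ k) x) = busemann T x - int k"
  by (induction k) (simp_all add: busemann_parent[OF T])

end

text \<open>Level \<open>k\<close> of a tetrahedron consists of the pairs of a descendant of \<open>a1\<close> in generation \<open>k\<close> and a
descendant of \<open>a2\<close> in generation \<open>n - k\<close>: the Busemann functions force the two generations to add
up to \<open>n\<close>.\<close>

locale dl_tetrahedron = diestel_leader +
  fixes a1 :: 'a and a2 :: 'b and n :: nat
  assumes height: "- busemann T2 a2 = busemann T1 a1 + int n"
begin

abbreviation "S \<equiv> tetrahedron T1 T2 a1 a2"

definition level :: "nat \<Rightarrow> ('a \<times> 'b) set" where
  "level k = {x. (\<pi>1 ^^ k) (fst x) = a1 \<and> (\<pi>2 ^^ (n - k)) (snd x) = a2}"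

lemma level_DL:
  assumes "k \<le> n" "x \<in> level k" shows "x \<in> DLV"
  using assms height busemann_ancestor[OF T1, of k "fst x"] busemann_ancestor[OF T2, of "n - k" "snd x"]
  by (auto simp: level_def DL_iff of_nat_diff)

lemma S_levels: "S = (\<Union>k\<le>n. level k)"
proof (intro set_eqI iffI)
  fix x assume x: "x \<in> S"
  then obtain k l where kl: "a1 = (\<pi>1 ^^ k) (fst x)" "a2 = (\<pi>2 ^^ l) (snd x)" and xD: "x \<in> DLV"
    using tree_le_iff[OF T1] tree_le_iff[OF T2] by (cases x) (auto simp: tetrahedron_def)
  have "int k + int l = int n"
    using busemann_ancestor[OF T1, of k "fst x"] busemann_ancestor[OF T2, of l "snd x"] kl height xD
    by (auto simp: DL_iff)
  then have k: "k \<le> n" "l = n - k" by auto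
  then have "x \<in> level k" unfolding level_def using kl(1)[symmetric] kl(2)[symmetric] by simp
  with k show "x \<in> (\<Union>k\<le>n. level k)" by blast
next
  fix x assume "x \<in> (\<Union>k\<le>n. level k)"
  then obtain k where k: "k \<le> n" "x \<in> level k" by auto
  then show "x \<in> S" using level_DL[OF k] tree_le_iff[OF T1] tree_le_iff[OF T2]
    by (cases x) (auto simp: tetrahedron_def level_def)
qed

lemma level_disjoint:
  assumes "x \<in> level k" "x \<in> level j" shows "k = j"
proof -
  have "busemann T1 (fst x) - int k = busemann T1 (fst x) - int j"
    using assms busemann_ancestor[OF T1, of _ "fst x"] unfolding level_def by (metis (mono_tags, lifting) mem_Collect_eq)
  then show ?thesis by simp
qed

lemma level_prod: "level k = {x. (\<pi>1 ^^ k) x = a1} \<times> {x. (\<pi>2 ^^ (n - k)) x = a2}"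
  by (auto simp: level_def)

lemma finite_level: "finite (level k)" and card_level: "card (level k) = q ^ k * r ^ (n - k)"
  unfolding level_prod using card_descendants[OF T1] card_descendants[OF T2] by (auto simp: card_cartesian_product)

lemma finite_S: "finite S" unfolding S_levels by (simp add: finite_level)

lemma sum_S: "sum f S = (\<Sum>k\<le>n. sum f (level k))"
  unfolding S_levels using level_disjoint by (intro sum.UNION_disjoint) (auto simp: finite_level)

lemma card_S: "card S = (\<Sum>k\<le>n. q ^ k * r ^ (n - k))"
  using sum_S[of "\<lambda>_. 1::nat"] by (simp add: card_level)

lemma level_S: "k \<le> n \<Longrightarrow> level k \<subseteq> S" unfolding S_levels by blast

lemma S_DL: "S \<subseteq> DLV" by (auto simp: tetrahedron_def)

lemma up_level:
  assumes x: "x \<in> level k" and k: "k < n" shows "up x \<subseteq> level (Suc k)"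
proof
  fix y assume "y \<in> up x"
  then obtain c where c: "y = (c, \<pi>2 (snd x))" "\<pi>1 c = fst x" by (auto simp: up_def)
  have "n - k = Suc (n - Suc k)" using k by simp
  then have "(\<pi>2 ^^ (n - Suc k)) (\<pi>2 (snd x)) = a2" using x by (simp add: level_def funpow_swap1)
  moreover have "(\<pi>1 ^^ Suc k) c = a1" using x c by (simp add: level_def funpow_swap1)
  ultimately show "y \<in> level (Suc k)" using c by (simp add: level_def del: funpow.simps)
qed

lemma down_level:
  assumes x: "x \<in> level k" and k: "0 < k" "k \<le> n" shows "down x \<subseteq> level (k - 1)"
proof
  fix y assume "y \<in> down x"
  then obtain c where c: "y = (\<pi>1 (fst x), c)" "\<pi>2 c = snd x" by (auto simp: down_def)
  have "n - (k - 1) = Suc (n - k)" "k = Suc (k - 1)" using k by auto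
  then have "(\<pi>2 ^^ (n - (k - 1))) c = a2" "(\<pi>1 ^^ (k - 1)) (\<pi>1 (fst x)) = a1"
    using x c by (auto simp: level_def funpow_swap1) (metis funpow.simps(2) funpow_swap1 o_apply)
  then show "y \<in> level (k - 1)" using c by (simp add: level_def)
qed

lemma up_top:
  assumes x: "x \<in> level n" shows "up x \<inter> S = {}"
proof -
  have False if y: "y \<in> up x" "y \<in> level j" "j \<le> n" for y j
  proof -
    obtain c where c: "y = (c, \<pi>2 (snd x))" "\<pi>1 c = fst x" using y by (auto simp: up_def)
    have "busemann T1 c - int j = busemann T1 (fst x) - int n"
      using x y(2) c busemann_ancestor[OF T1, of j c] busemann_ancestor[OF T1, of n "fst x"] by (auto simp: level_def)
    with busemann_child1[OF c(2)] y(3) show False by simp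
  qed
  then show ?thesis by (auto simp: S_levels)
qed

lemma down_bottom:
  assumes x: "x \<in> level 0" shows "down x \<inter> S = {}"
proof -
  have False if y: "y \<in> down x" "y \<in> level j" "j \<le> n" for y j
  proof -
    obtain c where c: "y = (\<pi>1 (fst x), c)" "\<pi>2 c = snd x" using y by (auto simp: down_def)
    have "busemann T1 (\<pi>1 (fst x)) - int j = busemann T1 (fst x)"
      using x y(2) c busemann_ancestor[OF T1, of j "\<pi>1 (fst x)"] by (auto simp: level_def)
    with busemann_parent[OF T1, of "fst x"] show False by simp
  qed
  then show ?thesis by (auto simp: S_levels)
qed

text \<open>Only the extreme levels lose neighbours: the top level all those above, the bottom level all those below.\<close>

lemma S_neighbours:
  assumes x: "x \<in> level k" and k: "k \<le> n"
  shows "{y \<in> S. adj x y} = (if k < n then up x else {}) \<union> (if 0 < k then down x else {})"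
proof -
  have "{y \<in> S. adj x y} = (up x \<inter> S) \<union> (down x \<inter> S)"
  proof -
    have "{y \<in> S. adj x y} = S \<inter> {y \<in> DLV. adj x y}" using S_DL by blast
    then show ?thesis unfolding DL_neighbours[OF level_DL[OF k x]] by blast
  qed
  moreover have "up x \<inter> S = (if k < n then up x else {})"
  proof (cases "k < n")
    case True
    then have "level (Suc k) \<subseteq> S" by (intro level_S) simp
    with True up_level[OF x True] show ?thesis by auto
  next
    case False
    then show ?thesis using up_top x k by simp
  qed
  moreover have "down x \<inter> S = (if 0 < k then down x else {})"
  proof (cases "0 < k")
    case True
    then have "level (k - 1) \<subseteq> S" using k by (intro level_S) simp
    with True down_level[OF x True k] show ?thesis by auto
  next
    case False
    then show ?thesis using down_bottom x k by simp
  qed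
  ultimately show ?thesis by simp
qed

lemma card_S_neighbours:
  assumes x: "x \<in> level k" and k: "k \<le> n"
  shows "card {y \<in> S. adj x y} = (if k < n then q else 0) + (if 0 < k then r else 0)"
  unfolding S_neighbours[OF assms] using up_down_disjoint
  by (auto simp: card_Un_disjoint finite_up finite_down card_up card_down)

lemma P_row: "(\<Sum>y\<in>S. P x y) \<le> 1"
proof (cases "x \<in> DLV")
  case True
  have "(\<Sum>y\<in>S. P x y) = (\<Sum>y\<in>{y \<in> S. adj x y}. 1 / real (q + r))"
    unfolding sum.inter_filter[OF finite_S] using S_DL True by (intro sum.cong) (auto simp: P_eq)
  also have "\<dots> \<le> (\<Sum>y\<in>{y \<in> DLV. adj x y}. 1 / real (q + r))"
  proof (rule sum_mono2)
    show "finite {y \<in> DLV. adj x y}" unfolding DL_neighbours[OF True] by (simp add: finite_up finite_down)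
  qed (use S_DL in auto)
  also have "\<dots> \<le> 1" using card_DL_neighbours[OF True] by simp
  finally show ?thesis .
qed (simp add: P_eq)

lemma S_nonempty: "S \<noteq> {}"
proof -
  have "card (level 0) \<noteq> 0" using r by (simp add: card_level)
  then have "level 0 \<noteq> {}" by auto
  then show ?thesis by (auto simp: S_levels)
qed

lemma P_substochastic: "substochastic_matrix S P (\<lambda>_. 1)"
proof
  show "1 * P x y = 1 * P y x" if "x \<in> S" "y \<in> S" for x y
    using that by (simp add: P_eq adj_sym[of x y] conj_commute)
qed (simp_all add: finite_S S_nonempty srw_nonneg P_row)

lemma srw_substochastic: "\<exists>d. substochastic_matrix S (srw S adj) d"
proof -
  interpret symmetrizable_matrix S "srw S adj" "\<lambda>x. if {y \<in> S. adj x y} = {} then 1 else real (card {y \<in> S. adj x y})"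
    by (rule srw_symmetrizable[OF finite_S]) (rule adj_sym)
  have *: "substochastic_matrix S (srw S adj) (\<lambda>x. if {y \<in> S. adj x y} = {} then 1 else real (card {y \<in> S. adj x y}))"
    by unfold_locales (rule S_nonempty srw_nonneg srw_row[OF finite_S])+
  show ?thesis by (rule exI, rule *)
qed

text \<open>The property shared by the truncated operator and the simple random walk on the tetrahedron.\<close>

definition interior_agrees :: "('a \<times> 'b \<Rightarrow> 'a \<times> 'b \<Rightarrow> real) \<Rightarrow> bool" where
  "interior_agrees M \<longleftrightarrow> (\<forall>x y k. 0 < k \<longrightarrow> k < n \<longrightarrow> x \<in> level k \<longrightarrow> y \<in> S \<longrightarrow> M x y = P x y)"

lemma interior_agrees_P: "interior_agrees P" by (simp add: interior_agrees_def)

lemma interior_agrees_srw: "interior_agrees (srw S adj)"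
  unfolding interior_agrees_def
proof (intro allI impI)
  fix x y k assume k: "0 < k" "k < n" and x: "x \<in> level k" and y: "y \<in> S"
  then have "card {z \<in> S. adj x z} = q + r" using card_S_neighbours[OF x] by simp
  moreover have "x \<in> S" using k x by (auto simp: S_levels)
  ultimately show "srw S adj x y = P x y" using y S_DL unfolding P_eq by (auto simp: srw_def)
qed

lemma interior_op:
  assumes M: "interior_agrees M" and k: "0 < k" "k < n" and x: "x \<in> level k"
  shows "mat_op S M f x = (sum f (up x) + sum f (down x)) / of_nat (q + r)"
proof -
  have xS: "x \<in> S" using k x by (auto simp: S_levels)
  have MP: "M x y = P x y" if "y \<in> S" for y
    using M k x that unfolding interior_agrees_def by blast
  have "mat_op S M f x = (\<Sum>y\<in>S. complex_of_real (M x y) * f y)"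
    using xS by (simp add: mat_op_finite[OF finite_S])
  also have "\<dots> = (\<Sum>y\<in>S. complex_of_real (P x y) * f y)"
    by (intro sum.cong refl) (simp only: MP)
  also have "\<dots> = (\<Sum>y\<in>{y \<in> S. adj x y}. f y / of_nat (q + r))"
    unfolding sum.inter_filter[OF finite_S] using S_DL xS by (intro sum.cong) (auto simp: P_eq)
  also have "{y \<in> S. adj x y} = up x \<union> down x" using S_neighbours[OF x] k by simp
  finally show ?thesis
    by (simp add: sum.union_disjoint finite_up finite_down up_down_disjoint sum_divide_distrib add_divide_distrib)
qed

text \<open>In \<open>m\<close> steps the walk moves by at most \<open>m\<close> levels, so it does not notice the boundary.\<close>

lemma interior_power:
  assumes M: "interior_agrees M"
  shows "m \<le> k \<Longrightarrow> k + m \<le> n \<Longrightarrow> x \<in> level k \<Longrightarrow> (mat_op S M ^^ m) f x = (Q ^^ m) f x"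
proof (induction m arbitrary: k x)
  case (Suc m)
  have k: "0 < k" "k < n" using Suc.prems by auto
  have "(mat_op S M ^^ m) f y = (Q ^^ m) f y" if "y \<in> up x" for y
    using up_level[OF Suc.prems(3) k(2)] that Suc.prems by (intro Suc.IH[of "Suc k"]) auto
  moreover have "(mat_op S M ^^ m) f y = (Q ^^ m) f y" if "y \<in> down x" for y
    using down_level[OF Suc.prems(3) k(1)] that Suc.prems k by (intro Suc.IH[of "k - 1"]) auto
  ultimately show ?case
    using level_DL[OF less_imp_le[OF k(2)] Suc.prems(3)]
    by (simp add: interior_op[OF M k Suc.prems(3)] Q_eq_sum cong: sum.cong)
qed simp

lemma Q_contraction:
  assumes "\<And>y. cmod (f y) \<le> 1" shows "cmod ((Q ^^ m) f x) \<le> 1"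
proof (induction m arbitrary: x)
  case (Suc m)
  show ?case
  proof (cases "x \<in> DLV")
    case True
    let ?f = "(Q ^^ m) f"
    have "cmod (sum ?f (up x) + sum ?f (down x)) \<le> (\<Sum>y\<in>up x. 1) + (\<Sum>y\<in>down x. 1)"
      using Suc.IH by (intro order_trans[OF norm_triangle_ineq] add_mono order_trans[OF norm_sum] sum_mono)
    then have "cmod (sum ?f (up x) + sum ?f (down x)) \<le> real (q + r)" by (simp add: card_up card_down)
    then show ?thesis using q by (simp add: Q_eq_sum[OF True] norm_divide divide_le_eq flip: of_nat_add)
  qed (simp add: mat_op_def)
qed (use assms in simp)

text \<open>Vertices at least \<open>m\<close> levels away from the extreme ones contribute exactly the return probability, and there are at
most \<open>2 m\<close> other levels. For \<open>q = r\<close> every level contains the proportion \<open>1 / (n + 1)\<close> of all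
vertices; a vertex there changes the trace by at most 2.\<close>

lemma trace_estimate:
  assumes M: "interior_agrees M" and sm: "substochastic_matrix S M d" and qr: "q = r" and v: "v \<in> DLV"
  shows "\<bar>Re (\<Sum>x\<in>S. (mat_op S M ^^ m) (kron x) x) / card S - Re ((Q ^^ m) (kron v) v)\<bar> \<le> 4 * real m / (real n + 1)"
proof -
  let ?t = "\<lambda>x. (mat_op S M ^^ m) (kron x) x" and ?v = "(Q ^^ m) (kron v) v"
  \<comment> \<open>the levels from which a walk of \<open>m\<close> steps may leave the tetrahedron\<close>
  define bad where "bad = {k. k \<le> n \<and> \<not> (m \<le> k \<and> k + m \<le> n)}"
  have "card bad \<le> card ({..<m} \<union> {n + 1 - m..n})"
    unfolding bad_def by (intro card_mono) auto
  also have "\<dots> \<le> m + m" by (rule order_trans[OF card_Un_le]) auto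
  finally have bad: "card bad \<le> 2 * m" by simp
  have fin_bad: "finite bad" by (rule finite_subset[of _ "{..n}"]) (auto simp: bad_def)
  have card_lev: "card (level k) = q ^ n" if "k \<le> n" for k
    using that by (simp add: card_level qr flip: power_add)
  have cS: "card S = (n + 1) * q ^ n" by (simp add: card_S qr flip: power_add)
  then have cSr: "real (card S) = (real n + 1) * real q ^ n"
    by (simp only: of_nat_mult of_nat_add of_nat_power of_nat_1)
  have cS0: "real (card S) > 0" using S_nonempty finite_S by (simp add: card_gt_0_iff)
  have "cmod (\<Sum>x\<in>S. ?t x - ?v) \<le> (\<Sum>x\<in>S. cmod (?t x - ?v))" by (rule norm_sum)
  also have "\<dots> = (\<Sum>k\<le>n. \<Sum>x\<in>level k. cmod (?t x - ?v))" by (rule sum_S)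
  also have "\<dots> \<le> (\<Sum>k\<le>n. if k \<in> bad then 2 * real q ^ n else 0)"
  proof (rule sum_mono)
    fix k assume k: "k \<in> {..n}"
    show "(\<Sum>x\<in>level k. cmod (?t x - ?v)) \<le> (if k \<in> bad then 2 * real q ^ n else 0)"
    proof (cases "k \<in> bad")
      case True
      have "(\<Sum>x\<in>level k. cmod (?t x - ?v)) \<le> (\<Sum>x\<in>level k. 2)"
      proof (rule sum_mono)
        fix x
        have "cmod (?t x) \<le> 1"
          by (rule substochastic_matrix.op_power_contraction[OF sm]) auto
        moreover have "cmod ?v \<le> 1" by (rule Q_contraction) auto
        ultimately show "cmod (?t x - ?v) \<le> 2" using norm_triangle_ineq4[of "?t x" ?v] by linarith
      qed
      then show ?thesis using True k card_lev[of k] by simp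
    next
      case False
      with k have km: "m \<le> k" "k + m \<le> n" by (auto simp: bad_def)
      have "?t x = ?v" if "x \<in> level k" for x
        using interior_power[OF M km that] return_homogeneous[OF level_DL[of k x] v] k that by simp
      with False show ?thesis by simp
    qed
  qed
  also have "\<dots> = (\<Sum>k\<in>bad. 2 * real q ^ n)"
    by (rule sum.mono_neutral_cong_right) (auto simp: bad_def)
  also have "\<dots> = real (card bad) * (2 * real q ^ n)" by simp
  also have "\<dots> \<le> real (2 * m) * (2 * real q ^ n)" using bad by (intro mult_right_mono) auto
  also have "\<dots> = 4 * m * real q ^ n" by simp
  finally have le: "cmod (\<Sum>x\<in>S. ?t x - ?v) \<le> 4 * m * real q ^ n" .
  have "Re (\<Sum>x\<in>S. ?t x) / card S - Re ?v = Re (\<Sum>x\<in>S. ?t x - ?v) / card S"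
    using cS0 by (simp add: sum_subtractf field_simps)
  then have "\<bar>Re (\<Sum>x\<in>S. ?t x) / card S - Re ?v\<bar> = \<bar>Re (\<Sum>x\<in>S. ?t x - ?v) / card S\<bar>"
    by (rule arg_cong)
  also have "\<dots> \<le> cmod (\<Sum>x\<in>S. ?t x - ?v) / card S"
    using cS0 abs_Re_le_cmod[of "\<Sum>x\<in>S. ?t x - ?v"] by (simp add: divide_right_mono)
  also have "\<dots> \<le> 4 * m * real q ^ n / card S" by (rule divide_right_mono[OF le]) simp
  also have "\<dots> = (4 * real m) * real q ^ n / ((real n + 1) * real q ^ n)" by (simp only: cSr)
  also have "\<dots> = (4 * real m) / (real n + 1)"
    by (rule nonzero_mult_divide_mult_cancel_right) (use q in simp)
  finally show ?thesis .
qed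

text \<open>Up to the factor \<open>(q + r)\<^sup>2\<close>, the trace of the square counts the ordered pairs of neighbours in the tetrahedron. Compared with
\<open>(q + r) |S|\<close>, the top level misses \<open>q \<cdot> q\<^sup>n\<close> of them and the bottom level \<open>r \<cdot> r\<^sup>n\<close>. This loss is at least
\<open>|q - r| |S|\<close>, since \<open>(q - r) |S| = q\<^sup>n\<^sup>+\<^sup>1 - r\<^sup>n\<^sup>+\<^sup>1\<close> by the geometric sum.\<close>

lemma second_moment_gap:
  "Re (\<Sum>x\<in>S. (mat_op S P ^^ 2) (kron x) x) / card S \<le> (real (q + r) - \<bar>real q - real r\<bar>) / (real (q + r))\<^sup>2"
proof -
  have cS0: "real (card S) > 0" using S_nonempty finite_S by (simp add: card_gt_0_iff)
  have t: "(mat_op S P ^^ 2) (kron x) x = complex_of_real (real (card {y \<in> S. adj x y}) / (real (q + r))\<^sup>2)"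
    if x: "x \<in> S" for x
  proof -
    have "(mat_op S P ^^ 2) (kron x) x = (\<Sum>y\<in>S. P x y * (\<Sum>z\<in>S. complex_of_real (P y z) * kron x z))"
      using x by (simp add: numeral_2_eq_2 mat_op_finite[OF finite_S] cong: sum.cong)
    also have "\<dots> = (\<Sum>y\<in>S. complex_of_real (P x y * P y x))"
      using x finite_S by (intro sum.cong) (auto simp: if_distrib cong: if_cong)
    also have "\<dots> = (\<Sum>y\<in>{y \<in> S. adj x y}. complex_of_real (1 / (real (q + r))\<^sup>2))"
      unfolding sum.inter_filter[OF finite_S] using x S_DL adj_sym
      by (intro sum.cong) (auto simp: P_eq power2_eq_square)
    finally show ?thesis by simp
  qed
  have "Re (\<Sum>x\<in>S. (mat_op S P ^^ 2) (kron x) x) = (\<Sum>x\<in>S. real (card {y \<in> S. adj x y}) / (real (q + r))\<^sup>2)"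
    using t by simp
  also have "\<dots> = (\<Sum>x\<in>S. real (card {y \<in> S. adj x y})) / (real (q + r))\<^sup>2"
    by (rule sum_divide_distrib[symmetric])
  also have "(\<Sum>x\<in>S. real (card {y \<in> S. adj x y})) =
     (\<Sum>k\<le>n. real (card (level k)) * (real (q + r) - (if k = n then q else 0) - (if k = 0 then r else 0)))"
    unfolding sum_S by (intro sum.cong) (auto simp: card_S_neighbours)
  also have "\<dots> = (\<Sum>k\<le>n. real (card (level k)) * real (q + r)) - (\<Sum>k\<le>n. if k = n then real (card (level k)) * q else 0)
      - (\<Sum>k\<le>n. if k = 0 then real (card (level k)) * r else 0)"
    unfolding sum_subtractf[symmetric] by (intro sum.cong) (auto simp: algebra_simps)
  also have "\<dots> = real (card S) * real (q + r) - real q ^ Suc n - real r ^ Suc n"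
    by (simp add: card_level card_S sum_distrib_right)
  also have "\<dots> \<le> real (card S) * (real (q + r) - \<bar>real q - real r\<bar>)"
  proof -
    have "real q ^ Suc n - real r ^ Suc n = (real q - real r) * (\<Sum>i<Suc n. real r ^ (Suc n - Suc i) * real q ^ i)"
      by (rule power_diff_sumr2)
    also have "(\<Sum>i<Suc n. real r ^ (Suc n - Suc i) * real q ^ i) = real (card S)"
      unfolding card_S lessThan_Suc_atMost by (simp add: mult.commute)
    finally have "\<bar>real q - real r\<bar> * real (card S) = \<bar>real q ^ Suc n - real r ^ Suc n\<bar>"
      by (simp add: abs_mult)
    also have "\<dots> \<le> real q ^ Suc n + real r ^ Suc n"
      using zero_le_power[of "real q" "Suc n"] zero_le_power[of "real r" "Suc n"] by linarith
    finally show ?thesis by (simp add: algebra_simps)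
  qed
  finally have "Re (\<Sum>x\<in>S. (mat_op S P ^^ 2) (kron x) x)
     \<le> real (card S) * (real (q + r) - \<bar>real q - real r\<bar>) / (real (q + r))\<^sup>2"
    by (simp add: divide_right_mono)
  with cS0 show ?thesis by (simp add: pos_divide_le_eq mult_ac)
qed

end

context diestel_leader
begin

lemma return_two:
  assumes v: "v \<in> DLV" shows "(Q ^^ 2) (kron v) v = 1 / of_nat (q + r)"
proof -
  have Q1: "Q (kron v) y = 1 / of_nat (q + r)" if y: "y \<in> up v \<union> down v" for y
  proof -
    have "y \<in> DLV" "adj v y" using y unfolding DL_neighbours[OF v, symmetric] by simp_all
    then have "v \<in> {z \<in> DLV. adj y z}" using v adj_sym[of v y] by simp
    then have "v \<in> up y \<union> down y" unfolding DL_neighbours[OF \<open>y \<in> DLV\<close>] .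
    have "sum (kron v) (up y) + sum (kron v) (down y) = sum (kron v) (up y \<union> down y)"
      by (rule sum.union_disjoint[symmetric, OF finite_up finite_down up_down_disjoint])
    also have "\<dots> = 1" using \<open>v \<in> up y \<union> down y\<close> finite_UnI[OF finite_up finite_down]
      by (simp only: sum.delta if_True)
    finally show ?thesis using Q_eq_sum[OF \<open>y \<in> DLV\<close>, of "kron v"] by simp
  qed
  have "(Q ^^ 2) (kron v) v = (sum (Q (kron v)) (up v) + sum (Q (kron v)) (down v)) / of_nat (q + r)"
    by (simp add: numeral_2_eq_2 Q_eq_sum[OF v])
  also have "sum (Q (kron v)) (up v) = (\<Sum>y\<in>up v. 1 / of_nat (q + r))" using Q1 by (intro sum.cong) auto
  also have "sum (Q (kron v)) (down v) = (\<Sum>y\<in>down v. 1 / of_nat (q + r))" using Q1 by (intro sum.cong) auto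
  also have "((\<Sum>y\<in>up v. 1 / of_nat (q + r)) + (\<Sum>y\<in>down v. 1 / of_nat (q + r))) / of_nat (q + r) = (1 / of_nat (q + r) :: complex)"
  proof -
    have "of_nat (q + r) \<noteq> (0::complex)" using q unfolding of_nat_eq_0_iff by simp
    then show ?thesis by (simp add: card_up card_down add_divide_distrib[symmetric] del: of_nat_add flip: of_nat_add)
  qed
  finally show ?thesis .
qed

end

section \<open>Convergence and non-convergence\<close>

text \<open>Tetrahedra are only given for \<open>n \<ge> 1\<close>, so the sequences are shifted by one before the limit theorems are applied.\<close>

lemma weak_conv_m_Suc_iff: "weak_conv_m (\<lambda>n. X (Suc n)) \<mu> \<longleftrightarrow> weak_conv_m X \<mu>"
  unfolding weak_conv_m_def weak_conv_def
  using filterlim_sequentially_Suc[of "\<lambda>n. cdf (X n) x" for x] by simp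

context diestel_leader
begin

context
  fixes S :: "nat \<Rightarrow> ('a \<times> 'b) set" and E
  assumes E: "resolution_of_identity DLV Q E"
    and S: "\<And>n. n \<ge> 1 \<Longrightarrow> is_tetrahedron T1 T2 n (S n)"
begin

abbreviation "\<mu> \<equiv> plancherel_measure DLV (troot T1, troot T2) E"
abbreviation "return_prob k \<equiv> Re ((Q ^^ k) (kron (troot T1, troot T2)) (troot T1, troot T2))"

lemma plancherel_eq: "\<mu> = diagonal_measure DLV E (kron (troot T1, troot T2))"
  by (simp add: plancherel_measure_def)

lemma plancherel_real_distribution: "real_distribution \<mu>"
  and plancherel_moments: "(\<integral>l. l ^ k \<partial>\<mu>) = return_prob k"
proof -
  interpret R: resolved_operator DLV P E by (rule P_resolved[OF E])
  show "real_distribution \<mu>" unfolding plancherel_eq by (rule R.diagonal_real_distribution[OF root_in_DL])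
  show "(\<integral>l. l ^ k \<partial>\<mu>) = return_prob k" unfolding plancherel_eq by (rule R.moment_diagonal[OF root_in_DL])
qed

lemma plancherel_support: obtains C where "C \<ge> 1" "AE l in \<mu>. l \<in> {-C..C}"
proof -
  interpret R: resolved_operator DLV P E by (rule P_resolved[OF E])
  obtain C where C: "\<And>f. f \<in> ell2 DLV \<Longrightarrow> AE x in diagonal_measure DLV E f. x \<in> {-C..C}"
    using R.support_diagonal by blast
  have "kron (troot T1, troot T2) \<in> ell2 DLV"
    using root_in_DL by (intro ell2_finite_support) (auto simp: supported_def)
  from C[OF this] have "AE l in \<mu>. l \<in> {-max 1 C..max 1 C}" unfolding plancherel_eq by eventually_elim auto
  then show ?thesis using that[of "max 1 C"] by simp
qed

lemma S_obtain:
  assumes "n \<ge> 1" obtains a1 a2 where "dl_tetrahedron q r T1 T2 a1 a2 n" "S n = tetrahedron T1 T2 a1 a2"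
proof -
  obtain a1 a2 where "- busemann T2 a2 = busemann T1 a1 + int n" "S n = tetrahedron T1 T2 a1 a2"
    using S[OF assms] unfolding is_tetrahedron_def by blast
  then show ?thesis using that[of a1 a2] diestel_leader_axioms
    by (simp add: dl_tetrahedron_def dl_tetrahedron_axioms_def)
qed

lemma truncation_substochastic:
  assumes "n \<ge> 1" shows "substochastic_matrix (S n) P (\<lambda>_. 1)"
proof -
  obtain a1 a2 where "dl_tetrahedron q r T1 T2 a1 a2 n" and Sn: "S n = tetrahedron T1 T2 a1 a2"
    using assms by (rule S_obtain)
  then show ?thesis using dl_tetrahedron.P_substochastic by metis
qed

lemma walk_substochastic:
  assumes "n \<ge> 1" shows "\<exists>d. substochastic_matrix (S n) (srw (S n) adj) d"
proof -
  obtain a1 a2 where "dl_tetrahedron q r T1 T2 a1 a2 n" and Sn: "S n = tetrahedron T1 T2 a1 a2"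
    using assms by (rule S_obtain)
  then show ?thesis using dl_tetrahedron.srw_substochastic by metis
qed

lemma weak_conv_of_interior_agreement:
  assumes qr: "q = r" and adm: "\<And>n. n \<ge> 1 \<Longrightarrow> \<exists>d. substochastic_matrix (S n) (M n) d"
    and int: "\<And>n a1 a2. n \<ge> 1 \<Longrightarrow> dl_tetrahedron q r T1 T2 a1 a2 n \<Longrightarrow> S n = tetrahedron T1 T2 a1 a2 \<Longrightarrow>
      dl_tetrahedron.interior_agrees T1 T2 a1 a2 n (M n)"
  shows "weak_conv_m (\<lambda>n. cumulative_spectral_measure (S n) (M n)) \<mu>"
proof -
  let ?\<nu> = "\<lambda>n. cumulative_spectral_measure (S (Suc n)) (M (Suc n))"
  obtain C where C: "C \<ge> 1" "AE l in \<mu>. l \<in> {-C..C}" by (rule plancherel_support)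
  have "weak_conv_m ?\<nu> \<mu>"
  proof (rule method_of_moments_bounded_support[OF _ _ plancherel_real_distribution C(2)])
    fix n
    obtain d where "substochastic_matrix (S (Suc n)) (M (Suc n)) d" using adm[of "Suc n"] by auto
    then interpret substochastic_matrix "S (Suc n)" "M (Suc n)" d .
    show "real_distribution (?\<nu> n)"
      by (rule cumulative_spectral_measure_substochastic)
    have "AE l in ?\<nu> n. l \<in> {-1..1}"
      by (rule cumulative_spectral_measure_substochastic)
    then show "AE l in ?\<nu> n. l \<in> {-C..C}" by eventually_elim (use C(1) in auto)
  next
    fix k
    have bound: "norm ((\<integral>l. l ^ k \<partial>?\<nu> n) - return_prob k) \<le> 4 * real k / (real (Suc n) + 1)" for n
    proof -
      obtain d where d: "substochastic_matrix (S (Suc n)) (M (Suc n)) d" using adm[of "Suc n"] by auto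
      then interpret substochastic_matrix "S (Suc n)" "M (Suc n)" d .
      obtain a1 a2 where t: "dl_tetrahedron q r T1 T2 a1 a2 (Suc n)" and Sn: "S (Suc n) = tetrahedron T1 T2 a1 a2"
        by (rule S_obtain[of "Suc n"]) auto
      interpret t: dl_tetrahedron q r T1 T2 a1 a2 "Suc n" by (fact t)
      have i: "t.interior_agrees (M (Suc n))" by (rule int[OF _ t Sn]) simp
      have "(\<integral>l. l ^ k \<partial>?\<nu> n) = Re (\<Sum>x\<in>S (Suc n). (op ^^ k) (kron x) x) / card (S (Suc n))"
        by (rule cumulative_spectral_measure_substochastic)
      then show ?thesis
        using t.trace_estimate[OF i d[unfolded Sn] qr root_in_DL, of k] unfolding Sn by simp
    qed
    have vanish: "(\<lambda>n. 4 * real k / (real (Suc n) + 1)) \<longlonglongrightarrow> 0" by real_asymp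
    have "(\<lambda>n. (\<integral>l. l ^ k \<partial>?\<nu> n) - return_prob k) \<longlonglongrightarrow> 0"
      by (rule Lim_null_comparison[OF always_eventually vanish]) (rule allI, rule bound)
    then show "(\<lambda>n. \<integral>l. l ^ k \<partial>?\<nu> n) \<longlonglongrightarrow> (\<integral>l. l ^ k \<partial>\<mu>)"
      unfolding plancherel_moments by (rule LIM_zero_cancel)
  qed
  then show ?thesis by (simp add: weak_conv_m_Suc_iff[of "\<lambda>n. cumulative_spectral_measure (S n) (M n)"])
qed

text \<open>Weak convergence would force the second moments to converge to \<open>1 / (q + r)\<close>, from which they stay away
by \<open>|q - r| / (q + r)\<^sup>2\<close>.\<close>

lemma not_weak_conv:
  assumes qr: "q \<noteq> r"
  shows "\<not> weak_conv_m (\<lambda>n. cumulative_spectral_measure (S n) P) \<mu>"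
proof
  let ?\<nu> = "\<lambda>n. cumulative_spectral_measure (S (Suc n)) P"
  assume "weak_conv_m (\<lambda>n. cumulative_spectral_measure (S n) P) \<mu>"
  then have w: "weak_conv_m ?\<nu> \<mu>" by (simp add: weak_conv_m_Suc_iff[of "\<lambda>n. cumulative_spectral_measure (S n) P"])
  obtain C where C: "C \<ge> 1" "AE l in \<mu>. l \<in> {-C..C}" by (rule plancherel_support)
  let ?b = "(real (q + r) - \<bar>real q - real r\<bar>) / (real (q + r))\<^sup>2"
  have "(\<lambda>n. \<integral>l. l ^ 2 \<partial>?\<nu> n) \<longlonglongrightarrow> (\<integral>l. l ^ 2 \<partial>\<mu>)"
  proof (rule weak_conv_moments_bounded_support[OF _ _ plancherel_real_distribution C(2) w])
    fix n
    interpret substochastic_matrix "S (Suc n)" P "\<lambda>_. 1" by (rule truncation_substochastic) simp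
    show "real_distribution (?\<nu> n)"
      by (rule cumulative_spectral_measure_substochastic)
    have "AE l in ?\<nu> n. l \<in> {-1..1}"
      by (rule cumulative_spectral_measure_substochastic)
    then show "AE l in ?\<nu> n. l \<in> {-C..C}" by eventually_elim (use C(1) in auto)
  qed
  moreover have "(\<integral>l. l ^ 2 \<partial>?\<nu> n) \<le> ?b" for n
  proof -
    interpret substochastic_matrix "S (Suc n)" P "\<lambda>_. 1" by (rule truncation_substochastic) simp
    obtain a1 a2 where t: "dl_tetrahedron q r T1 T2 a1 a2 (Suc n)" and Sn: "S (Suc n) = tetrahedron T1 T2 a1 a2"
      by (rule S_obtain[of "Suc n"]) auto
    interpret t: dl_tetrahedron q r T1 T2 a1 a2 "Suc n" by (fact t)
    have "(\<integral>l. l ^ 2 \<partial>?\<nu> n) = Re (\<Sum>x\<in>S (Suc n). (op ^^ 2) (kron x) x) / card (S (Suc n))"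
      by (rule cumulative_spectral_measure_substochastic)
    then show ?thesis using t.second_moment_gap unfolding Sn by simp
  qed
  ultimately have "(\<integral>l. l ^ 2 \<partial>\<mu>) \<le> ?b" by (intro LIMSEQ_le_const2) auto
  then have "1 / real (q + r) \<le> ?b"
    unfolding plancherel_moments return_two[OF root_in_DL] by simp
  moreover have "?b < 1 / real (q + r)"
  proof -
    have "?b < real (q + r) / (real (q + r))\<^sup>2"
      using q qr by (intro divide_strict_right_mono) auto
    also have "\<dots> = 1 / real (q + r)" by (simp add: power2_eq_square)
    finally show ?thesis .
  qed
  ultimately show False by simp
qed

end

end

theorem corollary6p5:
  fixes q r :: nat
    and T1 :: "'a end_tree" and T2 :: "'b end_tree"
    and S :: "nat \<Rightarrow> ('a \<times> 'b) set"
    and E :: "real set \<Rightarrow> ('a \<times> 'b \<Rightarrow> complex) \<Rightarrow> ('a \<times> 'b \<Rightarrow> complex)"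
  defines "P \<equiv> srw (DL T1 T2) (DL_adj T1 T2)"
  defines "\<mu> \<equiv> plancherel_measure (DL T1 T2) (troot T1, troot T2) E"
  assumes "q \<ge> 2" and "r \<ge> 2"
    and "homogeneous_end_tree q T1" and "homogeneous_end_tree r T2"
    and "resolution_of_identity (DL T1 T2) (mat_op (DL T1 T2) P) E"
    and "\<And>n. n \<ge> 1 \<Longrightarrow> is_tetrahedron T1 T2 n (S n)"
    and "\<And>n. n \<ge> 1 \<Longrightarrow> S n \<subseteq> S (Suc n)"
    and "(\<Union>n\<in>{1..}. S n) = DL T1 T2"
  shows "(r = q \<longrightarrow>
            weak_conv_m (\<lambda>n. cumulative_spectral_measure (S n) (srw (S n) (DL_adj T1 T2))) \<mu> \<and>
            weak_conv_m (\<lambda>n. cumulative_spectral_measure (S n) P) \<mu>) \<and>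
         (r \<noteq> q \<longrightarrow>
            \<not> weak_conv_m (\<lambda>n. cumulative_spectral_measure (S n) P) \<mu>)"
proof -
  interpret diestel_leader q r T1 T2 by unfold_locales fact+
  note E = assms(7)[unfolded P_def] and tets = assms(8)
  show ?thesis unfolding P_def \<mu>_def
  proof (intro conjI impI)
    assume qr: "r = q"
    show "weak_conv_m (\<lambda>n. cumulative_spectral_measure (S n) (srw (S n) (DL_adj T1 T2)))
        (plancherel_measure (DL T1 T2) (troot T1, troot T2) E)"
    proof (rule weak_conv_of_interior_agreement[OF E tets qr[symmetric] walk_substochastic[OF E tets]])
      fix n a1 a2 assume "dl_tetrahedron q r T1 T2 a1 a2 n" and Sn: "S n = tetrahedron T1 T2 a1 a2"
      then interpret dl_tetrahedron q r T1 T2 a1 a2 n by simp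
      show "interior_agrees (srw (S n) (DL_adj T1 T2))" unfolding Sn by (rule interior_agrees_srw)
    qed
    show "weak_conv_m (\<lambda>n. cumulative_spectral_measure (S n) (srw (DL T1 T2) (DL_adj T1 T2)))
        (plancherel_measure (DL T1 T2) (troot T1, troot T2) E)"
    proof (rule weak_conv_of_interior_agreement[OF E tets qr[symmetric]])
      fix n a1 a2 assume "dl_tetrahedron q r T1 T2 a1 a2 n"
      then interpret dl_tetrahedron q r T1 T2 a1 a2 n by simp
      show "interior_agrees (srw (DL T1 T2) (DL_adj T1 T2))" by (rule interior_agrees_P)
    next
      fix n :: nat assume "n \<ge> 1"
      then show "\<exists>d. substochastic_matrix (S n) (srw (DL T1 T2) (DL_adj T1 T2)) d"
        using truncation_substochastic[OF E tets] by (intro exI)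
    qed
  next
    assume "r \<noteq> q"
    then show "\<not> weak_conv_m (\<lambda>n. cumulative_spectral_measure (S n) (srw (DL T1 T2) (DL_adj T1 T2)))
        (plancherel_measure (DL T1 T2) (troot T1, troot T2) E)"
      using not_weak_conv[OF E tets] by auto
  qed
qed

end
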